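(* For two-qubit unitaries $U$ with quasiprobability extent $\gamma(U)$, let $\gamma_{\min}(\cdot)$ and $\gamma_{\max}(\cdot)$ denote the minimum and maximum of $\gamma(U)$ over all two-qubit unitaries with the given value of the indicated descriptor. The following lower and upper envelopes are sharp (the stated values are attained at every descriptor value). (i) Operator entanglement. For $0\le E_{\mathrm{op}}\le 3/4$, $$\gamma_{\min}(E_{\mathrm{op}})=\begin{cases}1+2\sqrt{2E_{\mathrm{op}}}, & 0\le E_{\mathrm{op}}\le\frac12,\\ 3+4\sqrt{4E_{\mathrm{op}}-2}, & \frac12\le E_{\mathrm{op}}\le\frac34.\end{cases}$$ The spectrum attaining the lower envelope changes at $E_{\mathrm{op}}=1/2$ from rank-two controlled spectra (realised by the controlled family) to pair-pair spectra (for which the CNOT--SWAP family is a canonical representative). The upper envelope is attained by the fractional SWAP family and is $$\gamma_{\max}(E_{\mathrm{op}})=4-3q_E+3\sqrt{(1-q_E)(1+3q_E)},\qquad q_E=\sqrt{1-\tfrac43E_{\mathrm{op}}}.$$ (ii) Schmidt strength. For $u\in[0,1]$ let $z(u)$ denote the unique $z\in[1/2,1]$ satisfying $h_2(z)=u$. Then for $0\le K_{\mathrm{Sch}}\le 2$, $$\gamma_{\min}(K_{\mathrm{Sch}})=\begin{cases}1+4\sqrt{z(K_{\mathrm{Sch}})\,[1-z(K_{\mathrm{Sch}})]}, & 0\le K_{\mathrm{Sch}}\le1,\\ 3+8\sqrt{z(K_{\mathrm{Sch}}-1)\,[1-z(K_{\mathrm{Sch}}-1)]}, & 1\le K_{\mathrm{Sch}}\le2.\end{cases}$$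 The spectrum attaining the lower envelope changes at $K_{\mathrm{Sch}}=1$ from rank-two controlled spectra to pair-pair spectra (for which the CNOT--SWAP family is a canonical representative). The upper envelope is attained by the fractional SWAP family and is given parametrically by $$K_{\mathrm{FS}}(x)=h_2\!\left(\tfrac{3x}{4}\right)+\tfrac{3x}{4}\log_23,\qquad \gamma_{\mathrm{FS}}(x)=1+3x+3\sqrt{x(4-3x)},\qquad 0\le x\le1,$$ that is, $\gamma_{\max}(K_{\mathrm{FS}}(x))=\gamma_{\mathrm{FS}}(x)$ for $0\le x\le1$; the function $K_{\mathrm{FS}}$ is strictly increasing on $[0,1]$, so this parametric curve defines a unique function $\gamma_{\max}(K_{\mathrm{Sch}})$.
   Context: Cartan form. Every two-qubit unitary $U\in U(4)$ can be written $U=(V_1\otimes V_2)\,U_{\mathrm d}\,(V_3\otimes V_4)$ with single-qubit unitaries $V_j$ and $U_{\mathrm d}=U_{\mathrm d}(\theta_1,\theta_2,\theta_3)=\exp[\mathrm i(\theta_1X\otimes X+\theta_2Y\otimes Y+\theta_3Z\otimes Z)]$, where $X,Y,Z$ are the Pauli matrices and $|\theta_3|\le\theta_2\le\theta_1\le\pi/4$. A "family" $(\theta_1(\theta),\theta_2(\theta),\theta_3(\theta))$ means the gates $U_{\mathrm d}(\theta_1(\theta),\theta_2(\theta),\theta_3(\theta))$ for $0\le\theta\le\pi/4$. The families used are: controlled $(\theta,0,0)$; CNOT--SWAP $(\pi/4,\theta,\theta)$; fractional SWAP $(\theta,\theta,\theta)$. Operator-Schmidt spectrum. Write $U_{\mathrm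 d}=\sum_{j=0}^3u_j\,\sigma_j\otimes\sigma_j$ with $\sigma_0=\mathbb I,\sigma_1=X,\sigma_2=Y,\sigma_3=Z$, and put $p_j=|u_j|^2$, so $\sum_jp_j=1$. (Intrinsically, the operator-Schmidt singular values of $U$ with respect to Hilbert--Schmidt-orthonormal local operator bases are $2\sqrt{p_j}$.) Explicitly, with $c_j=\cos\theta_j$, $s_j=\sin\theta_j$: $p_0=c_1^2c_2^2c_3^2+s_1^2s_2^2s_3^2$, $p_1=s_1^2c_2^2c_3^2+c_1^2s_2^2s_3^2$, $p_2=c_1^2s_2^2c_3^2+s_1^2c_2^2s_3^2$, $p_3=c_1^2c_2^2s_3^2+s_1^2s_2^2c_3^2$. Up to permutation, a rank-two controlled spectrum has the form $(t,1-t,0,0)$ with $\frac12\le t\le1$ (including the rank-one limit $t=1$), and a pair-pair spectrum has the form $(\frac t2,\frac t2,\frac{1-t}2,\frac{1-t}2)$ with $\frac12\le t\le1$. Quasiprobability extent. $\gamma(U)$ is the optimal gate-cutting (quasiprobability decomposition) cost of $U$; for two-qubit unitaries it is given by the known formula, taken here as its definition, $\gamma(U)=2\big(\sum_{j=0}^3\sqrt{p_j}\big)^2-1$. Descriptors. Operator entanglement: $E_{\mathrm{op}}(U)=1-\sum_{j=0}^3p_j^2\in[0,3/4]$. Schmidt strength: $K_{\mathrm{Sch}}(U)=-\sum_{j=0}^3p_j\log_2p_j\in[0,2]$. Binary entropy: $h_2(x)=-x\log_2x-(1-x)\log_2(1-x)$, with $0\log_20=0$. *)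

theory Defs
  imports "HOL-Analysis.Analysis" "HOL-Library.Multiset"
begin

section \<open>One- and two-qubit gates\<close>

type_synonym op1 = "complex^2^2"
type_synonym op2 = "complex^(2 \<times> 2)^(2 \<times> 2)"

definition conj_transpose :: "complex^'n^'m \<Rightarrow> complex^'m^'n" where
  "conj_transpose A = (\<chi> i j. cnj (A $ j $ i))"

definition unitary :: "complex^'n^'n \<Rightarrow> bool" where
  "unitary A \<longleftrightarrow> conj_transpose A ** A = mat 1 \<and> A ** conj_transpose A = mat 1"

definition two_qubit_unitaries :: "op2 set" where
  "two_qubit_unitaries = {U. unitary U}"

definition cscale :: "complex \<Rightarrow> complex^'n^'m \<Rightarrow> complex^'n^'m" where
  "cscale c A = (\<chi> i j. c * A $ i $ j)"

definition kron :: "op1 \<Rightarrow> op1 \<Rightarrow> op2" where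
  "kron A B = (\<chi> i j. A $ fst i $ fst j * B $ snd i $ snd j)"

text \<open>Powers are iterated matrix products: the class operations \<open>*\<close> and \<open>^\<close> on
  \<open>vec\<close> are componentwise.\<close>

definition mat_exp :: "complex^'n^'n \<Rightarrow> complex^'n^'n" where
  "mat_exp A = (\<Sum>n. (1 / fact n) *\<^sub>R (((\<lambda>B. A ** B) ^^ n) (mat 1)))"

text \<open>The row and column indices \<open>1, 2 :: 2\<close> stand for the basis states
  \<open>|0>\<close> and \<open>|1>\<close>.\<close>

definition pauli_X :: op1 where
  "pauli_X = vector [vector [0, 1], vector [1, 0]]"

definition pauli_Y :: op1 where
  "pauli_Y = vector [vector [0, - \<i>], vector [\<i>, 0]]"

definition pauli_Z :: op1 where
  "pauli_Z = vector [vector [1, 0], vector [0, - 1]]"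

definition pauli :: "nat \<Rightarrow> op1" where
  "pauli j = [mat 1, pauli_X, pauli_Y, pauli_Z] ! j"


section \<open>Cartan form and operator-Schmidt spectrum\<close>

definition Ud :: "real \<Rightarrow> real \<Rightarrow> real \<Rightarrow> op2" where
  "Ud \<theta>1 \<theta>2 \<theta>3 = mat_exp (cscale \<i>
     (\<theta>1 *\<^sub>R kron pauli_X pauli_X + \<theta>2 *\<^sub>R kron pauli_Y pauli_Y
        + \<theta>3 *\<^sub>R kron pauli_Z pauli_Z))"

definition cartan_form :: "op2 \<Rightarrow> real \<Rightarrow> real \<Rightarrow> real \<Rightarrow> bool" where
  "cartan_form U \<theta>1 \<theta>2 \<theta>3 \<longleftrightarrow>
     \<bar>\<theta>3\<bar> \<le> \<theta>2 \<and> \<theta>2 \<le> \<theta>1 \<and> \<theta>1 \<le> pi / 4 \<and>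
     (\<exists>V1 V2 V3 V4. unitary V1 \<and> unitary V2 \<and> unitary V3 \<and> unitary V4 \<and>
        U = kron V1 V2 ** Ud \<theta>1 \<theta>2 \<theta>3 ** kron V3 V4)"

definition is_schmidt_spectrum :: "op2 \<Rightarrow> real multiset \<Rightarrow> bool" where
  "is_schmidt_spectrum U P \<longleftrightarrow>
     (\<exists>\<theta>1 \<theta>2 \<theta>3 u. cartan_form U \<theta>1 \<theta>2 \<theta>3 \<and>
        Ud \<theta>1 \<theta>2 \<theta>3 = (\<Sum>j<4. cscale (u j) (kron (pauli j) (pauli j))) \<and>
        P = {# (cmod (u j))\<^sup>2. j \<in># mset_set {..<4} #})"

text \<open>The spectrum is the multiset \<open>{# p\<^sub>0, p\<^sub>1, p\<^sub>2, p\<^sub>3 #}\<close>, i.e. the \<open>p\<^sub>j\<close> up to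
  permutation. Every two-qubit unitary has a Cartan form, and the multiset does not depend on its
  choice, since the \<open>2 sqrt p\<^sub>j\<close> are the operator-Schmidt singular values; hence the
  definite description is meaningful on \<^const>\<open>two_qubit_unitaries\<close>.\<close>

definition schmidt_spectrum :: "op2 \<Rightarrow> real multiset" where
  "schmidt_spectrum U = (THE P. is_schmidt_spectrum U P)"

definition rank_two_controlled :: "real multiset \<Rightarrow> bool" where
  "rank_two_controlled P \<longleftrightarrow> (\<exists>t\<in>{1/2..1}. P = {# t, 1 - t, 0, 0 #})"

definition pair_pair :: "real multiset \<Rightarrow> bool" where
  "pair_pair P \<longleftrightarrow> (\<exists>t\<in>{1/2..1}. P = {# t / 2, t / 2, (1 - t) / 2, (1 - t) / 2 #})"

definition controlled :: "real \<Rightarrow> op2" where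
  "controlled \<theta> = Ud \<theta> 0 0"

definition cnot_swap :: "real \<Rightarrow> op2" where
  "cnot_swap \<theta> = Ud (pi / 4) \<theta> \<theta>"

definition fractional_swap :: "real \<Rightarrow> op2" where
  "fractional_swap \<theta> = Ud \<theta> \<theta> \<theta>"


section \<open>Quasiprobability extent and descriptors\<close>

definition qp_extent :: "op2 \<Rightarrow> real" where
  "qp_extent U = 2 * (\<Sum>p\<in>#schmidt_spectrum U. sqrt p)\<^sup>2 - 1"

definition op_entanglement :: "op2 \<Rightarrow> real" where
  "op_entanglement U = 1 - (\<Sum>p\<in>#schmidt_spectrum U. p\<^sup>2)"

text \<open>The convention \<open>0 log 0 = 0\<close> holds because the real logarithm is total and
  multiplied by \<open>0\<close>.\<close>

definition schmidt_strength :: "op2 \<Rightarrow> real" where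
  "schmidt_strength U = - (\<Sum>p\<in>#schmidt_spectrum U. p * log 2 p)"

definition h2 :: "real \<Rightarrow> real" where
  "h2 x = - x * log 2 x - (1 - x) * log 2 (1 - x)"

definition h2_inv :: "real \<Rightarrow> real" where
  "h2_inv u = (THE z. z \<in> {1/2..1} \<and> h2 z = u)"

definition K_FS :: "real \<Rightarrow> real" where
  "K_FS x = h2 (3 * x / 4) + 3 * x / 4 * log 2 3"

definition gamma_FS :: "real \<Rightarrow> real" where
  "gamma_FS x = 1 + 3 * x + 3 * sqrt (x * (4 - 3 * x))"


section \<open>Envelopes\<close>

definition is_gamma_min :: "(op2 \<Rightarrow> real) \<Rightarrow> real \<Rightarrow> real \<Rightarrow> bool" where
  "is_gamma_min D d m \<longleftrightarrow>
     (\<exists>U\<in>two_qubit_unitaries. D U = d \<and> qp_extent U = m) \<and>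
     (\<forall>U\<in>two_qubit_unitaries. D U = d \<longrightarrow> m \<le> qp_extent U)"

definition is_gamma_max :: "(op2 \<Rightarrow> real) \<Rightarrow> real \<Rightarrow> real \<Rightarrow> bool" where
  "is_gamma_max D d m \<longleftrightarrow>
     (\<exists>U\<in>two_qubit_unitaries. D U = d \<and> qp_extent U = m) \<and>
     (\<forall>U\<in>two_qubit_unitaries. D U = d \<longrightarrow> qp_extent U \<le> m)"

definition attained_by :: "(real \<Rightarrow> op2) \<Rightarrow> (op2 \<Rightarrow> real) \<Rightarrow> real \<Rightarrow> real \<Rightarrow> bool" where
  "attained_by G D d g \<longleftrightarrow> (\<exists>\<theta>\<in>{0..pi/4}. D (G \<theta>) = d \<and> qp_extent (G \<theta>) = g)"

text \<open>At descriptor value \<open>d\<close>, the gates with \<open>qp_extent\<close> equal to \<open>g\<close> are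
  exactly those whose spectrum has the form \<open>S\<close>.\<close>

definition attaining_spectrum ::
    "(real multiset \<Rightarrow> bool) \<Rightarrow> (op2 \<Rightarrow> real) \<Rightarrow> real \<Rightarrow> real \<Rightarrow> bool" where
  "attaining_spectrum S D d g \<longleftrightarrow>
     (\<forall>U\<in>two_qubit_unitaries. D U = d \<longrightarrow>
        (qp_extent U = g \<longleftrightarrow> S (schmidt_spectrum U)))"

end

theory Submission
  imports Defs "HOL-Real_Asymp.Real_Asymp"
begin

text \<open>Conjugation by the magic basis turns real orthogonal matrices into local gates, possibly times
  SWAP, and the diagonal matrices into the gates \<open>Ud\<close> up to a phase. Writing a unitary as
  \<open>O\<^sub>1 D O\<^sub>2\<close> with \<open>O\<^sub>1, O\<^sub>2\<close> orthogonal and \<open>D\<close> diagonal therefore gives its Cartan form. With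
  \<open>A \<ge> B \<ge> C \<ge> 0\<close> the pairwise products of the \<open>cos 2\<theta>\<^sub>j\<close>, the spectrum is \<open>(1 \<plusminus> A \<plusminus> B \<plusminus> C) / 4\<close> with an
  even number of minus signs, and unitarity leaves the single constraint \<open>A B \<le> C\<close>, that is
  \<open>p\<^sub>1 p\<^sub>2 \<le> p\<^sub>0 p\<^sub>3\<close> for the sorted spectrum.

  For a fixed sum of \<open>p\<^sup>2\<close> or of \<open>p ln p\<close>, the upper envelopes and the rank-two lower envelopes follow by
  interpolating the square root at the extremal probabilities by a combination of 1, \<open>p\<close> and the
  constrained function: the error has constant sign on the range of the competitors. (For the
  operator entanglement the rank-two bound is just subadditivity of the square root.) The pair-pair
  envelopes use the constraint. For the operator entanglement it gives
  \<open>16 sqrt (p\<^sub>0 p\<^sub>1 p\<^sub>2 p\<^sub>3) \<ge> 1 - A\<^sup>2 - B\<^sup>2 - C\<^sup>2\<close>, and the bound follows by pairing the products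
  \<open>sqrt (p\<^sub>i p\<^sub>j)\<close>. For the Schmidt strength, a minimiser inside the constraint could be perturbed,
  unless it is a fractional-SWAP spectrum; so it is a product distribution, for which both the
  entropy and the logarithm of the sum of square roots are additive, and the latter is a concave
  function of the former.\<close>


section \<open>Unitary matrices and Kronecker products\<close>

text \<open>The spectrum is a definite description over Cartan forms, so uniqueness has to be proved
  as well as existence: the squared singular values of the realigned gate are local invariants. The
  extent is \<open>2 Q^2 - 1\<close> with \<open>Q\<close> the sum of the square roots, so every
  bound on the extent is a bound on \<open>Q\<close>. The unitarity constraint cannot be avoided in
  the pair-pair regimes: the distribution (1/3, 1/3, 1/3, 0) would give extent 5, below both lower
  envelopes at its descriptor values, and it violates \<open>p1 p2 <= p0 p3\<close>. The constrained
  domain \<open>dominant\<close> is not convex, hence the argument by a minimiser for the Schmidt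
  strength: moving three probabilities with fixed sum leaves two free parameters, just enough to
  lower \<open>Q\<close> while raising the entropy. Such a move needs three distinct values and room
  inside the constraint; what it cannot treat is a tight constraint or three equal small
  probabilities.\<close>

lemma sum_UNIV_prod:
  fixes f :: "'a::finite \<times> 'b::finite \<Rightarrow> 'c::comm_monoid_add"
  shows "(\<Sum>k\<in>UNIV. f k) = (\<Sum>a\<in>UNIV. \<Sum>b\<in>UNIV. f (a, b))"
  by (simp add: sum.cartesian_product flip: UNIV_Times_UNIV)

lemma conj_transpose_nth [simp]: "conj_transpose A $ i $ j = cnj (A $ j $ i)"
  by (simp add: conj_transpose_def)

lemma conj_transpose_conj_transpose [simp]: "conj_transpose (conj_transpose A) = A"
  by (simp add: vec_eq_iff)

lemma conj_transpose_matrix_mult: "conj_transpose (A ** B) = conj_transpose B ** conj_transpose A"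
  by (simp add: vec_eq_iff matrix_matrix_mult_def mult.commute)

lemma conj_transpose_mat_1 [simp]: "conj_transpose (mat 1) = mat 1"
  by (simp add: vec_eq_iff mat_def)

lemma unitary_conj_transpose [simp]: "unitary (conj_transpose A) \<longleftrightarrow> unitary A"
  by (auto simp: unitary_def)

lemma unitary_mult: "unitary A \<Longrightarrow> unitary B \<Longrightarrow> unitary (A ** B)"
  unfolding unitary_def conj_transpose_matrix_mult
  by (metis matrix_mul_assoc matrix_mul_lid)

lemma unitary_mat_1 [simp]: "unitary (mat 1)"
  by (simp add: unitary_def)

lemma unitaryI: "conj_transpose A ** A = mat 1 \<Longrightarrow> unitary A"
  by (simp add: unitary_def matrix_left_right_inverse)

lemma cscale_nth [simp]: "cscale c A $ i $ j = c * A $ i $ j"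
  by (simp add: cscale_def)

lemma cscale_mult_left: "cscale c A ** B = cscale c (A ** B)"
  by (simp add: vec_eq_iff matrix_matrix_mult_def sum_distrib_left mult.assoc)

lemma cscale_mult_right: "A ** cscale c B = cscale c (A ** B)"
  by (simp add: vec_eq_iff matrix_matrix_mult_def sum_distrib_left mult_ac)

lemma cscale_cscale: "cscale c (cscale d A) = cscale (c * d) A"
  by (simp add: vec_eq_iff mult.assoc)

lemma conj_transpose_cscale: "conj_transpose (cscale c A) = cscale (cnj c) (conj_transpose A)"
  by (simp add: vec_eq_iff)

lemma cnj_mult_self_unit: "cmod z = 1 \<Longrightarrow> cnj z * z = 1"
  by (metis complex_norm_square mult.commute of_real_1 power_one)

lemma unitary_cscale: "unitary A \<Longrightarrow> cmod c = 1 \<Longrightarrow> unitary (cscale c A)"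
  using cnj_mult_self_unit[of c]
  by (intro unitaryI)
     (simp add: unitary_def conj_transpose_cscale cscale_mult_left cscale_mult_right cscale_cscale,
      simp add: vec_eq_iff mult.commute)

lemma kron_nth [simp]: "kron A B $ (i, k) $ (j, l) = A $ i $ j * B $ k $ l"
  by (simp add: kron_def)

lemma kron_mult: "kron A B ** kron C D = kron (A ** C) (B ** D)"
  by (simp add: vec_eq_iff kron_def matrix_matrix_mult_def sum_UNIV_prod sum_product mult_ac)

lemma conj_transpose_kron: "conj_transpose (kron A B) = kron (conj_transpose A) (conj_transpose B)"
  by (simp add: vec_eq_iff)

lemma kron_mat_1 [simp]: "kron (mat 1) (mat 1) = mat 1"
  by (simp add: vec_eq_iff mat_def)

lemma unitary_kron: "unitary A \<Longrightarrow> unitary B \<Longrightarrow> unitary (kron A B)"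
  by (rule unitaryI) (simp add: conj_transpose_kron kron_mult unitary_def)

lemma kron_cscale_left: "kron (cscale c A) B = cscale c (kron A B)"
  by (simp add: vec_eq_iff)


section \<open>Simultaneous diagonalisation\<close>

text \<open>A maximiser \<open>v\<close> of the Rayleigh quotient on the unit sphere of
  \<open>W\<close> is an eigenvector. The residual \<open>z = l v - f v\<close> stays in
  \<open>W\<close>, so moving \<open>v\<close> along it is an admissible test of maximality.\<close>

lemma self_adjoint_eigenvector:
  fixes f :: "'a::euclidean_space \<Rightarrow> 'a"
  assumes f: "linear f" and adj: "\<And>x y. f x \<bullet> y = x \<bullet> f y"
    and W: "subspace W" "f ` W \<subseteq> W" "W \<noteq> {0}"
  obtains v l where "v \<in> W" "norm v = 1" "f v = l *\<^sub>R v"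
proof -
  let ?K = "sphere 0 1 \<inter> W"
  obtain w where w: "w \<in> W" "w \<noteq> 0"
    using W subspace_0 by blast
  then have "w /\<^sub>R norm w \<in> ?K"
    using W(1) by (simp add: subspace_scale)
  moreover have "compact ?K"
    using W(1) by (simp add: closed_subspace compact_Int_closed)
  moreover have "continuous_on ?K (\<lambda>x. x \<bullet> f x)"
    by (intro continuous_intros linear_continuous_on) (use f linear_conv_bounded_linear in blast)
  ultimately obtain v where v: "v \<in> ?K" and max: "\<And>y. y \<in> ?K \<Longrightarrow> y \<bullet> f y \<le> v \<bullet> f v"
    by (metis (no_types, lifting) continuous_attains_sup empty_iff)
  define l where "l = v \<bullet> f v"
  have vv: "v \<bullet> v = 1" using v by (simp add: dot_square_norm)
  have ge: "y \<bullet> f y \<le> l * (y \<bullet> y)" if "y \<in> W" for y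
  proof (cases "y = 0")
    case False
    then have "y /\<^sub>R norm y \<in> ?K"
      using W(1) that by (simp add: subspace_scale)
    from max[OF this] False show ?thesis
      by (simp add: linear_cmul[OF f] l_def dot_square_norm field_simps power2_eq_square)
  qed (simp add: linear_0[OF f])
  define z where "z = l *\<^sub>R v - f v"
  have z: "z \<in> W" using v W by (auto simp: z_def intro!: subspace_diff subspace_scale)
  have "z \<bullet> z = 0"
  proof (rule ccontr)
    assume ne: "z \<bullet> z \<noteq> 0"
    define a where "a = z \<bullet> z"
    define b where "b = l * (z \<bullet> z) - z \<bullet> f z"
    have a: "a > 0" using ne by (simp add: a_def)
    \<comment> \<open>Maximality at \<open>v + t z\<close>: the linear coefficient is twice the
      squared residual, so a small negative \<open>t\<close> would break the inequality unless the
      residual vanishes.\<close>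
    have quad: "0 \<le> 2 * t * a + t\<^sup>2 * b" for t
    proof -
      have "v + t *\<^sub>R z \<in> W" using v z W(1) by (auto intro!: subspace_add subspace_scale)
      from ge[OF this] have "0 \<le> l * ((v + t *\<^sub>R z) \<bullet> (v + t *\<^sub>R z)) - (v + t *\<^sub>R z) \<bullet> f (v + t *\<^sub>R z)"
        by simp
      also have "\<dots> = (l * (v \<bullet> v) - v \<bullet> f v) + t * (2 * l * (v \<bullet> z) - v \<bullet> f z - z \<bullet> f v) + t\<^sup>2 * b"
        unfolding b_def linear_add[OF f] linear_cmul[OF f]
        by (simp add: inner_add_left inner_add_right inner_commute power2_eq_square algebra_simps)
      also have "v \<bullet> f z = z \<bullet> f v"
        using adj by (metis inner_commute)
      also have "2 * l * (v \<bullet> z) - z \<bullet> f v - z \<bullet> f v = 2 * a"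
        unfolding a_def by (simp add: z_def inner_diff_left inner_diff_right inner_commute algebra_simps)
      finally show ?thesis by (simp add: vv l_def algebra_simps)
    qed
    \<comment> \<open>The denominator \<open>1 + |b|\<close> keeps \<open>|t b| <= a\<close>
      whatever the sign of \<open>b\<close>, including \<open>b = 0\<close>.\<close>
    define t where "t = - (a / (1 + \<bar>b\<bar>))"
    have t: "t < 0" "\<bar>t\<bar> * \<bar>b\<bar> \<le> a"
      using a by (auto simp: t_def field_simps abs_mult)
    have "t * b \<ge> - a" using t(2) abs_ge_minus_self[of "t * b"] by (simp add: abs_mult)
    then have "2 * a + t * b > 0" using a by linarith
    then have "t * (2 * a + t * b) < 0" using t(1) by (simp add: mult_neg_pos)
    with quad[of t] show False by (simp add: power2_eq_square algebra_simps)
  qed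
  then have "f v = l *\<^sub>R v" by (simp add: z_def)
  with that v show ?thesis by auto
qed

text \<open>\<open>g\<close> preserves the eigenspaces of \<open>f\<close> in \<open>W\<close>, so
  an eigenvector of \<open>g\<close> can be sought inside one of them.\<close>

lemma commuting_self_adjoint_eigenvector:
  fixes f g :: "'a::euclidean_space \<Rightarrow> 'a"
  assumes f: "linear f" "\<And>x y. f x \<bullet> y = x \<bullet> f y"
    and g: "linear g" "\<And>x y. g x \<bullet> y = x \<bullet> g y"
    and comm: "\<And>x. f (g x) = g (f x)"
    and W: "subspace W" "f ` W \<subseteq> W" "g ` W \<subseteq> W" "W \<noteq> {0}"
  obtains v a b where "v \<in> W" "norm v = 1" "f v = a *\<^sub>R v" "g v = b *\<^sub>R v"
proof -
  obtain v a where v: "v \<in> W" "norm v = 1" "f v = a *\<^sub>R v"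
    by (rule self_adjoint_eigenvector[OF f W(1,2,4)])
  let ?V = "{x \<in> W. f x = a *\<^sub>R x}"
  have "subspace ?V"
    using W(1) by (auto simp: subspace_def linear_add[OF f(1)] linear_cmul[OF f(1)] linear_0[OF f(1)] scaleR_add_right)
  moreover have "g ` ?V \<subseteq> ?V"
    using W(3) comm by (auto simp: linear_cmul[OF g(1)])
  moreover have "?V \<noteq> {0}" using v by (metis (mono_tags, lifting) mem_Collect_eq norm_zero singletonD zero_neq_one)
  ultimately obtain w b where "w \<in> ?V" "norm w = 1" "g w = b *\<^sub>R w"
    using self_adjoint_eigenvector[OF g] by blast
  with that show ?thesis by blast
qed

text \<open>An orthonormal family of joint eigenvectors of largest cardinality spans:
  self-adjointness makes its orthogonal complement invariant, and a nonzero complement would contain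
  one more joint eigenvector.\<close>

lemma commuting_self_adjoint_eigenbasis:
  fixes f g :: "real^'n \<Rightarrow> real^'n"
  assumes f: "linear f" "\<And>x y. f x \<bullet> y = x \<bullet> f y"
    and g: "linear g" "\<And>x y. g x \<bullet> y = x \<bullet> g y"
    and comm: "\<And>x. f (g x) = g (f x)"
  shows "\<exists>(e :: 'n \<Rightarrow> real^'n) a b. (\<forall>i j. e i \<bullet> e j = (if i = j then 1 else 0)) \<and>
    (\<forall>i. f (e i) = a i *\<^sub>R e i) \<and> (\<forall>i. g (e i) = b i *\<^sub>R e i)"
proof -
  define good where "good B \<longleftrightarrow> pairwise orthogonal B \<and>
      (\<forall>v\<in>B. norm v = 1 \<and> (\<exists>a. f v = a *\<^sub>R v) \<and> (\<exists>b. g v = b *\<^sub>R v))" for B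
  have ind: "independent B" if "good B" for B
    using that pairwise_orthogonal_independent[of B] unfolding good_def by force
  have bound: "card B \<le> CARD('n)" if "good B" for B
    using independent_card_le[OF ind[OF that]] by simp
  have "good {}" by (simp add: good_def)
  then obtain B where B: "good B" and max: "\<And>C. good C \<Longrightarrow> card C \<le> card B"
    using ex_has_greatest_nat[of good "{}" card "Suc (CARD('n))"] bound by (metis less_Suc_eq_le)
  have fin: "finite B" using ind[OF B] independent_bound by blast
  have "span B = UNIV"
  proof (rule ccontr)
    assume ne: "span B \<noteq> UNIV"
    let ?W = "{x. \<forall>v\<in>B. v \<bullet> x = 0}"
    have "subspace ?W" by (simp add: subspace_def inner_add_right)
    moreover have "f ` ?W \<subseteq> ?W"
    proof clarsimp
      fix x v assume x: "\<forall>v\<in>B. v \<bullet> x = 0" and v: "v \<in> B"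
      then obtain a where "f v = a *\<^sub>R v" using B by (auto simp: good_def)
      with x v show "v \<bullet> f x = 0" using f(2)[of v x] by simp
    qed
    moreover have "g ` ?W \<subseteq> ?W"
    proof clarsimp
      fix x v assume x: "\<forall>v\<in>B. v \<bullet> x = 0" and v: "v \<in> B"
      then obtain a where "g v = a *\<^sub>R v" using B by (auto simp: good_def)
      with x v show "v \<bullet> g x = 0" using g(2)[of v x] by simp
    qed
    moreover have "?W \<noteq> {0}"
    proof -
      obtain x where "x \<noteq> 0" "\<And>y. y \<in> span B \<Longrightarrow> orthogonal x y"
        using orthogonal_to_subspace_exists_gen[of B UNIV] ne by (auto simp: span_UNIV psubset_eq)
      then have "x \<in> ?W" "x \<noteq> 0" by (auto simp: orthogonal_def inner_commute span_base)
      then show ?thesis by blast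
    qed
    ultimately obtain v a b where v: "v \<in> ?W" "norm v = 1" "f v = a *\<^sub>R v" "g v = b *\<^sub>R v"
      by (rule commuting_self_adjoint_eigenvector[where f = f and g = g and W = ?W, OF f g comm])
    then have "v \<notin> B" by (metis (mono_tags) inner_eq_zero_iff mem_Collect_eq norm_zero zero_neq_one)
    moreover have "good (insert v B)"
      using B v by (auto simp: good_def pairwise_insert orthogonal_def inner_commute)
    ultimately show False using max[of "insert v B"] fin by simp
  qed
  then have "card B = CARD('n)"
    using ind[OF B] by (metis DIM_cart DIM_real dim_UNIV dim_eq_card dim_span mult.right_neutral)
  then obtain e where e: "bij_betw e (UNIV::'n set) B"
    using finite_same_card_bij[of "UNIV::'n set" B] fin by auto
  then have eB: "e i \<in> B" for i by (auto simp: bij_betw_def)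
  have "\<forall>i. \<exists>a. f (e i) = a *\<^sub>R e i" "\<forall>i. \<exists>b. g (e i) = b *\<^sub>R e i"
    using B eB by (simp_all add: good_def)
  then obtain a b where ab: "\<And>i. f (e i) = a i *\<^sub>R e i" "\<And>i. g (e i) = b i *\<^sub>R e i"
    by (auto dest!: choice)
  have orth: "e i \<bullet> e j = (if i = j then 1 else 0)" for i j
  proof (cases "i = j")
    case True
    then show ?thesis using B eB by (simp add: good_def dot_square_norm)
  next
    case False
    then have "e i \<noteq> e j" using e by (auto simp: bij_betw_def inj_on_def)
    with False show ?thesis using B eB by (auto simp: good_def pairwise_def orthogonal_def)
  qed
  show ?thesis using orth ab by (intro exI[of _ e] exI[of _ a] exI[of _ b]) simp
qed


section \<open>Factorisation of a unitary into orthogonal and diagonal matrices\<close>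

definition cpx_mat :: "real^'n^'m \<Rightarrow> complex^'n^'m" where
  "cpx_mat A = (\<chi> i j. complex_of_real (A $ i $ j))"

definition diag_mat :: "('n \<Rightarrow> complex) \<Rightarrow> complex^'n^'n" where
  "diag_mat d = (\<chi> i j. if i = j then d i else 0)"

lemma cpx_mat_nth [simp]: "cpx_mat A $ i $ j = complex_of_real (A $ i $ j)"
  by (simp add: cpx_mat_def)

lemma cpx_mat_mult: "cpx_mat (A ** B) = cpx_mat A ** cpx_mat B"
  by (simp add: vec_eq_iff matrix_matrix_mult_def)

lemma cpx_mat_1 [simp]: "cpx_mat (mat 1) = mat 1"
  by (simp add: vec_eq_iff mat_def)

lemma conj_transpose_cpx_mat: "conj_transpose (cpx_mat A) = cpx_mat (transpose A)"
  by (simp add: vec_eq_iff transpose_def)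

lemma transpose_cpx_mat: "transpose (cpx_mat A) = cpx_mat (transpose A)"
  by (simp add: vec_eq_iff transpose_def)

lemma unitary_cpx_mat: "orthogonal_matrix A \<Longrightarrow> unitary (cpx_mat A)"
  by (rule unitaryI) (simp add: conj_transpose_cpx_mat orthogonal_matrix_def flip: cpx_mat_mult)

lemma diag_mat_nth: "diag_mat d $ i $ j = (if i = j then d i else 0)"
  by (simp add: diag_mat_def)

lemma mult_diag_mat: "(A ** diag_mat d) $ i $ j = A $ i $ j * d j"
  by (simp add: matrix_matrix_mult_def diag_mat_nth if_distrib cong: if_cong)

lemma diag_mat_mult_left: "(diag_mat d ** A) $ i $ j = d i * A $ i $ j"
  by (simp add: matrix_matrix_mult_def diag_mat_nth if_distrib if_distribR cong: if_cong)

lemma diag_mat_mult: "diag_mat d ** diag_mat e = diag_mat (\<lambda>i. d i * e i)"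
  by (simp add: vec_eq_iff diag_mat_mult_left diag_mat_nth)

lemma diag_mat_1: "diag_mat (\<lambda>_. 1) = mat 1"
  by (simp add: vec_eq_iff diag_mat_nth mat_def)

lemma conj_transpose_diag_mat: "conj_transpose (diag_mat d) = diag_mat (\<lambda>i. cnj (d i))"
  by (simp add: vec_eq_iff diag_mat_nth)

lemma transpose_diag_mat [simp]: "transpose (diag_mat d) = diag_mat d"
  by (simp add: vec_eq_iff diag_mat_nth transpose_def)

lemma unitary_diag_mat: "(\<And>i. cmod (d i) = 1) \<Longrightarrow> unitary (diag_mat d)"
  by (rule unitaryI)
     (simp add: conj_transpose_diag_mat diag_mat_mult cnj_mult_self_unit diag_mat_1)

lemma unitary_transpose: "unitary A \<Longrightarrow> unitary (transpose A)"
proof (rule unitaryI)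
  assume "unitary A"
  then have "transpose (conj_transpose A ** A) = mat 1" "transpose (A ** conj_transpose A) = mat 1"
    by (simp_all add: unitary_def transpose_mat)
  then show "conj_transpose (transpose A) ** transpose A = mat 1"
    by (simp add: matrix_matrix_mult_def vec_eq_iff transpose_def mult.commute)
qed

text \<open>If \<open>U = O1 D O2\<close>, then \<open>U^T U = O2^T D^2 O2\<close>. So
  \<open>O2\<close> has to come from a real eigenbasis of the symmetric unitary
  \<open>S = U^T U\<close>, and the remaining factor \<open>W = U R D^(-1)\<close> turns out to be
  real.\<close>

lemma unitary_orthogonal_diagonal:
  fixes U :: "complex^'n^'n"
  assumes U: "unitary U"
  obtains O1 O2 :: "real^'n^'n" and d
  where "orthogonal_matrix O1" "orthogonal_matrix O2" "\<forall>i. cmod (d i) = 1"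
    "U = cpx_mat O1 ** diag_mat d ** cpx_mat O2"
proof -
  define S where "S = transpose U ** U"
  have "transpose S = S" by (simp add: S_def matrix_transpose_mul)
  then have sym: "S $ i $ j = S $ j $ i" for i j
    by (simp add: vec_eq_iff transpose_def)
  have "unitary S" unfolding S_def by (intro unitary_mult unitary_transpose U)
  define P :: "real^'n^'n" where "P = (\<chi> i j. Re (S $ i $ j))"
  define Q :: "real^'n^'n" where "Q = (\<chi> i j. Im (S $ i $ j))"
  have "(conj_transpose S ** S) $ i $ j = (mat 1 :: complex^'n^'n) $ i $ j" for i j
    using \<open>unitary S\<close> by (simp add: unitary_def)
  then have SS: "(\<Sum>k\<in>UNIV. cnj (S $ i $ k) * S $ k $ j) = (if i = j then 1 else 0)" for i j
    by (simp add: matrix_matrix_mult_def mat_def sym[of i])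
  \<comment> \<open>Real part of \<open>conj(S) S = 1\<close> with \<open>S = P + i Q\<close>; the
    imaginary part says that \<open>P\<close> and \<open>Q\<close> commute, which permits a common
    eigenbasis.\<close>
  have PQ1: "P ** P + Q ** Q = mat 1"
    unfolding vec_eq_iff
  proof (intro allI)
    fix i j
    show "(P ** P + Q ** Q) $ i $ j = (mat 1 :: real^'n^'n) $ i $ j"
      using arg_cong[OF SS, of Re, of i j]
      by (simp add: matrix_matrix_mult_def mat_def P_def Q_def sum.distrib if_distrib cong: if_cong)
  qed
  have PQ: "P ** Q = Q ** P"
    unfolding vec_eq_iff
  proof (intro allI)
    fix i j :: 'n
    have "Im (if i = j then 1 else 0) = 0" by simp
    then show "(P ** Q) $ i $ j = (Q ** P) $ i $ j"
      using arg_cong[OF SS, of Im, of i j]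
      by (simp add: matrix_matrix_mult_def P_def Q_def sum_subtractf)
  qed
  have adj: "(A *v x) \<bullet> y = x \<bullet> (A *v y)" if "transpose A = A" for A :: "real^'n^'n" and x y
    by (metis dot_lmul_matrix that transpose_matrix_vector)
  have "transpose P = P" "transpose Q = Q"
    by (simp_all add: P_def Q_def vec_eq_iff transpose_def sym)
  note adj = adj[OF this(1)] adj[OF this(2)]
  have comm: "P *v (Q *v x) = Q *v (P *v x)" for x
    by (simp add: matrix_vector_mul_assoc PQ)
  obtain e :: "'n \<Rightarrow> real^'n" and a b where orth: "\<And>i j. e i \<bullet> e j = (if i = j then 1 else 0)"
    and ea: "\<And>i. P *v e i = a i *\<^sub>R e i" and eb: "\<And>i. Q *v e i = b i *\<^sub>R e i"
    using commuting_self_adjoint_eigenbasis[where f = "(*v) P" and g = "(*v) Q",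
          OF matrix_vector_mul_linear adj(1) matrix_vector_mul_linear adj(2) comm]
    by auto
  have ab: "(a i)\<^sup>2 + (b i)\<^sup>2 = 1" for i
  proof -
    have "(P ** P + Q ** Q) *v e i = ((a i)\<^sup>2 + (b i)\<^sup>2) *\<^sub>R e i"
      by (simp add: matrix_vector_mult_add_rdistrib ea eb matrix_vector_mult_scaleR
          scaleR_add_left power2_eq_square flip: matrix_vector_mul_assoc)
    then have "e i \<bullet> e i = ((a i)\<^sup>2 + (b i)\<^sup>2) * (e i \<bullet> e i)"
      by (metis PQ1 inner_scaleR_right matrix_vector_mul_lid)
    then show ?thesis by (simp add: orth)
  qed
  define R :: "real^'n^'n" where "R = (\<chi> i j. e j $ i)"
  have RR: "transpose R ** R = mat 1"
    using orth by (simp add: vec_eq_iff matrix_matrix_mult_def transpose_def R_def mat_def inner_vec_def)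
  then have R: "orthogonal_matrix R" by (simp add: orthogonal_matrix)
  \<comment> \<open>The branch of the root is immaterial: a sign change of \<open>d i\<close> is
    absorbed by column \<open>i\<close> of \<open>O1\<close>.\<close>
  define d where "d i = csqrt (Complex (a i) (b i))" for i
  have d2: "d i * d i = Complex (a i) (b i)" for i
    unfolding d_def by (metis power2_csqrt power2_eq_square)
  have "cmod (d i * d i) = 1" for i
    using ab[of i] by (simp add: d2 cmod_def)
  then have "(cmod (d i))\<^sup>2 = 1" for i
    by (simp add: norm_mult power2_eq_square)
  then have d1: "cmod (d i) = 1" for i
    by (simp add: power2_eq_1_iff) (smt (verit) norm_ge_zero)
  then have d0: "d i \<noteq> 0" for i by (metis norm_zero zero_neq_one)
  have SR: "S ** cpx_mat R = cpx_mat R ** diag_mat (\<lambda>i. d i * d i)"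
    unfolding vec_eq_iff
  proof (intro allI)
    fix i j
    have 1: "(\<Sum>k\<in>UNIV. Re (S $ i $ k) * e j $ k) = a j * e j $ i"
      using arg_cong[OF ea[of j], of "\<lambda>v. v $ i"] by (simp add: matrix_vector_mult_def P_def)
    have 2: "(\<Sum>k\<in>UNIV. Im (S $ i $ k) * e j $ k) = b j * e j $ i"
      using arg_cong[OF eb[of j], of "\<lambda>v. v $ i"] by (simp add: matrix_vector_mult_def Q_def)
    show "(S ** cpx_mat R) $ i $ j = (cpx_mat R ** diag_mat (\<lambda>i. d i * d i)) $ i $ j"
      unfolding mult_diag_mat d2 using 1 2
      by (simp add: complex_eq_iff matrix_matrix_mult_def R_def mult.commute)
  qed
  define W where "W = U ** cpx_mat R ** diag_mat (\<lambda>i. inverse (d i))"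
  have W: "unitary W" unfolding W_def
    using d1 by (intro unitary_mult U unitary_cpx_mat R unitary_diag_mat) (simp add: norm_inverse)
  have "transpose W ** W = diag_mat (\<lambda>i. inverse (d i)) ** cpx_mat (transpose R) **
      (S ** cpx_mat R) ** diag_mat (\<lambda>i. inverse (d i))"
    by (simp add: W_def S_def matrix_transpose_mul transpose_cpx_mat matrix_mul_assoc)
  also have "\<dots> = diag_mat (\<lambda>i. inverse (d i)) ** cpx_mat (transpose R ** R) **
      diag_mat (\<lambda>i. d i * d i) ** diag_mat (\<lambda>i. inverse (d i))"
    by (simp add: SR cpx_mat_mult matrix_mul_assoc)
  also have "\<dots> = mat 1"
    using d0 by (simp add: RR diag_mat_mult field_simps diag_mat_1)
  finally have TW: "transpose W ** W = mat 1" .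
  \<comment> \<open>A unitary matrix with \<open>W^T W = 1\<close> has its transpose equal to its
    adjoint, so it is real.\<close>
  have "transpose W = transpose W ** (W ** conj_transpose W)"
    using W by (simp add: unitary_def)
  then have "transpose W = conj_transpose W" by (simp add: matrix_mul_assoc TW)
  then have "cnj (W $ i $ j) = W $ i $ j" for i j
    by (simp add: vec_eq_iff transpose_def)
  then have real: "W $ i $ j \<in> \<real>" for i j
    by (simp add: Reals_cnj_iff)
  define O1 :: "real^'n^'n" where "O1 = (\<chi> i j. Re (W $ i $ j))"
  have O1: "cpx_mat O1 = W" using real by (simp add: vec_eq_iff O1_def)
  have "cpx_mat (transpose O1 ** O1) = mat 1" using TW O1
    by (simp add: cpx_mat_mult flip: transpose_cpx_mat)
  then have "complex_of_real ((transpose O1 ** O1) $ i $ j) = complex_of_real (mat 1 $ i $ j)" for i j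
    by (metis cpx_mat_1 cpx_mat_nth)
  then have "transpose O1 ** O1 = mat 1" by (simp add: vec_eq_iff)
  then have "orthogonal_matrix O1" by (simp add: orthogonal_matrix)
  moreover have "orthogonal_matrix (transpose R)" using R by (simp add: orthogonal_matrix_transpose)
  moreover have "W ** diag_mat d ** cpx_mat (transpose R) = U"
  proof -
    have "W ** diag_mat d ** cpx_mat (transpose R) = U ** cpx_mat R **
        (diag_mat (\<lambda>i. inverse (d i)) ** diag_mat d) ** cpx_mat (transpose R)"
      by (simp add: W_def matrix_mul_assoc)
    also have "\<dots> = U ** cpx_mat (R ** transpose R)"
      using d0 by (simp add: diag_mat_mult diag_mat_1 cpx_mat_mult matrix_mul_assoc)
    finally show ?thesis using R by (simp add: orthogonal_matrix_def)
  qed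
  ultimately show ?thesis using that[of O1 "transpose R" d] d1 O1 by simp
qed


section \<open>Orthogonal matrices in the magic basis\<close>

definition refl_mat :: "real^'n \<Rightarrow> real^'n^'n" where
  "refl_mat w = (\<chi> i j. (if i = j then 1 else 0) - 2 * w $ i * w $ j)"

lemma refl_mat_vec: "refl_mat w *v x = x - (2 * (w \<bullet> x)) *\<^sub>R w"
  unfolding vec_eq_iff
proof (intro allI)
  fix i
  have "(\<Sum>j\<in>UNIV. ((if i = j then 1 else 0) - 2 * w $ i * w $ j) * x $ j)
      = (\<Sum>j\<in>UNIV. (if i = j then x $ j else 0) - 2 * w $ i * (w $ j * x $ j))"
    by (intro sum.cong) (auto simp: algebra_simps)
  also have "\<dots> = x $ i - 2 * w $ i * (\<Sum>j\<in>UNIV. w $ j * x $ j)"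
    by (simp add: sum_subtractf sum_distrib_left)
  finally show "(refl_mat w *v x) $ i = (x - (2 * (w \<bullet> x)) *\<^sub>R w) $ i"
    by (simp add: refl_mat_def matrix_vector_mult_def inner_vec_def)
qed

lemma refl_mat_self: "norm w = 1 \<Longrightarrow> refl_mat w ** refl_mat w = mat 1"
  by (simp add: matrix_eq refl_mat_vec inner_diff_right dot_square_norm flip: matrix_vector_mul_assoc)

lemma orthogonal_refl_mat: "norm w = 1 \<Longrightarrow> orthogonal_matrix (refl_mat w)"
proof -
  assume "norm w = 1"
  moreover have "transpose (refl_mat w) = refl_mat w"
    by (simp add: vec_eq_iff transpose_def refl_mat_def mult_ac)
  ultimately show ?thesis by (simp add: orthogonal_matrix refl_mat_self)
qed

text \<open>Cartan-Dieudonne as an induction rule, so that only single reflections have to be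
  understood in the magic basis. The measure is the number of basis vectors moved by
  \<open>A\<close>.\<close>

lemma orthogonal_matrix_reflection_induct [consumes 1, case_names one refl]:
  fixes A :: "real^'n^'n"
  assumes "orthogonal_matrix A"
    and one: "P (mat 1)" and refl: "\<And>w A. norm w = 1 \<Longrightarrow> P A \<Longrightarrow> P (refl_mat w ** A)"
  shows "P A"
  using assms(1)
proof (induction "card {j. A *v axis j 1 \<noteq> axis j 1}" arbitrary: A rule: less_induct)
  case less
  show ?case
  proof (cases "{j. A *v axis j 1 \<noteq> axis j 1} = {}")
    case True
    then have "A $ i $ j = mat 1 $ i $ j" for i j
      by (metis (mono_tags, lifting) empty_Collect_eq matrix_vector_mul_lid matrix_vector_mult_basis column_def vec_lambda_beta)
    then have "A = mat 1" by (simp add: vec_eq_iff)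
    then show ?thesis using one by simp
  next
    case False
    then obtain j where j: "A *v axis j 1 \<noteq> axis j 1" by blast
    define u where "u = A *v axis j 1"
    define v :: "real^'n" where "v = axis j 1"
    define w where "w = (u - v) /\<^sub>R norm (u - v)"
    have inner: "(A *v x) \<bullet> (A *v y) = x \<bullet> y" for x y
      using less.prems
      by (metis dot_lmul_matrix matrix_vector_mul_assoc matrix_vector_mul_lid orthogonal_matrix transpose_matrix_vector)
    have uu: "u \<bullet> u = 1" "v \<bullet> v = 1" by (simp_all add: u_def v_def inner inner_axis_axis)
    have ne: "norm (u - v) > 0" using j by (simp add: u_def v_def)
    then have w: "norm w = 1" by (simp add: w_def)
    have wu: "refl_mat w *v u = v"
    proof -
      have "2 * ((u - v) \<bullet> u) = (norm (u - v))\<^sup>2"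
        by (simp add: power2_norm_eq_inner inner_diff_left inner_diff_right uu inner_commute)
      then have "(2 * (w \<bullet> u)) *\<^sub>R w = u - v"
        using ne by (simp add: w_def power2_eq_square) (simp add: field_simps)
      then show ?thesis by (simp add: refl_mat_vec)
    qed
    \<comment> \<open>A basis vector fixed by \<open>A\<close> is orthogonal to both
      \<open>A e_j\<close> and \<open>e_j\<close>, hence to \<open>w\<close>; so the reflection
      sending \<open>A e_j\<close> to \<open>e_j\<close> unfixes nothing.\<close>
    have fixed: "refl_mat w *v axis k 1 = axis k 1" if "A *v axis k 1 = axis k 1" for k
    proof -
      have "k \<noteq> j" using that j by auto
      then have "u \<bullet> axis k 1 = 0" "v \<bullet> axis k 1 = 0"
        using inner[of "axis j 1" "axis k 1"] that by (simp_all add: u_def v_def inner_axis_axis)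
      then show ?thesis by (simp add: refl_mat_vec w_def inner_diff_left)
    qed
    have "{k. (refl_mat w ** A) *v axis k 1 \<noteq> axis k 1} \<subset> {k. A *v axis k 1 \<noteq> axis k 1}"
    proof
      show "{k. (refl_mat w ** A) *v axis k 1 \<noteq> axis k 1} \<subseteq> {k. A *v axis k 1 \<noteq> axis k 1}"
        using fixed by (auto simp flip: matrix_vector_mul_assoc)
      have "(refl_mat w ** A) *v axis j 1 = axis j 1"
        using wu by (simp add: u_def v_def flip: matrix_vector_mul_assoc)
      then show "{k. (refl_mat w ** A) *v axis k 1 \<noteq> axis k 1} \<noteq> {k. A *v axis k 1 \<noteq> axis k 1}"
        using j by blast
    qed
    then have "card {k. (refl_mat w ** A) *v axis k 1 \<noteq> axis k 1} < card {k. A *v axis k 1 \<noteq> axis k 1}"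
      by (intro psubset_card_mono) auto
    moreover have "orthogonal_matrix (refl_mat w ** A)"
      using less.prems orthogonal_refl_mat[OF w] by (simp add: orthogonal_matrix_mul)
    ultimately have "P (refl_mat w ** A)" by (rule less.hyps)
    then have "P (refl_mat w ** (refl_mat w ** A))" by (rule refl[OF w])
    then show ?thesis by (simp add: matrix_mul_assoc refl_mat_self[OF w])
  qed
qed


text \<open>Read as 2-by-2 matrices, the real combinations of the columns of \<open>magic\<close> are the real
  quaternions, with basis \<open>I, iX, iY, iZ\<close> indexed by \<open>(1,1), (1,2), (2,1), (2,2)\<close>.\<close>

definition quat :: "real^(2 \<times> 2) \<Rightarrow> op1" where
  "quat w = vector [vector [Complex (w $ (1, 1)) (w $ (2, 2)), Complex (w $ (2, 1)) (w $ (1, 2))],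
                    vector [Complex (- w $ (2, 1)) (w $ (1, 2)), Complex (w $ (1, 1)) (- w $ (2, 2))]]"

definition magic :: op2 where
  "magic = (\<chi> r k. complex_of_real (1 / sqrt 2) * quat (axis k 1) $ fst r $ snd r)"

definition swap_mat :: op2 where
  "swap_mat = (\<chi> i j. if i = prod.swap j then 1 else 0)"

lemma matrix_eq_2x2:
  fixes A B :: "'a^2^2"
  shows "A = B \<longleftrightarrow> A $ 1 $ 1 = B $ 1 $ 1 \<and> A $ 1 $ 2 = B $ 1 $ 2 \<and> A $ 2 $ 1 = B $ 2 $ 1 \<and> A $ 2 $ 2 = B $ 2 $ 2"
  by (auto simp: vec_eq_iff forall_2)

lemma norm_2x2: "norm w = 1 \<Longrightarrow>
    (w $ (1, 1))\<^sup>2 + (w $ (1, 2))\<^sup>2 + (w $ (2, 1))\<^sup>2 + (w $ (2, 2))\<^sup>2 = 1"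
  for w :: "real^(2 \<times> 2)"
  by (simp add: norm_eq_1 inner_vec_def sum_UNIV_prod sum_2 power2_eq_square)

lemma unitary_quat: "norm w = 1 \<Longrightarrow> unitary (quat w)"
  by (drule norm_2x2, rule unitaryI)
     (simp add: matrix_eq_2x2 matrix_matrix_mult_def sum_2 quat_def mat_def complex_eq_iff
       power2_eq_square algebra_simps)

lemma pauli_nth [simp]:
  "pauli_X $ 1 $ 1 = 0" "pauli_X $ 1 $ 2 = 1" "pauli_X $ 2 $ 1 = 1" "pauli_X $ 2 $ 2 = 0"
  "pauli_Y $ 1 $ 1 = 0" "pauli_Y $ 1 $ 2 = - \<i>" "pauli_Y $ 2 $ 1 = \<i>" "pauli_Y $ 2 $ 2 = 0"
  "pauli_Z $ 1 $ 1 = 1" "pauli_Z $ 1 $ 2 = 0" "pauli_Z $ 2 $ 1 = 0" "pauli_Z $ 2 $ 2 = - 1"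
  by (simp_all add: pauli_X_def pauli_Y_def pauli_Z_def)

lemma unitary_pauli [simp]: "unitary pauli_X" "unitary pauli_Y" "unitary pauli_Z"
  by (rule unitaryI, simp add: matrix_eq_2x2 matrix_matrix_mult_def sum_2 mat_def)+

lemma magic_nth [simp]:
  "magic $ (1,1) $ (1,1) = 1 / sqrt 2" "magic $ (1,1) $ (1,2) = 0"
  "magic $ (1,1) $ (2,1) = 0" "magic $ (1,1) $ (2,2) = \<i> / sqrt 2"
  "magic $ (1,2) $ (1,1) = 0" "magic $ (1,2) $ (1,2) = \<i> / sqrt 2"
  "magic $ (1,2) $ (2,1) = 1 / sqrt 2" "magic $ (1,2) $ (2,2) = 0"
  "magic $ (2,1) $ (1,1) = 0" "magic $ (2,1) $ (1,2) = \<i> / sqrt 2"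
  "magic $ (2,1) $ (2,1) = - 1 / sqrt 2" "magic $ (2,1) $ (2,2) = 0"
  "magic $ (2,2) $ (1,1) = 1 / sqrt 2" "magic $ (2,2) $ (1,2) = 0"
  "magic $ (2,2) $ (2,1) = 0" "magic $ (2,2) $ (2,2) = - \<i> / sqrt 2"
  by (simp_all add: magic_def quat_def axis_def complex_eq_iff)

lemma matrix_eq_4x4:
  fixes A B :: "'a^(2 \<times> 2)^(2 \<times> 2)"
  shows "A = B \<longleftrightarrow> (\<forall>i j k l. A $ (i, j) $ (k, l) = B $ (i, j) $ (k, l))"
  by (auto simp: vec_eq_iff)

lemma of_real_sqrt2_mult [simp]: "complex_of_real (sqrt 2) * complex_of_real (sqrt 2) = 2"
  by (metis of_real_mult of_real_numeral real_sqrt_mult_self abs_numeral)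

lemma unitary_magic: "unitary magic"
  by (rule unitaryI)
     (simp add: matrix_eq_4x4 forall_2 matrix_matrix_mult_def sum_UNIV_prod sum_2 mat_def)

lemma swap_mat_nth: "swap_mat $ (i, j) $ (k, l) = (if i = l \<and> j = k then 1 else 0)"
  by (auto simp: swap_mat_def)

lemma swap_mat_kron: "swap_mat ** kron A B = kron B A ** swap_mat"
  by (simp add: matrix_eq_4x4 forall_2 matrix_matrix_mult_def sum_UNIV_prod sum_2 swap_mat_nth)

lemma swap_mat_swap_mat: "swap_mat ** swap_mat = mat 1"
  by (simp add: matrix_eq_4x4 forall_2 matrix_matrix_mult_def sum_UNIV_prod sum_2 swap_mat_nth mat_def)

text \<open>Eigenvalues of SWAP on the columns of \<open>magic\<close>: among
  \<open>I, iX, iY, iZ\<close> only \<open>iY\<close>, the singlet column, is antisymmetric.\<close>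

definition swap_signs :: "2 \<times> 2 \<Rightarrow> complex" where
  "swap_signs k = (if k = (2, 1) then - 1 else 1)"

lemma swap_mat_magic: "swap_mat ** magic = magic ** diag_mat swap_signs"
  by (simp add: matrix_eq_4x4 forall_2 mult_diag_mat)
     (simp add: matrix_matrix_mult_def sum_UNIV_prod sum_2 swap_mat_nth swap_signs_def)

text \<open>For a unit quaternion \<open>w\<close> the reflection is \<open>x \<mapsto> - w x\<^sup>* w\<close>, and conjugation is
  \<open>x\<^sup>* = Y x\<^sup>T Y\<close>; transposing a 2-by-2 matrix is the swap of the two qubits.\<close>

lemma refl_mat_magic:
  assumes "norm w = 1"
  shows "magic ** cpx_mat (refl_mat w) =
    kron (cscale (- 1) (quat w ** pauli_Y)) (transpose (pauli_Y ** quat w)) ** swap_mat ** magic"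
  unfolding matrix_mul_assoc[symmetric] swap_mat_magic
  unfolding matrix_mul_assoc matrix_eq_4x4 forall_2 mult_diag_mat
  using norm_2x2[OF assms]
  by (simp add: matrix_matrix_mult_def sum_UNIV_prod sum_2 swap_signs_def refl_mat_def
       complex_eq_iff transpose_def quat_def field_simps power2_eq_square)
     (simp flip: mult.assoc)


section \<open>Local gates in the magic basis\<close>

definition local_gate :: "op2 \<Rightarrow> bool" where
  "local_gate K \<longleftrightarrow> (\<exists>A B. unitary A \<and> unitary B \<and> K = kron A B)"

lemma local_gateI: "unitary A \<Longrightarrow> unitary B \<Longrightarrow> local_gate (kron A B)"
  by (auto simp: local_gate_def)

lemma local_gate_1: "local_gate (mat 1)"
  by (metis local_gateI kron_mat_1 unitary_mat_1)

lemma local_gate_mult: "local_gate K \<Longrightarrow> local_gate L \<Longrightarrow> local_gate (K ** L)"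
  by (metis local_gate_def kron_mult unitary_mult)

lemma local_gate_conj_transpose: "local_gate K \<Longrightarrow> local_gate (conj_transpose K)"
  by (metis local_gate_def conj_transpose_kron unitary_conj_transpose)

lemma local_gate_cscale: "local_gate K \<Longrightarrow> cmod c = 1 \<Longrightarrow> local_gate (cscale c K)"
  by (metis local_gate_def kron_cscale_left unitary_cscale)

lemma local_gate_swap:
  assumes "local_gate K"
  obtains L where "local_gate L" "swap_mat ** K = L ** swap_mat"
  using assms by (metis local_gate_def swap_mat_kron)

text \<open>Every reflection contributes a local gate and one SWAP. SWAP normalises the local gates
  and is an involution, so only the parity of the number of reflections remains.\<close>

lemma orthogonal_local:
  assumes "orthogonal_matrix A"
  shows "\<exists>K. local_gate K \<and> (magic ** cpx_mat A = K ** magic \<or> magic ** cpx_mat A = K ** swap_mat ** magic)"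
  using assms
proof (induction rule: orthogonal_matrix_reflection_induct)
  case one
  then show ?case by (intro exI[of _ "mat 1"]) (simp add: local_gate_1)
next
  case (refl w A)
  define L where "L = kron (cscale (- 1) (quat w ** pauli_Y)) (transpose (pauli_Y ** quat w))"
  have L: "local_gate L" unfolding L_def using refl(1)
    by (intro local_gateI unitary_cscale unitary_mult unitary_transpose unitary_quat unitary_pauli) auto
  have *: "magic ** cpx_mat (refl_mat w ** A) = L ** swap_mat ** (magic ** cpx_mat A)"
    by (simp add: cpx_mat_mult matrix_mul_assoc refl_mat_magic[OF refl(1)] L_def)
  obtain K where K: "local_gate K"
    "magic ** cpx_mat A = K ** magic \<or> magic ** cpx_mat A = K ** swap_mat ** magic"
    using refl by blast
  obtain K' where K': "local_gate K'" "swap_mat ** K = K' ** swap_mat"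
    using local_gate_swap[OF K(1)] .
  from K(2) show ?case
  proof
    assume "magic ** cpx_mat A = K ** magic"
    then have "magic ** cpx_mat (refl_mat w ** A) = L ** (swap_mat ** K) ** magic"
      by (simp add: * matrix_mul_assoc)
    then show ?thesis unfolding K'(2)
      by (intro exI[of _ "L ** K'"]) (simp add: matrix_mul_assoc local_gate_mult L K')
  next
    assume "magic ** cpx_mat A = K ** swap_mat ** magic"
    then have "magic ** cpx_mat (refl_mat w ** A) = L ** (swap_mat ** K) ** swap_mat ** magic"
      by (simp add: * matrix_mul_assoc)
    then have "magic ** cpx_mat (refl_mat w ** A) = L ** K' ** (swap_mat ** swap_mat) ** magic"
      unfolding K'(2) by (simp add: matrix_mul_assoc)
    then show ?thesis
      by (intro exI[of _ "L ** K'"]) (simp add: swap_mat_swap_mat local_gate_mult L K')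
  qed
qed

lemma unitary_diag_swap_signs: "cmod (swap_signs k) = 1"
  by (simp add: swap_signs_def)

text \<open>The columns of \<open>magic\<close> being SWAP eigenvectors, a leftover SWAP becomes a
  diagonal factor, which merges with the diagonal part of the factorisation.\<close>

lemma orthogonal_local_diag:
  assumes "orthogonal_matrix A"
  obtains K s where "local_gate K" "\<forall>k. cmod (s k) = 1" "magic ** cpx_mat A = K ** magic ** diag_mat s"
proof -
  obtain K where K: "local_gate K"
    "magic ** cpx_mat A = K ** magic \<or> magic ** cpx_mat A = K ** swap_mat ** magic"
    using orthogonal_local[OF assms] by blast
  from K(2) show ?thesis
  proof
    assume "magic ** cpx_mat A = K ** magic"
    then show ?thesis using that[of K "\<lambda>_. 1"] K by (simp add: diag_mat_1)
  next
    assume "magic ** cpx_mat A = K ** swap_mat ** magic"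
    then show ?thesis using that[of K swap_signs] K
      by (simp add: unitary_diag_swap_signs swap_mat_magic flip: matrix_mul_assoc)
  qed
qed

lemma magic_conj_transpose: "magic ** conj_transpose magic = mat 1" "conj_transpose magic ** magic = mat 1"
  using unitary_magic by (auto simp: unitary_def)

lemma unitary_local_magic_diag:
  assumes "unitary U"
  obtains K L d where "local_gate K" "local_gate L" "\<forall>k. cmod (d k) = 1"
    "U = K ** (magic ** diag_mat d ** conj_transpose magic) ** L"
proof -
  have "unitary (conj_transpose magic ** U ** magic)"
    by (intro unitary_mult assms) (simp_all add: unitary_magic)
  then obtain O1 O2 d where O: "orthogonal_matrix O1" "orthogonal_matrix O2" "\<forall>k. cmod (d k) = 1"
    and eq: "conj_transpose magic ** U ** magic = cpx_mat O1 ** diag_mat d ** cpx_mat O2"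
    by (rule unitary_orthogonal_diagonal)
  obtain K s where K: "local_gate K" "\<forall>k. cmod (s k) = 1" "magic ** cpx_mat O1 = K ** magic ** diag_mat s"
    using orthogonal_local_diag[OF O(1)] .
  \<comment> \<open>The local form has \<open>magic\<close> on the left; transposing
    \<open>O2\<close> and taking adjoints afterwards puts its local gate on the right.\<close>
  have "orthogonal_matrix (transpose O2)" using O(2) by (simp add: orthogonal_matrix_transpose)
  then obtain L t where L: "local_gate L" "\<forall>k. cmod (t k) = 1"
    "magic ** cpx_mat (transpose O2) = L ** magic ** diag_mat t"
    by (rule orthogonal_local_diag)
  have "conj_transpose (magic ** cpx_mat (transpose O2)) = cpx_mat O2 ** conj_transpose magic"
    by (simp add: conj_transpose_matrix_mult conj_transpose_cpx_mat)
  then have L3: "cpx_mat O2 ** conj_transpose magic = diag_mat (\<lambda>k. cnj (t k)) ** conj_transpose magic ** conj_transpose L"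
    by (simp add: L(3) conj_transpose_matrix_mult conj_transpose_diag_mat matrix_mul_assoc)
  have "U = (magic ** conj_transpose magic) ** U ** (magic ** conj_transpose magic)"
    by (simp add: magic_conj_transpose)
  also have "\<dots> = magic ** (conj_transpose magic ** U ** magic) ** conj_transpose magic"
    by (simp add: matrix_mul_assoc)
  also have "\<dots> = (magic ** cpx_mat O1) ** diag_mat d ** (cpx_mat O2 ** conj_transpose magic)"
    by (simp add: eq matrix_mul_assoc)
  also have "\<dots> = K ** magic ** (diag_mat s ** diag_mat d ** diag_mat (\<lambda>k. cnj (t k))) ** conj_transpose magic ** conj_transpose L"
    by (simp add: K(3) L3 matrix_mul_assoc)
  also have "\<dots> = K ** (magic ** diag_mat (\<lambda>k. s k * d k * cnj (t k)) ** conj_transpose magic) ** conj_transpose L"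
    by (simp add: diag_mat_mult matrix_mul_assoc)
  finally have eq: "U = \<dots>" .
  have "\<forall>k. cmod (s k * d k * cnj (t k)) = 1" using K(2) L(2) O(3) by (simp add: norm_mult)
  from that[OF K(1) local_gate_conj_transpose[OF L(1)] this eq] show ?thesis .
qed

text \<open>Eigenvalues of \<open>x XX + y YY + z ZZ\<close> on the Bell states that form the
  columns of \<open>magic\<close>.\<close>

definition magic_phase :: "real \<Rightarrow> real \<Rightarrow> real \<Rightarrow> 2 \<times> 2 \<Rightarrow> real" where
  "magic_phase x y z k =
     (if k = (1, 1) then x - y + z else if k = (1, 2) then x + y - z
      else if k = (2, 1) then - x - y - z else - x + y + z)"

lemma magic_phase_simps [simp]:
  "magic_phase x y z (1, 1) = x - y + z" "magic_phase x y z (1, 2) = x + y - z"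
  "magic_phase x y z (2, 1) = - x - y - z" "magic_phase x y z (2, 2) = - x + y + z"
  by (simp_all add: magic_phase_def)

lemma sums_vec:
  fixes f :: "nat \<Rightarrow> 'a::real_normed_vector^'n"
  assumes "\<And>i. (\<lambda>n. f n $ i) sums (s $ i)"
  shows "f sums s"
  using assms unfolding sums_def by (intro vec_tendstoI) simp

text \<open>Powers of \<open>A\<close> are conjugates of diagonal powers, so each entry of the
  series is a finite combination of scalar exponential series.\<close>

lemma mat_exp_diagonalisable:
  assumes V: "unitary V" and A: "A = V ** diag_mat d ** conj_transpose V"
  shows "mat_exp A = V ** diag_mat (\<lambda>k. exp (d k)) ** conj_transpose V"
proof -
  have pow: "((\<lambda>B. A ** B) ^^ n) (mat 1) = V ** diag_mat (\<lambda>k. d k ^ n) ** conj_transpose V" for n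
  proof (induction n)
    case 0
    then show ?case using V by (simp add: diag_mat_1 unitary_def)
  next
    case (Suc n)
    have "A ** (V ** diag_mat (\<lambda>k. d k ^ n) ** conj_transpose V)
      = V ** diag_mat d ** (conj_transpose V ** V) ** diag_mat (\<lambda>k. d k ^ n) ** conj_transpose V"
      by (simp add: A matrix_mul_assoc)
    also have "\<dots> = V ** (diag_mat d ** diag_mat (\<lambda>k. d k ^ n)) ** conj_transpose V"
      using V by (simp add: unitary_def matrix_mul_assoc)
    finally show ?case using Suc by (simp add: diag_mat_mult)
  qed
  have entry: "(V ** diag_mat e ** conj_transpose V) $ i $ j = (\<Sum>k\<in>UNIV. V $ i $ k * e k * cnj (V $ j $ k))" for e i j
    by (simp add: matrix_matrix_mult_def[of "V ** _"] mult_diag_mat)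
  have "(\<lambda>n. (1 / fact n) *\<^sub>R (((\<lambda>B. A ** B) ^^ n) (mat 1))) sums (V ** diag_mat (\<lambda>k. exp (d k)) ** conj_transpose V)"
  proof (intro sums_vec)
    fix i j
    have "(\<lambda>n. \<Sum>k\<in>UNIV. V $ i $ k * (d k ^ n /\<^sub>R fact n) * cnj (V $ j $ k)) sums
        (\<Sum>k\<in>UNIV. V $ i $ k * exp (d k) * cnj (V $ j $ k))"
      by (intro sums_sum sums_mult sums_mult2 exp_converges)
    then show "(\<lambda>n. ((1 / fact n) *\<^sub>R (((\<lambda>B. A ** B) ^^ n) (mat 1))) $ i $ j) sums
        (V ** diag_mat (\<lambda>k. exp (d k)) ** conj_transpose V) $ i $ j"
      unfolding pow vector_scaleR_component entry by (simp add: scaleR_sum_right inverse_eq_divide)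
  qed
  then show ?thesis unfolding mat_exp_def by (rule sums_unique[symmetric])
qed

lemma conj_magic_nth:
  "(magic ** diag_mat d ** conj_transpose magic) $ (i, j) $ (k, l) =
     (\<Sum>m\<in>UNIV. magic $ (i, j) $ m * d m * cnj (magic $ (k, l) $ m))"
  by (simp add: matrix_matrix_mult_def[of "magic ** _"] mult_diag_mat)

lemma Ud_eq: "Ud x y z = magic ** diag_mat (\<lambda>k. cis (magic_phase x y z k)) ** conj_transpose magic"
proof -
  have "cscale \<i> (x *\<^sub>R kron pauli_X pauli_X + y *\<^sub>R kron pauli_Y pauli_Y + z *\<^sub>R kron pauli_Z pauli_Z)
    = magic ** diag_mat (\<lambda>k. \<i> * magic_phase x y z k) ** conj_transpose magic"
    unfolding matrix_eq_4x4 forall_2 conj_magic_nth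
    by (simp add: sum_UNIV_prod sum_2 complex_eq_iff field_simps)
  from mat_exp_diagonalisable[OF unitary_magic this] show ?thesis
    by (simp add: Ud_def cis_conv_exp)
qed

lemma Ud_nth:
  "Ud x y z $ (1,1) $ (1,1) = (cis (x - y + z) + cis (- x + y + z)) / 2"
  "Ud x y z $ (1,1) $ (2,2) = (cis (x - y + z) - cis (- x + y + z)) / 2"
  "Ud x y z $ (2,2) $ (1,1) = (cis (x - y + z) - cis (- x + y + z)) / 2"
  "Ud x y z $ (2,2) $ (2,2) = (cis (x - y + z) + cis (- x + y + z)) / 2"
  "Ud x y z $ (1,2) $ (1,2) = (cis (x + y - z) + cis (- x - y - z)) / 2"
  "Ud x y z $ (1,2) $ (2,1) = (cis (x + y - z) - cis (- x - y - z)) / 2"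
  "Ud x y z $ (2,1) $ (1,2) = (cis (x + y - z) - cis (- x - y - z)) / 2"
  "Ud x y z $ (2,1) $ (2,1) = (cis (x + y - z) + cis (- x - y - z)) / 2"
  "Ud x y z $ (1,1) $ (1,2) = 0" "Ud x y z $ (1,1) $ (2,1) = 0"
  "Ud x y z $ (2,2) $ (1,2) = 0" "Ud x y z $ (2,2) $ (2,1) = 0"
  "Ud x y z $ (1,2) $ (1,1) = 0" "Ud x y z $ (2,1) $ (1,1) = 0"
  "Ud x y z $ (1,2) $ (2,2) = 0" "Ud x y z $ (2,1) $ (2,2) = 0"
  unfolding Ud_eq conj_magic_nth
  by (simp_all add: sum_UNIV_prod sum_2 field_simps)

lemma unitary_Ud: "unitary (Ud x y z)"
  unfolding Ud_eq by (intro unitary_mult unitary_diag_mat) (simp_all add: unitary_magic)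


section \<open>Existence of the Cartan form\<close>

definition locally_equiv :: "op2 \<Rightarrow> op2 \<Rightarrow> bool" where
  "locally_equiv U V \<longleftrightarrow> (\<exists>K L. local_gate K \<and> local_gate L \<and> U = K ** V ** L)"

lemma locally_equivI: "local_gate K \<Longrightarrow> local_gate L \<Longrightarrow> U = K ** V ** L \<Longrightarrow> locally_equiv U V"
  by (auto simp: locally_equiv_def)

lemma locally_equiv_trans: "locally_equiv U V \<Longrightarrow> locally_equiv V W \<Longrightarrow> locally_equiv U W"
  unfolding locally_equiv_def
proof clarify
  fix K L K' L'
  assume "local_gate K" "local_gate L" "local_gate K'" "local_gate L'"
  moreover have "K ** (K' ** W ** L') ** L = (K ** K') ** W ** (L' ** L)"
    by (simp add: matrix_mul_assoc)
  ultimately show "\<exists>M N. local_gate M \<and> local_gate N \<and> K ** (K' ** W ** L') ** L = M ** W ** N"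
    using local_gate_mult by blast
qed

lemma locally_equiv_conjugate:
  assumes "local_gate K" "U ** K = K ** V"
  shows "locally_equiv U V"
proof (rule locally_equivI[OF assms(1) local_gate_conj_transpose[OF assms(1)]])
  have "K ** conj_transpose K = mat 1"
    using assms(1) unitary_kron by (metis local_gate_def unitary_def)
  then show "U = K ** V ** conj_transpose K"
    by (simp flip: assms(2) matrix_mul_assoc)
qed

text \<open>Separating the angles makes every entry of \<open>Ud\<close> a polynomial in phases of
  single angles, which reduces the matrix identities below to ring identities.\<close>

lemma cis_expand:
  "cis (a + b) = cis a * cis b" "cis (a - b) = cis a * cis (- b)"
  "cis (- (a + b)) = cis (- a) * cis (- b)" "cis (- (a - b)) = cis (- a) * cis b"
  by (simp_all add: cis_mult)

text \<open>Conjugation by the phase gate turns X into Y and Y into -X; on both qubits it exchanges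
  XX and YY and fixes ZZ.\<close>

lemma Ud_swap12: "locally_equiv (Ud x y z) (Ud y x z)"
proof (rule locally_equiv_conjugate)
  define S :: op1 where "S = diag_mat (\<lambda>i. if i = 1 then 1 else \<i>)"
  show "local_gate (kron S S)"
    unfolding S_def by (intro local_gateI unitary_diag_mat) auto
  show "Ud x y z ** kron S S = kron S S ** Ud y x z"
    by (simp add: matrix_eq_4x4 forall_2)
       (simp add: matrix_matrix_mult_def sum_UNIV_prod sum_2 Ud_nth cis_expand S_def diag_mat_nth field_simps)
qed

text \<open>The Hadamard gate exchanges X and Z and negates Y; on both qubits the sign of YY
  cancels.\<close>

lemma Ud_swap13: "locally_equiv (Ud x y z) (Ud z y x)"
proof (rule locally_equiv_conjugate)
  define H :: op1 where "H = vector [vector [1 / sqrt 2, 1 / sqrt 2], vector [1 / sqrt 2, - 1 / sqrt 2]]"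
  have "unitary H"
    by (rule unitaryI) (simp add: H_def matrix_eq_2x2 matrix_matrix_mult_def sum_2 mat_def complex_eq_iff field_simps)
  then show "local_gate (kron H H)" by (intro local_gateI)
  show "Ud x y z ** kron H H = kron H H ** Ud z y x"
    by (simp add: matrix_eq_4x4 forall_2)
       (simp add: matrix_matrix_mult_def sum_UNIV_prod sum_2 Ud_nth cis_expand H_def field_simps)
qed

text \<open>Z on one qubit anticommutes with XX and YY and commutes with ZZ.\<close>

lemma Ud_flip12: "locally_equiv (Ud x y z) (Ud (- x) (- y) z)"
proof (rule locally_equiv_conjugate)
  show "local_gate (kron pauli_Z (mat 1))" by (intro local_gateI) auto
  show "Ud x y z ** kron pauli_Z (mat 1) = kron pauli_Z (mat 1) ** Ud (- x) (- y) z"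
    by (simp add: matrix_eq_4x4 forall_2)
       (simp add: matrix_matrix_mult_def sum_UNIV_prod sum_2 Ud_nth cis_expand mat_def field_simps)
qed

text \<open>\<open>exp (i pi/2 XX) = i XX\<close> is itself a local gate, so the angle matters only
  modulo \<open>pi / 2\<close>.\<close>

lemma Ud_shift1:
  "locally_equiv (Ud x y z) (Ud (x + pi / 2) y z)" "locally_equiv (Ud x y z) (Ud (x - pi / 2) y z)"
proof -
  define h where "h = pi / 2"
  have cis_h: "cis h = \<i>" "cis (- h) = - \<i>"
    by (simp_all add: h_def complex_eq_iff)
  have K: "local_gate (cscale c (kron pauli_X pauli_X))" if "cmod c = 1" for c
    using that by (intro local_gate_cscale local_gateI) auto
  have 1: "Ud x y z = cscale (- \<i>) (kron pauli_X pauli_X) ** Ud (x + h) y z ** mat 1"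
    by (simp add: matrix_eq_4x4 forall_2)
       (simp add: matrix_matrix_mult_def sum_UNIV_prod sum_2 Ud_nth cis_expand cis_h field_simps)
  show "locally_equiv (Ud x y z) (Ud (x + pi / 2) y z)"
    using locally_equivI[OF K local_gate_1 1] by (simp add: h_def)
  have 2: "Ud x y z = cscale \<i> (kron pauli_X pauli_X) ** Ud (x - h) y z ** mat 1"
    by (simp add: matrix_eq_4x4 forall_2)
       (simp add: matrix_matrix_mult_def sum_UNIV_prod sum_2 Ud_nth cis_expand cis_h field_simps)
  show "locally_equiv (Ud x y z) (Ud (x - pi / 2) y z)"
    using locally_equivI[OF K local_gate_1 2] by (simp add: h_def)
qed

lemma locally_equiv_refl: "locally_equiv U U"
  using locally_equivI[OF local_gate_1 local_gate_1] by simp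

lemma Ud_shift1_int: "locally_equiv (Ud x y z) (Ud (x + of_int n * (pi / 2)) y z)"
proof (induction n rule: int_induct[where k = 0])
  case base
  then show ?case by (simp add: locally_equiv_refl)
next
  case (step1 i)
  have "x + of_int (i + 1) * (pi / 2) = x + of_int i * (pi / 2) + pi / 2" by (simp add: field_simps)
  with locally_equiv_trans[OF step1(2) Ud_shift1(1)] show ?case by metis
next
  case (step2 i)
  have "x + of_int (i - 1) * (pi / 2) = x + of_int i * (pi / 2) - pi / 2" by (simp add: field_simps)
  with locally_equiv_trans[OF step2(2) Ud_shift1(2)] show ?case by metis
qed

lemma Ud_reduce1: "\<exists>x'. \<bar>x'\<bar> \<le> pi / 4 \<and> locally_equiv (Ud x y z) (Ud x' y z)"
proof -
  define n where "n = round (x / (pi / 2))"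
  have "\<bar>of_int n - x / (pi / 2)\<bar> \<le> 1 / 2"
    unfolding n_def by (rule of_int_round_abs_le)
  then have "of_int n - x / (pi / 2) \<le> 1 / 2" "x / (pi / 2) - of_int n \<le> 1 / 2" by linarith+
  then have "\<bar>x + of_int (- n) * (pi / 2)\<bar> \<le> pi / 4"
    unfolding abs_le_iff by (simp add: field_simps)
  then show ?thesis using Ud_shift1_int[of x y z "- n"] by blast
qed

lemma locally_equiv_swap12: "locally_equiv U (Ud x y z) \<Longrightarrow> locally_equiv U (Ud y x z)"
  by (rule locally_equiv_trans[OF _ Ud_swap12])

lemma locally_equiv_swap13: "locally_equiv U (Ud x y z) \<Longrightarrow> locally_equiv U (Ud z y x)"
  by (rule locally_equiv_trans[OF _ Ud_swap13])

lemma locally_equiv_swap23: "locally_equiv U (Ud x y z) \<Longrightarrow> locally_equiv U (Ud x z y)"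
  by (drule locally_equiv_swap12, drule locally_equiv_swap13, drule locally_equiv_swap12)

lemma locally_equiv_flip12: "locally_equiv U (Ud x y z) \<Longrightarrow> locally_equiv U (Ud (- x) (- y) z)"
  by (rule locally_equiv_trans[OF _ Ud_flip12])

lemma locally_equiv_flip13: "locally_equiv U (Ud x y z) \<Longrightarrow> locally_equiv U (Ud (- x) y (- z))"
  by (drule locally_equiv_swap23, drule locally_equiv_flip12, drule locally_equiv_swap23)

lemma locally_equiv_flip23: "locally_equiv U (Ud x y z) \<Longrightarrow> locally_equiv U (Ud x (- y) (- z))"
  by (drule locally_equiv_swap13, drule locally_equiv_flip12, drule locally_equiv_swap13)

lemma locally_equiv_reduce:
  assumes "locally_equiv U (Ud x y z)"
  shows "\<exists>x' y' z'. \<bar>x'\<bar> \<le> pi / 4 \<and> \<bar>y'\<bar> \<le> pi / 4 \<and> \<bar>z'\<bar> \<le> pi / 4 \<and> locally_equiv U (Ud x' y' z')"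
proof -
  obtain x' where x: "\<bar>x'\<bar> \<le> pi / 4" "locally_equiv U (Ud x' y z)"
    using Ud_reduce1 locally_equiv_trans[OF assms] by blast
  \<comment> \<open>Shifts act on the first angle; permutations bring each of the others into that
    slot.\<close>
  obtain y' where y: "\<bar>y'\<bar> \<le> pi / 4" "locally_equiv U (Ud y' x' z)"
    using Ud_reduce1 locally_equiv_trans[OF locally_equiv_swap12[OF x(2)]] by blast
  obtain z' where z: "\<bar>z'\<bar> \<le> pi / 4" "locally_equiv U (Ud z' x' y')"
    using Ud_reduce1 locally_equiv_trans[OF locally_equiv_swap13[OF y(2)]] by blast
  from x y z show ?thesis by blast
qed

lemma locally_equiv_sort:
  assumes "locally_equiv U (Ud x y z)" "\<bar>x\<bar> \<le> b" "\<bar>y\<bar> \<le> b" "\<bar>z\<bar> \<le> b"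
  shows "\<exists>x' y' z'. \<bar>x'\<bar> \<le> b \<and> \<bar>y'\<bar> \<le> \<bar>x'\<bar> \<and> \<bar>z'\<bar> \<le> \<bar>y'\<bar> \<and> locally_equiv U (Ud x' y' z')"
proof -
  note 1 = assms(1)
  note 2 = locally_equiv_swap12[OF 1] locally_equiv_swap13[OF 1] locally_equiv_swap23[OF 1]
  note 3 = locally_equiv_swap12[OF 2(2)] locally_equiv_swap12[OF 2(3)]
  consider "\<bar>y\<bar> \<le> \<bar>x\<bar>" "\<bar>z\<bar> \<le> \<bar>y\<bar>" | "\<bar>x\<bar> \<le> \<bar>y\<bar>" "\<bar>z\<bar> \<le> \<bar>x\<bar>" | "\<bar>y\<bar> \<le> \<bar>z\<bar>" "\<bar>x\<bar> \<le> \<bar>y\<bar>"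
    | "\<bar>z\<bar> \<le> \<bar>x\<bar>" "\<bar>y\<bar> \<le> \<bar>z\<bar>" | "\<bar>z\<bar> \<le> \<bar>y\<bar>" "\<bar>x\<bar> \<le> \<bar>z\<bar>" | "\<bar>x\<bar> \<le> \<bar>z\<bar>" "\<bar>y\<bar> \<le> \<bar>x\<bar>"
    by linarith
  then show ?thesis
    by cases (use 1 2 3 assms(2-4) in blast)+
qed

text \<open>Flips come in pairs: the two larger angles are made nonnegative, and the last one keeps
  the sign that is left over. This is why the chamber bounds \<open>|z|\<close> rather than
  \<open>z\<close>.\<close>

lemma locally_equiv_chamber:
  assumes "locally_equiv U (Ud x y z)" "\<bar>x\<bar> \<le> b" "\<bar>y\<bar> \<le> \<bar>x\<bar>" "\<bar>z\<bar> \<le> \<bar>y\<bar>"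
  shows "\<exists>x y z. \<bar>z\<bar> \<le> y \<and> y \<le> x \<and> x \<le> b \<and> locally_equiv U (Ud x y z)"
proof -
  note flips = locally_equiv_flip12[OF assms(1)] locally_equiv_flip13[OF assms(1)] locally_equiv_flip23[OF assms(1)]
  consider "0 \<le> x" "0 \<le> y" | "x \<le> 0" "y \<le> 0" | "x \<le> 0" "0 \<le> y" | "0 \<le> x" "y \<le> 0" by linarith
  then show ?thesis
  proof cases
    case 1 with assms show ?thesis by (intro exI[of _ x] exI[of _ y] exI[of _ z]) auto
  next
    case 2 with assms flips show ?thesis by (intro exI[of _ "- x"] exI[of _ "- y"] exI[of _ z]) auto
  next
    case 3 with assms flips show ?thesis by (intro exI[of _ "- x"] exI[of _ y] exI[of _ "- z"]) auto
  next
    case 4 with assms flips show ?thesis by (intro exI[of _ x] exI[of _ "- y"] exI[of _ "- z"]) auto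
  qed
qed

lemma unitary_locally_equiv_Ud:
  assumes "unitary U"
  shows "\<exists>x y z. locally_equiv U (Ud x y z)"
proof -
  obtain K L d where KL: "local_gate K" "local_gate L" and d: "\<forall>k. cmod (d k) = 1"
    and U: "U = K ** (magic ** diag_mat d ** conj_transpose magic) ** L"
    using unitary_local_magic_diag[OF assms] .
  define f where "f k = Arg (d k)" for k
  have f: "d k = cis (f k)" for k
    using d[rule_format, of k] rcis_cmod_Arg[of "d k"] by (simp add: f_def rcis_def)
  \<comment> \<open>Inverts \<open>magic_phase\<close>: its three sign patterns and the constant one
    are orthogonal, so the coefficients are signed averages of the four phases. \<open>m\<close> is
    a global phase and goes into \<open>K\<close>.\<close>
  define m where "m = (f (1,1) + f (1,2) + f (2,1) + f (2,2)) / 4"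
  define x where "x = (f (1,1) + f (1,2) - f (2,1) - f (2,2)) / 4"
  define y where "y = (- f (1,1) + f (1,2) - f (2,1) + f (2,2)) / 4"
  define z where "z = (f (1,1) - f (1,2) - f (2,1) + f (2,2)) / 4"
  have phase: "f (i, j) = m + magic_phase x y z (i, j)" for i j
    using exhaust_2[of i] exhaust_2[of j]
    by (auto simp: m_def x_def y_def z_def field_simps)
  have "diag_mat d = cscale (cis m) (diag_mat (\<lambda>k. cis (magic_phase x y z k)))"
    by (simp add: matrix_eq_4x4 diag_mat_nth f phase cis_mult)
  then have "U = cscale (cis m) K ** Ud x y z ** L"
    unfolding U Ud_eq by (simp add: cscale_mult_left cscale_mult_right)
  then show ?thesis using KL local_gate_cscale
    by (metis locally_equivI norm_cis)
qed

lemma cartan_form_exists: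
  assumes "unitary U"
  shows "\<exists>x y z. cartan_form U x y z"
proof -
  obtain x y z where "locally_equiv U (Ud x y z)"
    using unitary_locally_equiv_Ud[OF assms] by blast
  then obtain x y z where "\<bar>x\<bar> \<le> pi / 4" "\<bar>y\<bar> \<le> pi / 4" "\<bar>z\<bar> \<le> pi / 4" "locally_equiv U (Ud x y z)"
    using locally_equiv_reduce by blast
  then obtain x y z where "\<bar>x\<bar> \<le> pi / 4" "\<bar>y\<bar> \<le> \<bar>x\<bar>" "\<bar>z\<bar> \<le> \<bar>y\<bar>" "locally_equiv U (Ud x y z)"
    using locally_equiv_sort by blast
  then obtain x y z where "\<bar>z\<bar> \<le> y" "y \<le> x" "x \<le> pi / 4" "locally_equiv U (Ud x y z)"
    using locally_equiv_chamber by blast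
  then show ?thesis unfolding cartan_form_def locally_equiv_def local_gate_def by blast
qed


section \<open>The operator-Schmidt spectrum\<close>

text \<open>The product formulas for the spectrum after \<open>cos^2 t = (1 + cos 2t) / 2\<close>:
  the odd terms cancel and pairwise products of the \<open>cos 2t\<close> remain.\<close>

definition weyl_spectrum :: "real \<Rightarrow> real \<Rightarrow> real \<Rightarrow> real multiset" where
  "weyl_spectrum a b c =
     {# (1 + a * b + a * c + b * c) / 4, (1 - a * b - a * c + b * c) / 4,
        (1 - a * b + a * c - b * c) / 4, (1 + a * b - a * c - b * c) / 4 #}"

text \<open>Inverts the expansion: \<open>u 0 + u 3\<close> and \<open>u 0 - u 3\<close> are
  diagonal entries, \<open>u 1 + u 2\<close> and \<open>u 1 - u 2\<close> antidiagonal ones.\<close>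

definition pauli_coeff :: "op2 \<Rightarrow> nat \<Rightarrow> complex" where
  "pauli_coeff V j =
     [(V $ (1,1) $ (1,1) + V $ (1,2) $ (1,2)) / 2, (V $ (1,2) $ (2,1) + V $ (1,1) $ (2,2)) / 2,
      (V $ (1,2) $ (2,1) - V $ (1,1) $ (2,2)) / 2, (V $ (1,1) $ (1,1) - V $ (1,2) $ (1,2)) / 2] ! j"

lemma sum_lessThan_4: "(\<Sum>j<4. f j) = f 0 + f (Suc 0) + f 2 + f (3 :: nat)"
  by (simp add: eval_nat_numeral)

lemma image_mset_lessThan_4: "image_mset f (mset_set {..<4}) = {# f 0, f (Suc 0), f 2, f (3 :: nat) #}"
  by (simp add: eval_nat_numeral lessThan_Suc)

lemma pauli_coeff_simps:
  "pauli_coeff V 0 = (V $ (1,1) $ (1,1) + V $ (1,2) $ (1,2)) / 2"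
  "pauli_coeff V (Suc 0) = (V $ (1,2) $ (2,1) + V $ (1,1) $ (2,2)) / 2"
  "pauli_coeff V 2 = (V $ (1,2) $ (2,1) - V $ (1,1) $ (2,2)) / 2"
  "pauli_coeff V 3 = (V $ (1,1) $ (1,1) - V $ (1,2) $ (1,2)) / 2"
  by (simp_all add: pauli_coeff_def eval_nat_numeral)

lemma pauli_simps:
  "pauli 0 = mat 1" "pauli (Suc 0) = pauli_X" "pauli 2 = pauli_Y" "pauli 3 = pauli_Z"
  by (simp_all add: pauli_def eval_nat_numeral)

text \<open>\<open>is_schmidt_spectrum\<close> quantifies over all expansions, so the coefficients
  have to be determined by the gate.\<close>

lemma pauli_coeff_unique:
  assumes "V = (\<Sum>j<4. cscale (u j) (kron (pauli j) (pauli j)))" "j < 4"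
  shows "u j = pauli_coeff V j"
proof -
  have "j = 0 \<or> j = Suc 0 \<or> j = 2 \<or> j = 3" using assms(2) by auto
  then show ?thesis
    by (elim disjE; hypsubst; unfold pauli_coeff_simps assms(1) sum_lessThan_4 pauli_simps)
       (simp_all add: mat_def)
qed

lemma Ud_pauli_expansion:
  "Ud x y z = (\<Sum>j<4. cscale (pauli_coeff (Ud x y z) j) (kron (pauli j) (pauli j)))"
  unfolding sum_lessThan_4 pauli_simps pauli_coeff_simps matrix_eq_4x4 forall_2
  by (simp add: Ud_nth mat_def field_simps)

text \<open>Each Pauli coefficient of \<open>Ud\<close> is a quarter of a signed sum of four phases;
  \<open>s\<close>, \<open>t\<close>, \<open>u\<close>, \<open>v\<close> stand for these
  signs.\<close>

lemma cmod_cis_sum: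
  "(cmod ((s * cis a + t * cis b + u * cis c + v * cis d) / 4))\<^sup>2 =
     (s\<^sup>2 + t\<^sup>2 + u\<^sup>2 + v\<^sup>2 + 2 * (s * t * cos (a - b) + s * u * cos (a - c) + s * v * cos (a - d)
       + t * u * cos (b - c) + t * v * cos (b - d) + u * v * cos (c - d))) / 16"
  for s t u v :: real
proof -
  define ca sa cb sb cc sc cd sd where "ca = cos a" "sa = sin a" "cb = cos b" "sb = sin b"
    "cc = cos c" "sc = sin c" "cd = cos d" "sd = sin d"
  note defs = this
  have sq: "sa\<^sup>2 = 1 - ca\<^sup>2" "sb\<^sup>2 = 1 - cb\<^sup>2" "sc\<^sup>2 = 1 - cc\<^sup>2" "sd\<^sup>2 = 1 - cd\<^sup>2"
    unfolding defs by (simp_all add: sin_squared_eq)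
  show ?thesis
    unfolding cmod_power2 cos_diff
    by (simp add: power_divide add_divide_distrib[symmetric] flip: defs)
       (use sq in algebra)
qed

lemma pauli_coeff_cmod:
  fixes x y z :: real
  defines "a \<equiv> cos (2 * x)" and "b \<equiv> cos (2 * y)" and "c \<equiv> cos (2 * z)"
  shows "(cmod (pauli_coeff (Ud x y z) 0))\<^sup>2 = (1 + a * b + a * c + b * c) / 4"
    "(cmod (pauli_coeff (Ud x y z) (Suc 0)))\<^sup>2 = (1 - a * b - a * c + b * c) / 4"
    "(cmod (pauli_coeff (Ud x y z) 2))\<^sup>2 = (1 - a * b + a * c - b * c) / 4"
    "(cmod (pauli_coeff (Ud x y z) 3))\<^sup>2 = (1 + a * b - a * c - b * c) / 4"
proof -
  let ?S = "\<lambda>p q r s. complex_of_real p * cis (x - y + z) + complex_of_real q * cis (- x + y + z)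
       + complex_of_real r * cis (x + y - z) + complex_of_real s * cis (- x - y - z)"
  have eq: "pauli_coeff (Ud x y z) 0 = ?S 1 1 1 1 / 4" "pauli_coeff (Ud x y z) (Suc 0) = ?S 1 (- 1) 1 (- 1) / 4"
    "pauli_coeff (Ud x y z) 2 = ?S (- 1) 1 1 (- 1) / 4" "pauli_coeff (Ud x y z) 3 = ?S 1 1 (- 1) (- 1) / 4"
    unfolding pauli_coeff_simps Ud_nth by (simp_all add: field_simps)
  have args: "x - y + z - (- x + y + z) = 2 * x - 2 * y" "x - y + z - (x + y - z) = 2 * z - 2 * y"
    "x - y + z - (- x - y - z) = 2 * x + 2 * z" "- x + y + z - (x + y - z) = 2 * z - 2 * x"
    "- x + y + z - (- x - y - z) = 2 * y + 2 * z" "x + y - z - (- x - y - z) = 2 * x + 2 * y"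
    by simp_all
  show "(cmod (pauli_coeff (Ud x y z) 0))\<^sup>2 = (1 + a * b + a * c + b * c) / 4"
    "(cmod (pauli_coeff (Ud x y z) (Suc 0)))\<^sup>2 = (1 - a * b - a * c + b * c) / 4"
    "(cmod (pauli_coeff (Ud x y z) 2))\<^sup>2 = (1 - a * b + a * c - b * c) / 4"
    "(cmod (pauli_coeff (Ud x y z) 3))\<^sup>2 = (1 + a * b - a * c - b * c) / 4"
    unfolding eq cmod_cis_sum args a_def b_def c_def cos_diff cos_add by (simp_all add: field_simps)
qed

lemma is_schmidt_spectrum_iff:
  "is_schmidt_spectrum U P \<longleftrightarrow>
     (\<exists>x y z. cartan_form U x y z \<and> P = weyl_spectrum (cos (2 * x)) (cos (2 * y)) (cos (2 * z)))"
proof -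
  have *: "(\<exists>u. Ud x y z = (\<Sum>j<4. cscale (u j) (kron (pauli j) (pauli j))) \<and>
        P = {# (cmod (u j))\<^sup>2. j \<in># mset_set {..<4} #})
      \<longleftrightarrow> P = weyl_spectrum (cos (2 * x)) (cos (2 * y)) (cos (2 * z))" (is "?L \<longleftrightarrow> ?R") for x y z
  proof
    assume ?L
    then obtain u where u: "Ud x y z = (\<Sum>j<4. cscale (u j) (kron (pauli j) (pauli j)))"
      and P: "P = {# (cmod (u j))\<^sup>2. j \<in># mset_set {..<4} #}" by blast
    have "P = {# (cmod (pauli_coeff (Ud x y z) j))\<^sup>2. j \<in># mset_set {..<4} #}"
      unfolding P using pauli_coeff_unique[OF u] by (intro image_mset_cong) auto
    then show ?R
      by (simp add: image_mset_lessThan_4 pauli_coeff_cmod weyl_spectrum_def)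
  next
    assume ?R
    then have "P = {# (cmod (pauli_coeff (Ud x y z) j))\<^sup>2. j \<in># mset_set {..<4} #}"
      by (simp add: image_mset_lessThan_4 pauli_coeff_cmod weyl_spectrum_def)
    then show ?L using Ud_pauli_expansion by blast
  qed
  show ?thesis unfolding is_schmidt_spectrum_def by (simp only: ex_simps *)
qed


text \<open>Realignment turns \<open>\<Sum>\<^sub>j u\<^sub>j \<sigma>\<^sub>j \<otimes> \<sigma>\<^sub>j\<close> into \<open>\<Sum>\<^sub>j u\<^sub>j vec \<sigma>\<^sub>j (vec \<sigma>\<^sub>j)\<^sup>T\<close>, whose squared singular
  values are the \<open>4 p\<^sub>j\<close>, and it turns local gates into unitary factors on both sides.\<close>

definition realign :: "op2 \<Rightarrow> op2" where
  "realign U = (\<chi> r c. U $ (fst r, fst c) $ (snd r, snd c))"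

lemma realign_nth [simp]: "realign U $ (i, k) $ (j, l) = U $ (i, j) $ (k, l)"
  by (simp add: realign_def)

lemma realign_local:
  "realign (kron A B ** U ** kron C D) =
     kron A (transpose C) ** realign U ** kron (transpose B) D"
  unfolding matrix_eq_4x4 forall_2
  by (simp add: matrix_matrix_mult_def sum_UNIV_prod sum_2 transpose_def algebra_simps)

definition schmidt_gram :: "op2 \<Rightarrow> op2" where
  "schmidt_gram U = realign U ** conj_transpose (realign U)"

lemma matrix_diff_ldistrib: "A ** (B - C) = A ** B - A ** C" for A :: "'a::ring_1^'n^'m"
  by (simp add: vec_eq_iff matrix_matrix_mult_def right_diff_distrib sum_subtractf)

lemma matrix_diff_rdistrib: "(A - B) ** C = A ** C - B ** C" for A :: "'a::ring_1^'n^'m"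
  by (simp add: vec_eq_iff matrix_matrix_mult_def left_diff_distrib sum_subtractf)

lemma det_conjugate:
  assumes "unitary V"
  shows "det (mat c - V ** A ** conj_transpose V) = det (mat c - A)"
proof -
  have "V ** mat c ** conj_transpose V = mat c"
  proof -
    have "V ** mat c ** conj_transpose V = cscale c (V ** conj_transpose V)"
      by (simp add: vec_eq_iff matrix_matrix_mult_def mat_def if_distrib if_distribR sum_distrib_left mult_ac cong: if_cong)
    then show ?thesis using assms by (simp add: unitary_def vec_eq_iff mat_def)
  qed
  then have "mat c - V ** A ** conj_transpose V = V ** (mat c - A) ** conj_transpose V"
    by (simp add: matrix_diff_ldistrib matrix_diff_rdistrib)
  moreover have "det V * det (conj_transpose V) = 1"
    using assms by (metis det_I det_mul unitary_def)
  ultimately show ?thesis by (simp add: det_mul)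
qed

lemma det_schmidt_gram_local:
  assumes "unitary A" "unitary B" "unitary C" "unitary D"
  shows "det (mat c - schmidt_gram (kron A B ** U ** kron C D)) = det (mat c - schmidt_gram U)"
proof -
  let ?V = "kron A (transpose C)" and ?W = "kron (transpose B) D"
  have V: "unitary ?V" "unitary ?W"
    using assms by (simp_all add: unitary_kron unitary_transpose)
  have "schmidt_gram (kron A B ** U ** kron C D) =
      ?V ** realign U ** (?W ** conj_transpose ?W) ** conj_transpose (realign U) ** conj_transpose ?V"
    by (simp add: schmidt_gram_def realign_local conj_transpose_matrix_mult matrix_mul_assoc)
  also have "\<dots> = ?V ** schmidt_gram U ** conj_transpose ?V"
    using V(2) by (simp add: unitary_def schmidt_gram_def matrix_mul_assoc)
  finally show ?thesis using det_conjugate[OF V(1)] by simp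
qed

lemma det_schmidt_gram_Ud:
  "det (mat (of_real t) - schmidt_gram (Ud x y z)) =
     of_real (\<Prod>p\<in>#weyl_spectrum (cos (2 * x)) (cos (2 * y)) (cos (2 * z)). t - 4 * p)"
proof -
  define u where "u = pauli_coeff (Ud x y z)"
  \<comment> \<open>Up to normalisation the columns of \<open>magic\<close> are the vectorised
    \<open>I, iX, iY, iZ\<close>: the norms give the factor 2, and \<open>i^2\<close> gives the
    minus signs.\<close>
  define r where "r k = (if k = (1,1) then 2 * u 0 else if k = (1,2) then - 2 * u (Suc 0)
     else if k = (2,1) then - 2 * u 2 else - 2 * u 3)" for k :: "2 \<times> 2"
  have "realign (Ud x y z) = magic ** diag_mat r ** transpose magic"
    unfolding matrix_eq_4x4 forall_2 matrix_matrix_mult_def[of "magic ** _"]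
    by (simp add: mult_diag_mat sum_UNIV_prod sum_2 transpose_def r_def u_def pauli_coeff_simps Ud_nth)
       (simp add: field_simps)
  then have "schmidt_gram (Ud x y z) = magic ** diag_mat r ** (transpose magic ** conj_transpose (transpose magic))
      ** diag_mat (\<lambda>k. cnj (r k)) ** conj_transpose magic"
    by (simp add: schmidt_gram_def conj_transpose_matrix_mult conj_transpose_diag_mat matrix_mul_assoc)
  also have "transpose magic ** conj_transpose (transpose magic) = mat 1"
    using unitary_transpose[OF unitary_magic] by (simp add: unitary_def)
  also have "magic ** diag_mat r ** mat 1 ** diag_mat (\<lambda>k. cnj (r k)) ** conj_transpose magic
    = magic ** diag_mat (\<lambda>k. of_real ((cmod (r k))\<^sup>2)) ** conj_transpose magic"
    by (simp add: diag_mat_mult complex_norm_square del: of_real_power flip: matrix_mul_assoc[of _ "diag_mat _" "diag_mat _"])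
  finally have "det (mat (of_real t) - schmidt_gram (Ud x y z))
     = det (mat (of_real t) - diag_mat (\<lambda>k. of_real ((cmod (r k))\<^sup>2)))"
    by (simp add: det_conjugate[OF unitary_magic])
  also have "\<dots> = (\<Prod>k\<in>UNIV. of_real (t - (cmod (r k))\<^sup>2))"
    by (subst det_diagonal) (simp_all add: mat_def diag_mat_nth)
  also have "\<dots> = of_real (\<Prod>k\<in>UNIV. t - (cmod (r k))\<^sup>2)" by simp
  also have "(\<Prod>k\<in>UNIV. t - (cmod (r k))\<^sup>2) = (t - 4 * (cmod (u 0))\<^sup>2) * (t - 4 * (cmod (u (Suc 0)))\<^sup>2) * (t - 4 * (cmod (u 2))\<^sup>2) * (t - 4 * (cmod (u 3))\<^sup>2)"
    by (simp add: prod.cartesian_product[symmetric] UNIV_2 r_def norm_mult power_mult_distrib mult_ac flip: UNIV_Times_UNIV)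
  finally show ?thesis
    by (simp add: u_def pauli_coeff_cmod weyl_spectrum_def mult_ac)
qed

lemma proots_prod_linear: "proots (\<Prod>p\<in>#P. [:- p, 1:]) = P" for P :: "'a::idom multiset"
proof (induction P)
  case (add p P)
  have "(\<Prod>p\<in>#P. [:- p, 1:]) \<noteq> 0" by (simp add: prod_mset_zero_iff image_iff)
  with add show ?case by (simp add: proots_mult del: mult_pCons_left)
qed simp

text \<open>The characteristic polynomial of \<open>schmidt_gram\<close> is invariant under local
  gates and has the numbers \<open>4 p\<close> as its roots, with multiplicity. Comparing root
  multisets requires no ordering of the \<open>p\<close>.\<close>

lemma weyl_spectrum_unique:
  assumes "cartan_form U x y z" "cartan_form U x' y' z'"
  shows "weyl_spectrum (cos (2 * x)) (cos (2 * y)) (cos (2 * z)) = weyl_spectrum (cos (2 * x')) (cos (2 * y')) (cos (2 * z'))"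
    (is "?P = ?P'")
proof -
  let ?q = "\<lambda>P. \<Prod>p\<in>#P. [:- p, 1:] :: real poly"
  have "det (mat c - schmidt_gram U) = det (mat c - schmidt_gram (Ud x y z))"
    if "cartan_form U x y z" for c x y z
    using that det_schmidt_gram_local by (auto simp: cartan_form_def)
  from this[OF assms(1)] this[OF assms(2)]
  have "det (mat c - schmidt_gram (Ud x y z)) = det (mat c - schmidt_gram (Ud x' y' z'))" for c
    by simp
  from this[of "of_real _"] have "complex_of_real (\<Prod>p\<in>#?P. t - 4 * p) = complex_of_real (\<Prod>p\<in>#?P'. t - 4 * p)" for t
    unfolding det_schmidt_gram_Ud .
  then have eq: "(\<Prod>p\<in>#?P. t - 4 * p) = (\<Prod>p\<in>#?P'. t - 4 * p)" for t
    by (simp only: of_real_eq_iff)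
  \<comment> \<open>Rescaling the variable by 4 gives the monic polynomial with roots
    \<open>p\<close>, up to the factor \<open>4 ^ size\<close>, which agrees on both sides.\<close>
  have "poly (?q ?P) t = poly (?q ?P') t" for t
  proof -
    have scale: "(\<Prod>p\<in>#P. 4 * t - 4 * p) = 4 ^ size P * poly (?q P) t" for P
      by (induction P) (simp_all add: algebra_simps)
    have "size ?P = size ?P'" by (simp add: weyl_spectrum_def)
    with eq[of "4 * t"] show ?thesis unfolding scale by simp
  qed
  then have "?q ?P = ?q ?P'" by (simp only: flip: poly_eq_poly_eq_iff) (rule ext)
  then show ?thesis by (metis proots_prod_linear)
qed

lemma schmidt_spectrum_eq:
  assumes "cartan_form U x y z"
  shows "schmidt_spectrum U = weyl_spectrum (cos (2 * x)) (cos (2 * y)) (cos (2 * z))"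
  unfolding schmidt_spectrum_def is_schmidt_spectrum_iff
  by (rule the_equality) (use assms weyl_spectrum_unique in blast)+

lemma cartan_form_Ud: "\<bar>z\<bar> \<le> y \<Longrightarrow> y \<le> x \<Longrightarrow> x \<le> pi / 4 \<Longrightarrow> cartan_form (Ud x y z) x y z"
  unfolding cartan_form_def by (intro conjI exI[of _ "mat 1"]) auto


section \<open>Binary entropy\<close>

text \<open>Natural logarithms keep the derivatives free of constants; the factor
  \<open>ln 2\<close> returns in \<open>h2_eq\<close> and
  \<open>spectrum_functionals\<close>.\<close>

definition xlnx :: "real \<Rightarrow> real" where
  "xlnx p = p * ln p"

definition neg_entropy2 :: "real \<Rightarrow> real" where
  "neg_entropy2 t = xlnx t + xlnx (1 - t)"

definition sqrt_sum2 :: "real \<Rightarrow> real" where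
  "sqrt_sum2 t = sqrt t + sqrt (1 - t)"

lemma xlnx_0 [simp]: "xlnx 0 = 0" and xlnx_1 [simp]: "xlnx 1 = 0"
  by (simp_all add: xlnx_def)

lemma xlnx_mult: "0 \<le> a \<Longrightarrow> 0 \<le> b \<Longrightarrow> xlnx (a * b) = b * xlnx a + a * xlnx b"
  by (cases "a = 0 \<or> b = 0") (auto simp: xlnx_def ln_mult algebra_simps)

text \<open>The left-hand side is the tangent to \<open>xlnx\<close> at \<open>m\<close>; after
  division by \<open>p\<close> this is \<open>ln y <= y - 1\<close> at
  \<open>y = m / p\<close>.\<close>

lemma xlnx_tangent: "0 \<le> p \<Longrightarrow> 0 < m \<Longrightarrow> p * ln m + p - m \<le> xlnx p"
proof (cases "p = 0")
  case False
  assume "0 \<le> p" "0 < m"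
  with False have "p > 0" by simp
  have "ln (m / p) \<le> m / p - 1" using \<open>0 < m\<close> \<open>p > 0\<close> by (intro ln_le_minus_one) simp
  then have "p * (ln m - ln p) \<le> p * (m / p - 1)"
    using \<open>0 < m\<close> \<open>p > 0\<close> by (intro mult_left_mono) (simp_all add: ln_div)
  then show ?thesis using \<open>p > 0\<close> by (simp add: xlnx_def algebra_simps)
qed simp

lemma xlnx_tangent_strict: "0 < p \<Longrightarrow> 0 < m \<Longrightarrow> p \<noteq> m \<Longrightarrow> p * ln m + p - m < xlnx p"
proof -
  assume p: "0 < p" "0 < m" "p \<noteq> m"
  have "ln (m / p) \<noteq> m / p - 1" using ln_eq_minus_one[of "m / p"] p by auto
  moreover have "ln (m / p) \<le> m / p - 1" using p by (intro ln_le_minus_one) simp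
  ultimately have "p * (ln m - ln p) < p * (m / p - 1)"
    using p by (intro mult_strict_left_mono) (simp_all add: ln_div)
  then show ?thesis using p by (simp add: xlnx_def algebra_simps)
qed

lemma continuous_on_xlnx: "continuous_on {0..} xlnx"
proof -
  have "continuous (at x within {0..}) xlnx" if "x \<ge> 0" for x
  proof (cases "x = 0")
    case True
    have "(xlnx \<longlongrightarrow> 0) (at_right 0)" unfolding xlnx_def by real_asymp
    moreover have "at 0 within {0..} = at_right (0 :: real)" by (rule at_within_Ici_at_right)
    ultimately show ?thesis using True by (simp add: continuous_within)
  next
    case False
    with that have "isCont xlnx x" unfolding xlnx_def by (intro continuous_intros) auto
    then show ?thesis by (rule continuous_at_imp_continuous_at_within)
  qed
  then show ?thesis by (simp add: continuous_on_eq_continuous_within)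
qed

lemma continuous_on_xlnx_comp [continuous_intros]:
  "continuous_on S f \<Longrightarrow> (\<And>x. x \<in> S \<Longrightarrow> 0 \<le> f x) \<Longrightarrow> continuous_on S (\<lambda>x. xlnx (f x))"
  by (rule continuous_on_compose2[OF continuous_on_xlnx]) auto

lemma DERIV_xlnx [derivative_intros]:
  "(f has_real_derivative D) (at x within S) \<Longrightarrow> 0 < f x \<Longrightarrow>
     ((\<lambda>x. xlnx (f x)) has_real_derivative (ln (f x) + 1) * D) (at x within S)"
  unfolding xlnx_def by (auto intro!: derivative_eq_intros simp: field_simps)

lemma continuous_on_neg_entropy2: "S \<subseteq> {0..1} \<Longrightarrow> continuous_on S neg_entropy2"
  unfolding neg_entropy2_def by (intro continuous_intros) auto

lemma DERIV_neg_entropy2: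
  "0 < t \<Longrightarrow> t < 1 \<Longrightarrow> (neg_entropy2 has_real_derivative ln t - ln (1 - t)) (at t)"
  unfolding neg_entropy2_def by (auto intro!: derivative_eq_intros)

lemma neg_entropy2_strict_mono:
  assumes "1 / 2 \<le> s" "s < t" "t \<le> 1"
  shows "neg_entropy2 s < neg_entropy2 t"
proof (rule DERIV_pos_imp_increasing_open[OF assms(2)])
  fix x assume "s < x" "x < t"
  then show "\<exists>y. (neg_entropy2 has_real_derivative y) (at x) \<and> 0 < y"
    using assms by (intro exI[of _ "ln x - ln (1 - x)"] conjI DERIV_neg_entropy2) auto
next
  show "continuous_on {s..t} neg_entropy2" using assms by (intro continuous_on_neg_entropy2) auto
qed

lemma neg_entropy2_less_iff: "s \<in> {1/2..1} \<Longrightarrow> t \<in> {1/2..1} \<Longrightarrow> neg_entropy2 s < neg_entropy2 t \<longleftrightarrow> s < t"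
  by (cases s t rule: linorder_cases) (use neg_entropy2_strict_mono[of s t] neg_entropy2_strict_mono[of t s] in auto)

lemma neg_entropy2_1 [simp]: "neg_entropy2 1 = 0"
  by (simp add: neg_entropy2_def)

lemma neg_entropy2_half: "neg_entropy2 (1 / 2) = - ln 2"
  by (simp add: neg_entropy2_def xlnx_def ln_div)

lemma neg_entropy2_ge: "0 \<le> t \<Longrightarrow> t \<le> 1 \<Longrightarrow> - ln 2 \<le> neg_entropy2 t"
  using xlnx_tangent[of t "1/2"] xlnx_tangent[of "1 - t" "1/2"]
  by (simp add: neg_entropy2_def ln_div algebra_simps)

lemma neg_entropy2_surj:
  assumes "- ln 2 \<le> u" "u \<le> 0"
  obtains z where "z \<in> {1/2..1}" "neg_entropy2 z = u"
  using IVT'[of neg_entropy2 "1/2" u 1] assms continuous_on_neg_entropy2[of "{1/2..1}"]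
  by (auto simp: neg_entropy2_half)

lemma sqrt_sum2_sq: "0 \<le> t \<Longrightarrow> t \<le> 1 \<Longrightarrow> (sqrt_sum2 t)\<^sup>2 = 1 + 2 * sqrt (t * (1 - t))"
  by (simp add: sqrt_sum2_def power2_sum real_sqrt_mult)

lemma sqrt_sum2_pos: "0 \<le> t \<Longrightarrow> t \<le> 1 \<Longrightarrow> 0 < sqrt_sum2 t"
  by (cases "t = 0") (auto simp: sqrt_sum2_def intro!: add_pos_nonneg)

lemma sqrt_sum2_antimono:
  assumes "1 / 2 \<le> s" "s \<le> t" "t \<le> 1"
  shows "sqrt_sum2 t \<le> sqrt_sum2 s"
proof (rule power2_le_imp_le)
  have "0 \<le> (t - s) * (t + s - 1)" using assms by (intro mult_nonneg_nonneg) auto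
  then have "t * (1 - t) \<le> s * (1 - s)" by (simp add: algebra_simps)
  then show "(sqrt_sum2 t)\<^sup>2 \<le> (sqrt_sum2 s)\<^sup>2" using assms by (simp add: sqrt_sum2_sq)
qed (use sqrt_sum2_pos[of s] assms in auto)

text \<open>Jensen's inequality, by adding the tangents at the mean.\<close>

lemma xlnx_sum3_ge:
  assumes "0 \<le> a" "0 \<le> b" "0 \<le> c"
  shows "3 * xlnx ((a + b + c) / 3) \<le> xlnx a + xlnx b + xlnx c"
proof (cases "a + b + c = 0")
  case True
  with assms have "a = 0 \<and> b = 0 \<and> c = 0" by linarith
  then show ?thesis by simp
next
  case False
  let ?m = "(a + b + c) / 3"
  have "?m > 0" using assms False by simp
  from xlnx_tangent[OF assms(1) this] xlnx_tangent[OF assms(2) this] xlnx_tangent[OF assms(3) this]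
  have "(a + b + c) * ln ?m + (a + b + c) - 3 * ?m \<le> xlnx a + xlnx b + xlnx c"
    by (simp only: distrib_right)
  moreover have "3 * ?m = a + b + c" by simp
  ultimately show ?thesis unfolding xlnx_def by (simp only: mult.assoc[symmetric])
qed

lemma xlnx_le_mult_ln: "0 \<le> a \<Longrightarrow> a \<le> r \<Longrightarrow> xlnx a \<le> a * ln r"
  by (cases "a = 0") (auto simp: xlnx_def intro!: mult_left_mono)

text \<open>Along the spectra with one value \<open>s\<close> and three equal ones, the entropy
  falls from its maximum at \<open>s = 1/4\<close>. Together with Jensen this bounds the largest
  probability of a competitor.\<close>

lemma xlnx_one_three_strict_mono:
  assumes "1 / 4 \<le> s" "s < t" "t \<le> 1"
  shows "xlnx s + 3 * xlnx ((1 - s) / 3) < xlnx t + 3 * xlnx ((1 - t) / 3)"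
proof (rule DERIV_pos_imp_increasing_open[OF assms(2)])
  fix x assume "s < x" "x < t"
  with assms have x: "1 / 4 < x" "x < 1" by auto
  then have "ln ((1 - x) / 3) < ln x" by (subst ln_less_cancel_iff) auto
  with x show "\<exists>y. ((\<lambda>x. xlnx x + 3 * xlnx ((1 - x) / 3)) has_real_derivative y) (at x) \<and> 0 < y"
    by (intro exI[of _ "ln x - ln ((1 - x) / 3)"]) (auto intro!: derivative_eq_intros simp: field_simps)
next
  show "continuous_on {s..t} (\<lambda>x. xlnx x + 3 * xlnx ((1 - x) / 3))"
    using assms by (intro continuous_intros) auto
qed


section \<open>Inequalities for the operator entanglement\<close>

text \<open>Let \<open>T\<close> be the sum of the six products \<open>s_i s_j\<close> and
  \<open>R\<close> the sum of products of two different ones among them. The sum of the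
  \<open>p_i p_j\<close> is \<open>T^2 - 2 R\<close>, so the bound is \<open>R >= 0\<close>, with
  equality only if at most one \<open>s_i s_j\<close> is nonzero.\<close>

lemma sum_sqrt_lower_rank_two:
  fixes p0 p1 p2 p3 :: real
  assumes ord: "p3 \<le> p2" "p2 \<le> p1" "p1 \<le> p0" "0 \<le> p3" and sum: "p0 + p1 + p2 + p3 = 1"
  defines "e \<equiv> 1 - (p0\<^sup>2 + p1\<^sup>2 + p2\<^sup>2 + p3\<^sup>2)"
  defines "g \<equiv> 2 * (sqrt p0 + sqrt p1 + sqrt p2 + sqrt p3)\<^sup>2 - 1"
  shows "1 + 2 * sqrt (2 * e) \<le> g" "g = 1 + 2 * sqrt (2 * e) \<Longrightarrow> p2 = 0 \<and> p3 = 0"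
proof -
  define s0 s1 s2 s3 where s: "s0 = sqrt p0" "s1 = sqrt p1" "s2 = sqrt p2" "s3 = sqrt p3"
  have s_nn: "0 \<le> s0" "0 \<le> s1" "0 \<le> s2" "0 \<le> s3" using ord by (auto simp: s)
  have p: "p0 = s0\<^sup>2" "p1 = s1\<^sup>2" "p2 = s2\<^sup>2" "p3 = s3\<^sup>2" using ord by (auto simp: s)
  define T where "T = s0 * s1 + s0 * s2 + s0 * s3 + s1 * s2 + s1 * s3 + s2 * s3"
  have T0: "0 \<le> T" unfolding T_def using s_nn by simp
  have g: "g = 1 + 4 * T"
  proof -
    have "(s0 + s1 + s2 + s3)\<^sup>2 = (s0\<^sup>2 + s1\<^sup>2 + s2\<^sup>2 + s3\<^sup>2) + 2 * T"
      unfolding T_def by algebra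
    then show ?thesis using sum unfolding g_def p by (simp add: s_nn)
  qed
  define R where "R = s0 * s1 * (s0 * s2 + s0 * s3 + s1 * s2 + s1 * s3 + s2 * s3)
    + s0 * s2 * (s0 * s3 + s1 * s2 + s1 * s3 + s2 * s3) + s0 * s3 * (s1 * s2 + s1 * s3 + s2 * s3)
    + s1 * s2 * (s1 * s3 + s2 * s3) + s1 * s3 * (s2 * s3)"
  have R0: "s0 * s1 * (s0 * s2) \<le> R" unfolding R_def using s_nn by (simp add: algebra_simps)
  have "1 = (p0 + p1 + p2 + p3)\<^sup>2" using sum by simp
  then have e: "2 * e = (2 * T)\<^sup>2 - 8 * R"
    unfolding e_def T_def R_def p by algebra
  have "0 \<le> s0 * s1 * (s0 * s2)" using s_nn by simp
  with R0 have "R \<ge> 0" by linarith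
  then have le: "sqrt (2 * e) \<le> 2 * T" using T0 e by (intro real_le_lsqrt) auto
  then show "1 + 2 * sqrt (2 * e) \<le> g" by (simp add: g)
  assume "g = 1 + 2 * sqrt (2 * e)"
  then have "sqrt (2 * e) = 2 * T" by (simp add: g)
  moreover have "0 \<le> 2 * e"
  proof -
    have "e = 2 * (p0 * p1 + p0 * p2 + p0 * p3 + p1 * p2 + p1 * p3 + p2 * p3)"
      using \<open>1 = (p0 + p1 + p2 + p3)\<^sup>2\<close> unfolding e_def by algebra
    moreover have "0 \<le> p0 * p1 + p0 * p2 + p0 * p3 + p1 * p2 + p1 * p3 + p2 * p3" using ord by simp
    ultimately show ?thesis by simp
  qed
  ultimately have "2 * e = (2 * T)\<^sup>2" by (metis real_sqrt_pow2)
  with e have "R = 0" by simp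
  with R0 \<open>0 \<le> s0 * s1 * (s0 * s2)\<close> have "s0 * s1 * (s0 * s2) = 0" by linarith
  then have "s2 = 0" using ord s by auto
  then show "p2 = 0 \<and> p3 = 0" using ord p by auto
qed

text \<open>The radicands have the same sum on both sides, while their products differ by
  \<open>x y\<close>.\<close>

lemma sqrt_add_subadd:
  fixes w x y :: real
  assumes "0 \<le> w" "0 \<le> x" "0 \<le> y"
  shows "sqrt w + sqrt (w + x + y) \<le> sqrt (w + x) + sqrt (w + y)"
    "sqrt w + sqrt (w + x + y) = sqrt (w + x) + sqrt (w + y) \<Longrightarrow> x = 0 \<or> y = 0"
proof -
  have prod: "w * (w + x + y) \<le> (w + x) * (w + y)" using assms by (simp add: algebra_simps)
  have sq: "(sqrt w + sqrt (w + x + y))\<^sup>2 = 2 * w + x + y + 2 * sqrt (w * (w + x + y))"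
    "(sqrt (w + x) + sqrt (w + y))\<^sup>2 = 2 * w + x + y + 2 * sqrt ((w + x) * (w + y))"
    using assms by (simp_all add: power2_sum real_sqrt_mult mult.assoc)
  show "sqrt w + sqrt (w + x + y) \<le> sqrt (w + x) + sqrt (w + y)"
  proof (rule power2_le_imp_le)
    show "(sqrt w + sqrt (w + x + y))\<^sup>2 \<le> (sqrt (w + x) + sqrt (w + y))\<^sup>2"
      unfolding sq using prod by simp
  qed (use assms in simp)
  assume "sqrt w + sqrt (w + x + y) = sqrt (w + x) + sqrt (w + y)"
  then have "sqrt (w * (w + x + y)) = sqrt ((w + x) * (w + y))" using sq by simp
  then have "w * (w + x + y) = (w + x) * (w + y)" by simp
  then show "x = 0 \<or> y = 0" by (simp add: algebra_simps)
qed

text \<open>The three perfect matchings of the indices group the products \<open>s_i s_j\<close>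
  into pairs. Once \<open>D >= w\<close>, the squared pair sums are at least
  \<open>(w + A^2) / 4\<close> and its analogues, and concavity of the square root does the
  rest.\<close>

lemma sum_sqrt_lower_pair_pair:
  fixes A B C :: real
  assumes ord: "0 \<le> C" "C \<le> B" "B \<le> A" "A * B \<le> C" and S: "A\<^sup>2 + B\<^sup>2 + C\<^sup>2 \<le> 1"
    and nn: "0 \<le> 1 - A + B - C" "0 \<le> 1 - A - B + C"
  defines "g \<equiv> 2 * (sqrt ((1 + A + B + C) / 4) + sqrt ((1 + A - B - C) / 4)
     + sqrt ((1 - A + B - C) / 4) + sqrt ((1 - A - B + C) / 4))\<^sup>2 - 1"
  shows "3 + 4 * sqrt (1 - (A\<^sup>2 + B\<^sup>2 + C\<^sup>2)) \<le> g"
    "g = 3 + 4 * sqrt (1 - (A\<^sup>2 + B\<^sup>2 + C\<^sup>2)) \<Longrightarrow> B = 0 \<and> C = 0"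
proof -
  define w where "w = 1 - (A\<^sup>2 + B\<^sup>2 + C\<^sup>2)"
  have w0: "0 \<le> w" using S by (simp add: w_def)
  define s0 s1 s2 s3 where s: "s0 = sqrt ((1 + A + B + C) / 4)" "s1 = sqrt ((1 + A - B - C) / 4)"
    "s2 = sqrt ((1 - A + B - C) / 4)" "s3 = sqrt ((1 - A - B + C) / 4)"
  have nn': "0 \<le> 1 + A + B + C" "0 \<le> 1 + A - B - C" using ord nn by linarith+
  have s_nn: "0 \<le> s0" "0 \<le> s1" "0 \<le> s2" "0 \<le> s3" using nn nn' by (auto simp: s)
  have sq: "4 * s0\<^sup>2 = 1 + A + B + C" "4 * s1\<^sup>2 = 1 + A - B - C" "4 * s2\<^sup>2 = 1 - A + B - C" "4 * s3\<^sup>2 = 1 - A - B + C"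
    using nn nn' by (simp_all add: s)
  define D where "D = 16 * (s0 * s1 * s2 * s3)"
  have D0: "0 \<le> D" using s_nn by (simp add: D_def)
  have D2: "D\<^sup>2 = w\<^sup>2 + 4 * (2 * A * B * C - A\<^sup>2 * B\<^sup>2 - C\<^sup>2 * (A\<^sup>2 + B\<^sup>2))"
  proof -
    have "D\<^sup>2 = (4 * s0\<^sup>2) * (4 * s1\<^sup>2) * (4 * s2\<^sup>2) * (4 * s3\<^sup>2)" unfolding D_def by algebra
    then show ?thesis unfolding sq w_def by algebra
  qed
  \<comment> \<open>\<open>D^2 - w^2\<close> is four times this form, which equals
    \<open>C^2 (1 - A^2 - B^2) - (C - A B)^2\<close>. The constraint makes \<open>C - A B\<close>
    nonnegative, so an upper bound for it can be squared.\<close>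
  have quad: "0 \<le> 2 * A * B * C - A\<^sup>2 * B\<^sup>2 - C\<^sup>2 * (A\<^sup>2 + B\<^sup>2)"
  proof -
    have "(C - A * B)\<^sup>2 \<le> C\<^sup>2 * (1 - A\<^sup>2 - B\<^sup>2)"
    \<comment> \<open>Two upper bounds for \<open>C - A B\<close>: \<open>C^2\<close> when
      \<open>1 - C <= A\<close>, and \<open>C (1 - A)\<close> in the other case. The latter suffices
      once \<open>B^2 <= 2 A (1 - A)\<close>.\<close>
    proof (cases "1 - C \<le> A")
      case True
      have "C\<^sup>2 \<le> 1" using S zero_le_power2[of A] zero_le_power2[of B] by linarith
      then have "C \<le> 1" using power2_le_imp_le[of C 1] by simp
      then have "C * (1 - C) \<le> B * A" using True ord by (intro mult_mono) auto
      then have "C - A * B \<le> C * C" by (simp add: algebra_simps)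
      then have "(C - A * B)\<^sup>2 \<le> (C * C)\<^sup>2" using ord by (intro power_mono) auto
      also have "\<dots> = C\<^sup>2 * C\<^sup>2" by (simp add: power2_eq_square)
      also have "\<dots> \<le> C\<^sup>2 * (1 - A\<^sup>2 - B\<^sup>2)" using S by (intro mult_left_mono) auto
      finally show ?thesis .
    next
      case False
      \<comment> \<open>Here \<open>A B <= C < 1 - A\<close>. With \<open>B <= A\<close>, failure
        would force \<open>A > 2/3\<close> and also \<open>2 A^3 < 1 - A\<close>, but at
        \<open>A = 2/3\<close> the left side already exceeds the right one.\<close>
      have "B\<^sup>2 \<le> 2 * A * (1 - A)"
      proof (rule ccontr)
        assume "\<not> B\<^sup>2 \<le> 2 * A * (1 - A)"
        then have B: "2 * A * (1 - A) < B\<^sup>2" by simp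
        have "B\<^sup>2 \<le> A\<^sup>2" using ord by (intro power_mono) auto
        with B have "0 < A * (3 * A - 2)" by (simp add: power2_eq_square algebra_simps)
        then have A: "2 / 3 < A" using ord by (simp add: zero_less_mult_iff)
        have A1: "0 < 1 - A" using False ord by linarith
        have "(A * B)\<^sup>2 \<le> (1 - A)\<^sup>2" using ord False by (intro power_mono) auto
        moreover have "A\<^sup>2 * (2 * A * (1 - A)) < A\<^sup>2 * B\<^sup>2" using B A by (intro mult_strict_left_mono) auto
        ultimately have "(1 - A) * (2 * A ^ 3) < (1 - A) * (1 - A)"
          by (simp add: power_mult_distrib power2_eq_square power3_eq_cube algebra_simps)
        then have "2 * A ^ 3 < 1 - A" using A1 by (simp add: mult_less_cancel_left)
        moreover have "(2 / 3) ^ 3 < A ^ 3" using A by (intro power_strict_mono) auto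
        ultimately show False using A by (simp add: power3_eq_cube)
      qed
      then have *: "(1 - A)\<^sup>2 \<le> 1 - A\<^sup>2 - B\<^sup>2" by (simp add: power2_eq_square algebra_simps)
      have "A * C \<le> A * B" using ord by (intro mult_left_mono) auto
      then have "C - A * B \<le> C * (1 - A)" by (simp add: algebra_simps)
      then have "(C - A * B)\<^sup>2 \<le> (C * (1 - A))\<^sup>2" using ord by (intro power_mono) auto
      also have "\<dots> = C\<^sup>2 * (1 - A)\<^sup>2" by (simp add: power_mult_distrib)
      also have "\<dots> \<le> C\<^sup>2 * (1 - A\<^sup>2 - B\<^sup>2)" using * by (intro mult_left_mono) auto
      finally show ?thesis .
    qed
    moreover have "2 * A * B * C - A\<^sup>2 * B\<^sup>2 - C\<^sup>2 * (A\<^sup>2 + B\<^sup>2)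
      = C\<^sup>2 * (1 - A\<^sup>2 - B\<^sup>2) - (C - A * B)\<^sup>2" by algebra
    ultimately show ?thesis by simp
  qed
  have Dw: "w \<le> D" by (rule power2_le_imp_le) (use D2 quad D0 in auto)
  have TA: "sqrt (w + A\<^sup>2) \<le> 2 * (s0 * s1 + s2 * s3)"
  proof (rule real_le_lsqrt)
    have "(2 * (s0 * s1 + s2 * s3))\<^sup>2 = ((4 * s0\<^sup>2) * (4 * s1\<^sup>2) + (4 * s2\<^sup>2) * (4 * s3\<^sup>2) + 2 * D) / 4"
      unfolding D_def by algebra
    also have "\<dots> = (1 + D + A\<^sup>2 - B\<^sup>2 - C\<^sup>2) / 2" unfolding sq by (simp add: power2_eq_square field_simps)
    finally show "w + A\<^sup>2 \<le> (2 * (s0 * s1 + s2 * s3))\<^sup>2" using Dw by (simp add: w_def)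
  qed (use s_nn in simp)
  have TB: "sqrt (w + B\<^sup>2) \<le> 2 * (s0 * s2 + s1 * s3)"
  proof (rule real_le_lsqrt)
    have "(2 * (s0 * s2 + s1 * s3))\<^sup>2 = ((4 * s0\<^sup>2) * (4 * s2\<^sup>2) + (4 * s1\<^sup>2) * (4 * s3\<^sup>2) + 2 * D) / 4"
      unfolding D_def by algebra
    also have "\<dots> = (1 + D + B\<^sup>2 - A\<^sup>2 - C\<^sup>2) / 2" unfolding sq by (simp add: power2_eq_square field_simps)
    finally show "w + B\<^sup>2 \<le> (2 * (s0 * s2 + s1 * s3))\<^sup>2" using Dw by (simp add: w_def)
  qed (use s_nn in simp)
  have TC: "sqrt (w + C\<^sup>2) \<le> 2 * (s0 * s3 + s1 * s2)"
  proof (rule real_le_lsqrt)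
    have "(2 * (s0 * s3 + s1 * s2))\<^sup>2 = ((4 * s0\<^sup>2) * (4 * s3\<^sup>2) + (4 * s1\<^sup>2) * (4 * s2\<^sup>2) + 2 * D) / 4"
      unfolding D_def by algebra
    also have "\<dots> = (1 + D + C\<^sup>2 - A\<^sup>2 - B\<^sup>2) / 2" unfolding sq by (simp add: power2_eq_square field_simps)
    finally show "w + C\<^sup>2 \<le> (2 * (s0 * s3 + s1 * s2))\<^sup>2" using Dw by (simp add: w_def)
  qed (use s_nn in simp)
  have g: "g = 1 + 4 * (s0 * s1 + s2 * s3 + (s0 * s2 + s1 * s3) + (s0 * s3 + s1 * s2))"
  proof -
    have "(s0 + s1 + s2 + s3)\<^sup>2 = (4 * s0\<^sup>2 + 4 * s1\<^sup>2 + 4 * s2\<^sup>2 + 4 * s3\<^sup>2) / 4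
      + 2 * (s0 * s1 + s2 * s3 + (s0 * s2 + s1 * s3) + (s0 * s3 + s1 * s2))" by algebra
    then show ?thesis unfolding g_def s[symmetric] sq by simp
  qed
  note sub1 = sqrt_add_subadd[of w "A\<^sup>2" "B\<^sup>2"] and sub2 = sqrt_add_subadd(1)[of w "A\<^sup>2 + B\<^sup>2" "C\<^sup>2"]
  have one: "w + (A\<^sup>2 + B\<^sup>2) + C\<^sup>2 = 1" by (simp add: w_def)
  \<comment> \<open>Concavity twice: one use splits \<open>A^2\<close> from \<open>B^2\<close>, the
    other splits off \<open>C^2\<close>, which completes the largest radicand to 1.\<close>
  have chain: "sqrt w + sqrt (w + A\<^sup>2 + B\<^sup>2) + (sqrt w + 1) + 1 * 0 \<le> sqrt (w + A\<^sup>2) + sqrt (w + B\<^sup>2) + (sqrt (w + A\<^sup>2 + B\<^sup>2) + sqrt (w + C\<^sup>2))"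
    using sub1(1) sub2 w0 one by (simp add: add.assoc)
  then show "3 + 4 * sqrt (1 - (A\<^sup>2 + B\<^sup>2 + C\<^sup>2)) \<le> g"
    using TA TB TC unfolding g w_def[symmetric] by simp
  assume "g = 3 + 4 * sqrt (1 - (A\<^sup>2 + B\<^sup>2 + C\<^sup>2))"
  then have "sqrt w + sqrt (w + A\<^sup>2 + B\<^sup>2) = sqrt (w + A\<^sup>2) + sqrt (w + B\<^sup>2)"
    using TA TB TC sub1(1) sub2 w0 one unfolding g w_def[symmetric] by (simp add: add.assoc)
  then have "A\<^sup>2 = 0 \<or> B\<^sup>2 = 0" using sub1(2) w0 by simp
  then show "B = 0 \<and> C = 0" using ord by auto
qed

text \<open>The quartic inequality is available only up to \<open>P\<close>, so
  \<open>p0 <= P\<close> is needed before it: for given \<open>p0\<close> the sum of squares is at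
  least \<open>p0^2 + (1 - p0)^2 / 3\<close>, which increases for \<open>p0 >= 1/4\<close>.\<close>

lemma sum_sqrt_upper_one_three:
  fixes p0 p1 p2 p3 P x :: real
  assumes ord: "0 \<le> p1" "0 \<le> p2" "0 \<le> p3" "p1 \<le> p0" "p2 \<le> p0" "p3 \<le> p0"
    and sum: "p0 + p1 + p2 + p3 = 1"
    and P: "0 \<le> x" "x \<le> P" "P + 3 * x = 1"
    and sq: "p0\<^sup>2 + p1\<^sup>2 + p2\<^sup>2 + p3\<^sup>2 = P\<^sup>2 + 3 * x\<^sup>2"
  shows "sqrt p0 + sqrt p1 + sqrt p2 + sqrt p3 \<le> sqrt P + 3 * sqrt x"
proof -
  have "p0 \<le> P"
  proof (rule ccontr)
    assume "\<not> p0 \<le> P"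
    then have "p0 > P" by simp
    have "p1\<^sup>2 + p2\<^sup>2 + p3\<^sup>2 \<ge> (p1 + p2 + p3)\<^sup>2 / 3"
    proof -
      have "3 * (p1\<^sup>2 + p2\<^sup>2 + p3\<^sup>2) - (p1 + p2 + p3)\<^sup>2 = (p1 - p2)\<^sup>2 + (p1 - p3)\<^sup>2 + (p2 - p3)\<^sup>2"
        by (simp add: power2_eq_square algebra_simps)
      moreover have "0 \<le> (p1 - p2)\<^sup>2 + (p1 - p3)\<^sup>2 + (p2 - p3)\<^sup>2" by simp
      ultimately have "(p1 + p2 + p3)\<^sup>2 \<le> 3 * (p1\<^sup>2 + p2\<^sup>2 + p3\<^sup>2)" by linarith
      then show ?thesis by simp
    qed
    moreover have "p1 + p2 + p3 = 1 - p0" using sum by simp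
    ultimately have "p0\<^sup>2 + (1 - p0)\<^sup>2 / 3 \<le> P\<^sup>2 + 3 * x\<^sup>2" using sq by simp
    moreover have x: "x = (1 - P) / 3" using P by simp
    ultimately have "(p0 - P) * (4 * (p0 + P) - 2) \<le> 0"
      unfolding x by (simp add: power2_eq_square field_simps)
    moreover have "0 < (p0 - P) * (4 * (p0 + P) - 2)"
      using \<open>p0 > P\<close> P by (intro mult_pos_pos) auto
    ultimately show False by simp
  qed
  then have le: "p0 \<le> P" "p1 \<le> P" "p2 \<le> P" "p3 \<le> P" using ord by auto
  show ?thesis
  proof (cases "x = 0")
    \<comment> \<open>For \<open>x = 0\<close> the multiplier \<open>d\<close> below would vanish,
      so the point spectrum is handled directly.\<close>
    case True
    then have "P = 1" using P by simp
    have "p0\<^sup>2 + p1\<^sup>2 + p2\<^sup>2 + p3\<^sup>2 = (p0 + p1 + p2 + p3)\<^sup>2" using sq sum \<open>x = 0\<close> \<open>P = 1\<close> by simp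
    then have "p0 * p1 + p0 * p2 + p0 * p3 + (p1 * p2 + p1 * p3 + p2 * p3) = 0" by algebra
    moreover have "0 \<le> p0 * p1" "0 \<le> p0 * p2" "0 \<le> p0 * p3" "0 \<le> p1 * p2 + p1 * p3 + p2 * p3"
      using ord by auto
    ultimately have "p0 * p1 = 0" "p0 * p2 = 0" "p0 * p3 = 0" by linarith+
    then have "p1 = 0" "p2 = 0" "p3 = 0" using ord sum by auto
    then show ?thesis using sum \<open>P = 1\<close> True by simp
  next
    case False
    define a b where ab: "a = sqrt x" "b = sqrt P"
    have ab0: "0 < a" "a \<le> b" "x = a\<^sup>2" "P = b\<^sup>2" using P False by (auto simp: ab)
    define c d k where cdk: "c = 3 * a\<^sup>2 + 2 * a * b + b\<^sup>2" "d = 2 * a * (a + b)\<^sup>2"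
      "k = a\<^sup>2 * b * (2 * a + b)"
    \<comment> \<open>The quartic \<open>(s - a)\<^sup>2 (b - s) (s + 2a + b)\<close> has no cubic term, so it is a combination of
      the two constraints and of \<open>s\<close>.\<close>
    have poly: "0 \<le> - q\<^sup>2 + c * q - d * sqrt q + k" if "0 \<le> q" "q \<le> P" for q
    proof -
      define s where "s = sqrt q"
      have s: "0 \<le> s" "s \<le> b" "q = s\<^sup>2" using that by (auto simp: s_def ab)
      have "0 \<le> (s - a)\<^sup>2 * ((b - s) * (s + 2 * a + b))"
        using s ab0 by (intro mult_nonneg_nonneg) auto
      also have "\<dots> = - q\<^sup>2 + c * q - d * s + k"
        unfolding s cdk by algebra
      finally show ?thesis by (simp add: s_def)
    qed
    have "0 \<le> - (p0\<^sup>2 + p1\<^sup>2 + p2\<^sup>2 + p3\<^sup>2) + c * (p0 + p1 + p2 + p3)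
        - d * (sqrt p0 + sqrt p1 + sqrt p2 + sqrt p3) + 4 * k"
      using poly[OF _ le(1)] poly[OF _ le(2)] poly[OF _ le(3)] poly[OF _ le(4)] ord
      by (simp add: distrib_left)
    moreover have "- (P\<^sup>2 + 3 * x\<^sup>2) + c * (P + 3 * x) - d * (b + 3 * a) + 4 * k = 0"
      unfolding ab0 cdk by algebra
    ultimately have "d * (sqrt p0 + sqrt p1 + sqrt p2 + sqrt p3) \<le> d * (b + 3 * a)"
      unfolding sq sum P(3) by linarith
    moreover have "d > 0" using ab0 by (simp add: cdk)
    ultimately show ?thesis by (simp add: ab)
  qed
qed


section \<open>Inequalities for the Schmidt strength\<close>

text \<open>The combination is tangent to the square root at the triple value \<open>x\<close> and
  meets it at \<open>P\<close>. Dividing the difference by \<open>p\<close> gives \<open>J\<close>,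
  whose derivative is a quadratic in \<open>sqrt p\<close> over \<open>p^2\<close>; one root is
  \<open>sqrt x\<close>, the other comes from Rolle between \<open>x\<close> and
  \<open>P\<close>.\<close>

lemma interpolate_one_three:
  assumes "0 < x" "x < P"
  obtains \<alpha> \<beta> \<kappa> where
    "sqrt x = \<alpha> + \<beta> * x + \<kappa> * xlnx x" "sqrt P = \<alpha> + \<beta> * P + \<kappa> * xlnx P"
    "\<And>p. 0 \<le> p \<Longrightarrow> p \<le> P \<Longrightarrow> p \<noteq> x \<Longrightarrow> p \<noteq> P \<Longrightarrow> sqrt p < \<alpha> + \<beta> * p + \<kappa> * xlnx p"
proof -
  \<comment> \<open>\<open>N\<close> and \<open>M\<close> are the errors at \<open>P\<close> of the
    tangents at \<open>x\<close> to \<open>sqrt\<close> and \<open>xlnx\<close>. Tangency at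
    \<open>x\<close> fixes \<open>\<alpha>\<close> and \<open>\<beta>\<close> in terms of
    \<open>\<kappa>\<close>, and \<open>\<kappa> = N / M\<close> matches the value at
    \<open>P\<close>.\<close>
  define N where "N = sqrt P - sqrt x - (P - x) / (2 * sqrt x)"
  define M where "M = xlnx P - xlnx x - (P - x) * (ln x + 1)"
  have M: "M > 0"
    using xlnx_tangent_strict[of P x] assms by (simp add: M_def xlnx_def algebra_simps)
  have "N = - (sqrt P - sqrt x)\<^sup>2 / (2 * sqrt x)"
  proof -
    have "P - x = (sqrt P)\<^sup>2 - (sqrt x)\<^sup>2" using assms by simp
    then have "N = sqrt P - sqrt x - ((sqrt P)\<^sup>2 - (sqrt x)\<^sup>2) / (2 * sqrt x)" by (simp only: N_def)
    also have "\<dots> = - (sqrt P - sqrt x)\<^sup>2 / (2 * sqrt x)"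
      using assms by (simp add: field_simps power2_eq_square)
    finally show ?thesis .
  qed
  then have N: "N < 0" using assms by (simp add: divide_neg_pos)
  define \<kappa> where "\<kappa> = N / M"
  define \<alpha> where "\<alpha> = sqrt x / 2 + \<kappa> * x"
  define \<beta> where "\<beta> = 1 / (2 * sqrt x) - \<kappa> * (ln x + 1)"
  have \<kappa>: "\<kappa> < 0" using N M by (simp add: \<kappa>_def divide_neg_pos)
  define J where "J p = 1 / sqrt p - \<alpha> / p - \<beta> - \<kappa> * ln p" for p
  have hJ: "sqrt p - (\<alpha> + \<beta> * p + \<kappa> * xlnx p) = p * J p" if "p > 0" for p
  proof -
    have "p / sqrt p = sqrt p" using that by (simp add: real_div_sqrt)
    then show ?thesis using that by (simp add: J_def xlnx_def algebra_simps)
  qed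
  have DJ: "(J has_real_derivative (\<alpha> - sqrt p / 2 - \<kappa> * p) / p\<^sup>2) (at p)" if "p > 0" for p
  proof -
    have "sqrt p * sqrt p = p" using that by simp
    then show ?thesis unfolding J_def using that
      by (auto intro!: derivative_eq_intros simp: field_simps power2_eq_square)
  qed
  have hx: "sqrt x = \<alpha> + \<beta> * x + \<kappa> * xlnx x"
  proof -
    have "x / sqrt x = sqrt x" using assms by (simp add: real_div_sqrt)
    then have "\<beta> * x = sqrt x / 2 - \<kappa> * xlnx x - \<kappa> * x"
      by (simp add: \<beta>_def xlnx_def algebra_simps)
    then show ?thesis by (simp add: \<alpha>_def)
  qed
  have hP: "sqrt P = \<alpha> + \<beta> * P + \<kappa> * xlnx P"
  proof -
    have "\<kappa> * M = N" using M by (simp add: \<kappa>_def)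
    then have "sqrt P = sqrt x + (P - x) / (2 * sqrt x) + \<kappa> * (xlnx P - xlnx x) - \<kappa> * (P - x) * (ln x + 1)"
      by (simp add: N_def M_def algebra_simps)
    also have "\<dots> = sqrt x + \<beta> * (P - x) + \<kappa> * (xlnx P - xlnx x)"
      by (simp add: \<beta>_def algebra_simps diff_divide_distrib)
    also have "\<dots> = \<alpha> + \<beta> * P + \<kappa> * xlnx P"
      unfolding hx by (simp add: algebra_simps)
    finally show ?thesis .
  qed
  have Jx: "J x = 0" using hJ[of x] hx assms by simp
  have JP: "J P = 0" using hJ[of P] hP assms by simp
  have cont: "continuous_on {a..b} J" if "0 < a" for a b
    using that DJ by (intro DERIV_atLeastAtMost_imp_continuous_on) (meson less_le_trans)
  have "\<exists>\<xi>>x. \<xi> < P \<and> (\<alpha> - sqrt \<xi> / 2 - \<kappa> * \<xi>) / \<xi>\<^sup>2 = 0"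
  proof -
    have "\<exists>z>x. z < P \<and> J P - J x = (P - x) * ((\<alpha> - sqrt z / 2 - \<kappa> * z) / z\<^sup>2)"
      using assms by (intro MVT2[OF assms(2)] DJ) simp
    then show ?thesis using Jx JP assms by auto
  qed
  then obtain \<xi> where \<xi>: "x < \<xi>" "\<xi> < P" "\<alpha> - sqrt \<xi> / 2 - \<kappa> * \<xi> = 0"
    using assms by auto
  \<comment> \<open>The quadratic in \<open>sqrt p\<close> vanishes at \<open>sqrt x\<close> by the
    choice of \<open>\<alpha>\<close> and at \<open>sqrt \<xi>\<close>, and its leading coefficient
    is \<open>- \<kappa>\<close>.\<close>
  have factor: "\<alpha> - sqrt p / 2 - \<kappa> * p = - \<kappa> * (sqrt p - sqrt x) * (sqrt p - sqrt \<xi>)" if "p \<ge> 0" for p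
  proof -
    have sq: "p = (sqrt p)\<^sup>2" "x = (sqrt x)\<^sup>2" "\<xi> = (sqrt \<xi>)\<^sup>2" using that assms \<xi> by auto
    have "(sqrt \<xi> - sqrt x) * (- \<kappa> * (sqrt \<xi> + sqrt x) - 1 / 2) = 0"
    proof -
      have "(u - v) * (- \<kappa> * (u + v) - 1 / 2) = - \<kappa> * u\<^sup>2 + \<kappa> * v\<^sup>2 - u / 2 + v / 2" for u v
        by (simp add: field_simps power2_eq_square)
      from this[of "sqrt \<xi>" "sqrt x"] have "(sqrt \<xi> - sqrt x) * (- \<kappa> * (sqrt \<xi> + sqrt x) - 1 / 2)
        = - \<kappa> * (sqrt \<xi>)\<^sup>2 + \<kappa> * (sqrt x)\<^sup>2 - sqrt \<xi> / 2 + sqrt x / 2" .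
      also have "\<dots> = 0" using \<xi>(3) unfolding sq(2,3)[symmetric] \<alpha>_def by simp
      finally show ?thesis .
    qed
    moreover have "sqrt \<xi> - sqrt x \<noteq> 0" using \<xi> by simp
    ultimately have half: "1 / 2 = - \<kappa> * (sqrt \<xi> + sqrt x)" by simp
    have "\<alpha> - sqrt p / 2 - \<kappa> * p = (1 / 2) * (sqrt x - sqrt p) + \<kappa> * (x - p)"
      by (simp add: \<alpha>_def field_simps)
    also have "x - p = (sqrt x)\<^sup>2 - (sqrt p)\<^sup>2" using that assms by simp
    also have "(1 / 2) * (sqrt x - sqrt p) + \<kappa> * ((sqrt x)\<^sup>2 - (sqrt p)\<^sup>2)
      = - \<kappa> * (sqrt p - sqrt x) * (sqrt p - sqrt \<xi>)"
      unfolding half by (simp only: power2_eq_square) algebra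
    finally show ?thesis .
  qed
  \<comment> \<open>At \<open>p = 0\<close>, where dividing by \<open>p\<close> is impossible, the
    strict inequality reduces to this.\<close>
  have "\<alpha> > 0"
    using factor[of 0] \<kappa> assms \<xi> by (simp add: mult_neg_pos)
  have neg: "J p < 0" if p: "0 < p" "p \<le> P" "p \<noteq> x" "p \<noteq> P" for p
  proof -
    consider "p < x" | "x < p" "p \<le> \<xi>" | "\<xi> < p" "p < P" using p by linarith
    then show ?thesis
    proof cases
      case 1
      have "J p < J x"
      proof (rule DERIV_pos_imp_increasing_open[OF 1])
        fix q assume q: "p < q" "q < x"
        then have "0 < - \<kappa> * (sqrt q - sqrt x) * (sqrt q - sqrt \<xi>)"
          using \<kappa> \<xi> by (intro mult_neg_neg mult_pos_neg) auto
        then have "0 < (\<alpha> - sqrt q / 2 - \<kappa> * q) / q\<^sup>2" using factor[of q] q p by (simp add: divide_neg_pos)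
        then show "\<exists>y. (J has_real_derivative y) (at q) \<and> 0 < y"
          using DJ[of q] q p by auto
      qed (use cont p in auto)
      then show ?thesis using Jx by simp
    next
      case 2
      have "J p < J x"
      proof (rule DERIV_neg_imp_decreasing_open[OF 2(1)])
        fix q assume q: "x < q" "q < p"
        then show "\<exists>y. (J has_real_derivative y) (at q) \<and> y < 0"
        proof -
          have "- \<kappa> * (sqrt q - sqrt x) * (sqrt q - sqrt \<xi>) < 0"
            using \<kappa> q 2 by (intro mult_pos_neg mult_pos_pos) auto
          then have "(\<alpha> - sqrt q / 2 - \<kappa> * q) / q\<^sup>2 < 0"
            using factor[of q] q assms by (simp add: divide_neg_pos)
          then show ?thesis using DJ[of q] q assms by auto
        qed
      qed (use cont assms in auto)
      then show ?thesis using Jx by simp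
    next
      case 3
      have "J p < J P"
      proof (rule DERIV_pos_imp_increasing_open[OF 3(2)])
        fix q assume q: "p < q" "q < P"
        then show "\<exists>y. (J has_real_derivative y) (at q) \<and> 0 < y"
        proof -
          have "0 < - \<kappa> * (sqrt q - sqrt x) * (sqrt q - sqrt \<xi>)"
            using \<kappa> q 3 \<xi> by (intro mult_pos_pos) auto
          then have "0 < (\<alpha> - sqrt q / 2 - \<kappa> * q) / q\<^sup>2" using factor[of q] q p by (simp add: divide_neg_pos)
          then show ?thesis using DJ[of q] q p by auto
        qed
      qed (use cont p in auto)
      then show ?thesis using JP by simp
    qed
  qed
  show ?thesis
  proof (rule that[OF hx hP])
    fix p assume p: "0 \<le> p" "p \<le> P" "p \<noteq> x" "p \<noteq> P"
    show "sqrt p < \<alpha> + \<beta> * p + \<kappa> * xlnx p"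
    proof (cases "p = 0")
      case False
      then show ?thesis using hJ[of p] neg[of p] p mult_pos_neg[of p "J p"] by simp
    qed (use \<open>\<alpha> > 0\<close> in simp)
  qed
qed

text \<open>Adding the interpolation over the four probabilities leaves only the two prescribed
  sums. The equality clause later excludes a fractional-SWAP spectrum as a minimiser.\<close>

lemma sum_sqrt_upper_entropy:
  fixes p0 p1 p2 p3 P x :: real
  assumes nn: "0 \<le> p1" "0 \<le> p2" "0 \<le> p3" and max: "p1 \<le> p0" "p2 \<le> p0" "p3 \<le> p0"
    and sum: "p0 + p1 + p2 + p3 = 1"
    and P: "0 < x" "x < P" "P + 3 * x = 1"
    and ent: "xlnx p0 + xlnx p1 + xlnx p2 + xlnx p3 = xlnx P + 3 * xlnx x"
  shows "sqrt p0 + sqrt p1 + sqrt p2 + sqrt p3 \<le> sqrt P + 3 * sqrt x"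
    "sqrt p0 + sqrt p1 + sqrt p2 + sqrt p3 = sqrt P + 3 * sqrt x \<Longrightarrow> {p0, p1, p2, p3} \<subseteq> {x, P}"
proof -
  have "p0 \<le> P"
  proof (rule ccontr)
    assume "\<not> p0 \<le> P"
    then have "xlnx P + 3 * xlnx ((1 - P) / 3) < xlnx p0 + 3 * xlnx ((1 - p0) / 3)"
      using P nn sum by (intro xlnx_one_three_strict_mono) auto
    moreover have "(1 - P) / 3 = x" using P by simp
    moreover have "p1 + p2 + p3 = 1 - p0" using sum by simp
    ultimately show False using xlnx_sum3_ge[OF nn] ent by simp
  qed
  then have le: "p0 \<le> P" "p1 \<le> P" "p2 \<le> P" "p3 \<le> P" using max by auto
  obtain \<alpha> \<beta> \<kappa> where h: "sqrt x = \<alpha> + \<beta> * x + \<kappa> * xlnx x" "sqrt P = \<alpha> + \<beta> * P + \<kappa> * xlnx P"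
    and less: "\<And>p. 0 \<le> p \<Longrightarrow> p \<le> P \<Longrightarrow> p \<noteq> x \<Longrightarrow> p \<noteq> P \<Longrightarrow> sqrt p < \<alpha> + \<beta> * p + \<kappa> * xlnx p"
    using interpolate_one_three[OF P(1,2)] by blast
  define f where "f p = \<alpha> + \<beta> * p + \<kappa> * xlnx p" for p
  have total: "f p0 + f p1 + f p2 + f p3 = sqrt P + 3 * sqrt x"
  proof -
    have "f p0 + f p1 + f p2 + f p3 = 4 * \<alpha> + \<beta> * (p0 + p1 + p2 + p3) + \<kappa> * (xlnx p0 + xlnx p1 + xlnx p2 + xlnx p3)"
      by (simp add: f_def algebra_simps)
    also have "\<dots> = 4 * \<alpha> + \<beta> * (P + 3 * x) + \<kappa> * (xlnx P + 3 * xlnx x)" by (simp only: sum ent P(3))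
    also have "\<dots> = sqrt P + 3 * sqrt x" unfolding h by (simp add: algebra_simps)
    finally show ?thesis .
  qed
  have f_le: "sqrt p \<le> f p" and f_less: "p \<notin> {x, P} \<Longrightarrow> sqrt p < f p" if "0 \<le> p" "p \<le> P" for p
    using less[OF that] h by (cases "p \<in> {x, P}"; force simp: f_def)+
  have nn0: "0 \<le> p0" using nn max by linarith
  note fs = f_le[OF nn0 le(1)] f_le[OF nn(1) le(2)] f_le[OF nn(2) le(3)] f_le[OF nn(3) le(4)]
  show "sqrt p0 + sqrt p1 + sqrt p2 + sqrt p3 \<le> sqrt P + 3 * sqrt x"
    using fs total by linarith
  assume eq: "sqrt p0 + sqrt p1 + sqrt p2 + sqrt p3 = sqrt P + 3 * sqrt x"
  then have "sqrt p0 = f p0" "sqrt p1 = f p1" "sqrt p2 = f p2" "sqrt p3 = f p3"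
    using fs total by linarith+
  then show "{p0, p1, p2, p3} \<subseteq> {x, P}"
    using f_less[OF nn0 le(1)] f_less[OF nn(1) le(2)] f_less[OF nn(2) le(3)] f_less[OF nn(3) le(4)]
    by auto
qed

text \<open>Without a constant term the combination also vanishes at 0, so zero probabilities
  contribute nothing. Divided by \<open>p\<close>, the difference decreases up to some
  \<open>\<xi>\<close> between \<open>x\<close> and \<open>y\<close> and increases after it; hence
  it is nonnegative outside the interval from \<open>x\<close> to \<open>y\<close>.\<close>

lemma interpolate_rank_two:
  assumes "0 < x" "x \<le> y"
  obtains \<beta> \<kappa> where
    "sqrt x = \<beta> * x + \<kappa> * xlnx x" "sqrt y = \<beta> * y + \<kappa> * xlnx y"
    "\<And>p. y \<le> p \<Longrightarrow> \<beta> * p + \<kappa> * xlnx p \<le> sqrt p"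
    "\<And>p. 0 \<le> p \<Longrightarrow> p \<le> x \<Longrightarrow> \<beta> * p + \<kappa> * xlnx p \<le> sqrt p"
    "\<And>p. 0 < p \<Longrightarrow> p < x \<Longrightarrow> \<beta> * p + \<kappa> * xlnx p < sqrt p"
proof -
  have y: "0 < y" using assms by simp
  define J where "J \<beta> \<kappa> p = 1 / sqrt p - \<beta> - \<kappa> * ln p" for \<beta> \<kappa> p
  have DJ: "(J \<beta> \<kappa> has_real_derivative - (1 / 2 + \<kappa> * sqrt p) / (p * sqrt p)) (at p)" if "p > 0" for \<beta> \<kappa> p
    unfolding J_def using that
    by (auto intro!: derivative_eq_intros simp: field_simps)
  have cont: "continuous_on {a..b} (J \<beta> \<kappa>)" if "0 < a" for a b \<beta> \<kappa>
    using that DJ by (intro DERIV_atLeastAtMost_imp_continuous_on) (meson less_le_trans)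
  have "\<exists>\<beta> \<kappa> \<xi>. J \<beta> \<kappa> x = 0 \<and> J \<beta> \<kappa> y = 0 \<and> x \<le> \<xi> \<and> \<xi> \<le> y \<and> 1 / 2 + \<kappa> * sqrt \<xi> = 0"
  proof (cases "x = y")
    \<comment> \<open>Coinciding nodes, as for the spectrum (1/2, 1/2): value and derivative are
      matched at the single node.\<close>
    case True
    then show ?thesis using assms
      by (intro exI[of _ "1 / sqrt x + ln x / (2 * sqrt x)"] exI[of _ "- 1 / (2 * sqrt x)"] exI[of _ x])
         (simp add: J_def)
  next
    case False
    then have xy: "x < y" using assms by simp
    define \<kappa> where "\<kappa> = (1 / sqrt y - 1 / sqrt x) / (ln y - ln x)"
    define \<beta> where "\<beta> = 1 / sqrt x - \<kappa> * ln x"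
    have "ln y - ln x \<noteq> 0" using xy assms by simp
    then have "\<kappa> * (ln y - ln x) = 1 / sqrt y - 1 / sqrt x" by (simp add: \<kappa>_def)
    then have J0: "J \<beta> \<kappa> x = 0" "J \<beta> \<kappa> y = 0" by (simp_all add: J_def \<beta>_def algebra_simps)
    have "\<exists>z. x < z \<and> z < y \<and> J \<beta> \<kappa> y - J \<beta> \<kappa> x = (y - x) * (- (1 / 2 + \<kappa> * sqrt z) / (z * sqrt z))"
      using assms by (intro MVT2[OF xy] DJ) simp
    then obtain z where z: "x < z" "z < y" "- (1 / 2 + \<kappa> * sqrt z) / (z * sqrt z) = 0"
      using J0 xy by auto
    then have "1 / 2 + \<kappa> * sqrt z = 0" using z assms by (simp only: divide_eq_0_iff) auto
    then show ?thesis using J0 z by (intro exI[of _ \<beta>] exI[of _ \<kappa>] exI[of _ z]) auto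
  qed
  then obtain \<beta> \<kappa> \<xi> where J0: "J \<beta> \<kappa> x = 0" "J \<beta> \<kappa> y = 0" and \<xi>: "x \<le> \<xi>" "\<xi> \<le> y" "1 / 2 + \<kappa> * sqrt \<xi> = 0"
    by blast
  have "\<kappa> * sqrt \<xi> < 0" "0 < sqrt \<xi>" using \<xi> assms by (linarith, simp)
  then have \<kappa>: "\<kappa> < 0" by (simp add: mult_less_0_iff)
  have hJ: "sqrt p - (\<beta> * p + \<kappa> * xlnx p) = p * J \<beta> \<kappa> p" if "p > 0" for p
  proof -
    have "p / sqrt p = sqrt p" using that by (simp add: real_div_sqrt)
    then show ?thesis using that by (simp add: J_def xlnx_def algebra_simps)
  qed
  have pos1: "0 < J \<beta> \<kappa> p" if p: "0 < p" "p < x" for p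
  proof -
    have "J \<beta> \<kappa> x < J \<beta> \<kappa> p"
    proof (rule DERIV_neg_imp_decreasing_open[OF p(2)])
      fix q assume q: "p < q" "q < x"
      then have "\<kappa> * sqrt \<xi> < \<kappa> * sqrt q" using \<xi> \<kappa> by (simp add: mult_less_cancel_left)
      then have "0 < 1 / 2 + \<kappa> * sqrt q" using \<xi> by simp
      then show "\<exists>y. (J \<beta> \<kappa> has_real_derivative y) (at q) \<and> y < 0"
        using DJ[of q \<beta> \<kappa>] q p
        by (intro exI[of _ "- (1 / 2 + \<kappa> * sqrt q) / (q * sqrt q)"]) (simp add: divide_neg_pos)
    qed (use cont p in auto)
    then show ?thesis using J0 by simp
  qed
  have pos2: "0 \<le> J \<beta> \<kappa> p" if p: "y < p" for p
  proof -
    have "J \<beta> \<kappa> y < J \<beta> \<kappa> p"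
    proof (rule DERIV_pos_imp_increasing_open[OF p])
      fix q assume q: "y < q" "q < p"
      then have "\<kappa> * sqrt q < \<kappa> * sqrt \<xi>" using \<xi> \<kappa> by (simp add: mult_less_cancel_left)
      then have "1 / 2 + \<kappa> * sqrt q < 0" using \<xi> by simp
      then show "\<exists>y. (J \<beta> \<kappa> has_real_derivative y) (at q) \<and> 0 < y"
        using DJ[of q \<beta> \<kappa>] q p y
        by (intro exI[of _ "- (1 / 2 + \<kappa> * sqrt q) / (q * sqrt q)"]) (simp add: divide_neg_pos)
    qed (use cont y in auto)
    then show ?thesis using J0 by simp
  qed
  have hx: "sqrt x = \<beta> * x + \<kappa> * xlnx x" "sqrt y = \<beta> * y + \<kappa> * xlnx y"
    using hJ[of x] hJ[of y] J0 assms y by simp_all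
  have strict: "\<beta> * p + \<kappa> * xlnx p < sqrt p" if "0 < p" "p < x" for p
    using hJ[OF that(1)] mult_pos_pos[OF that(1) pos1[OF that]] by linarith
  have "\<beta> * p + \<kappa> * xlnx p \<le> sqrt p" if "0 \<le> p" "p \<le> x" for p
    using strict[of p] hx(1) that by (cases "p = 0 \<or> p = x") auto
  moreover have "\<beta> * p + \<kappa> * xlnx p \<le> sqrt p" if "y \<le> p" for p
  proof (cases "p = y")
    case False
    with that y have p: "0 < p" "y < p" by simp_all
    have "0 \<le> p * J \<beta> \<kappa> p" using pos2[OF p(2)] p(1) by simp
    then show ?thesis using hJ[OF p(1)] by linarith
  qed (use hx in simp)
  ultimately show ?thesis using that hx strict by blast
qed

text \<open>The interpolation gives no bound between its nodes \<open>1 - z\<close> and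
  \<open>z\<close>, so the point is that no probability lies strictly between them: the largest is
  at least \<open>z\<close>, and the other three together make up at most
  \<open>1 - z\<close>.\<close>

lemma sum_sqrt_lower_entropy_rank_two:
  fixes p0 p1 p2 p3 z :: real
  assumes ord: "p3 \<le> p2" "p2 \<le> p1" "p1 \<le> p0" "0 \<le> p3" and sum: "p0 + p1 + p2 + p3 = 1"
    and z: "z \<in> {1/2..1}" and ent: "xlnx p0 + xlnx p1 + xlnx p2 + xlnx p3 = neg_entropy2 z"
  shows "sqrt_sum2 z \<le> sqrt p0 + sqrt p1 + sqrt p2 + sqrt p3"
    "sqrt p0 + sqrt p1 + sqrt p2 + sqrt p3 = sqrt_sum2 z \<Longrightarrow> p2 = 0 \<and> p3 = 0"
proof -
  have nn: "0 \<le> p0" "0 \<le> p1" "0 \<le> p2" "0 \<le> p3" using ord by linarith+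
  \<comment> \<open>If every probability were below 1/2, the entropy would exceed
    \<open>ln 2\<close>.\<close>
  have half: "1 / 2 \<le> p0"
  proof (rule ccontr)
    assume less: "\<not> 1 / 2 \<le> p0"
    have "xlnx p0 + xlnx p1 + xlnx p2 + xlnx p3 \<le> (p0 + p1 + p2 + p3) * ln p0"
      using xlnx_le_mult_ln[of p0 p0] xlnx_le_mult_ln[of p1 p0] xlnx_le_mult_ln[of p2 p0] xlnx_le_mult_ln[of p3 p0] ord nn
      by (simp add: distrib_right)
    also have "\<dots> = ln p0" by (simp add: sum)
    also have "\<dots> < - ln 2"
    proof -
      have "0 < p0" using ord sum by linarith
      then have "ln p0 < ln (1 / 2)" using less by (subst ln_less_cancel_iff) auto
      then show ?thesis by (simp add: ln_div)
    qed
    finally show False using ent neg_entropy2_ge[of z] z by simp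
  qed
  have sum': "p1 + p2 + p3 = 1 - p0" using sum by simp
  have "z \<le> p0"
  proof -
    \<comment> \<open>Merging the three smaller probabilities into one cannot raise the
      entropy.\<close>
    have "xlnx p1 + xlnx p2 + xlnx p3 \<le> (p1 + p2 + p3) * ln (1 - p0)"
      using xlnx_le_mult_ln[of p1 "1 - p0"] xlnx_le_mult_ln[of p2 "1 - p0"] xlnx_le_mult_ln[of p3 "1 - p0"] nn sum'
      unfolding distrib_right by linarith
    then have "neg_entropy2 z \<le> neg_entropy2 p0"
      unfolding sum' using ent by (simp add: neg_entropy2_def xlnx_def)
    then show ?thesis using neg_entropy2_less_iff[of p0 z] z half nn sum' by force
  qed
  show "sqrt_sum2 z \<le> sqrt p0 + sqrt p1 + sqrt p2 + sqrt p3"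
    "sqrt p0 + sqrt p1 + sqrt p2 + sqrt p3 = sqrt_sum2 z \<Longrightarrow> p2 = 0 \<and> p3 = 0"
  proof (atomize (full), cases "z = 1")
    case True
    then have "p0 = 1" "p1 = 0" "p2 = 0" "p3 = 0" using \<open>z \<le> p0\<close> nn sum by linarith+
    then show "sqrt_sum2 z \<le> sqrt p0 + sqrt p1 + sqrt p2 + sqrt p3 \<and>
      (sqrt p0 + sqrt p1 + sqrt p2 + sqrt p3 = sqrt_sum2 z \<longrightarrow> p2 = 0 \<and> p3 = 0)"
      by (simp add: True sqrt_sum2_def)
  next
    case False
    then have z1: "0 < 1 - z" "1 - z \<le> z" using z by auto
    obtain \<beta> \<kappa> where h: "sqrt (1 - z) = \<beta> * (1 - z) + \<kappa> * xlnx (1 - z)" "sqrt z = \<beta> * z + \<kappa> * xlnx z"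
      and ge: "\<And>p. z \<le> p \<Longrightarrow> \<beta> * p + \<kappa> * xlnx p \<le> sqrt p"
        "\<And>p. 0 \<le> p \<Longrightarrow> p \<le> 1 - z \<Longrightarrow> \<beta> * p + \<kappa> * xlnx p \<le> sqrt p"
        "\<And>p. 0 < p \<Longrightarrow> p < 1 - z \<Longrightarrow> \<beta> * p + \<kappa> * xlnx p < sqrt p"
      using interpolate_rank_two[OF z1] by blast
    define f where "f p = \<beta> * p + \<kappa> * xlnx p" for p
    have total: "f p0 + f p1 + f p2 + f p3 = sqrt_sum2 z"
    proof -
      have "f p0 + f p1 + f p2 + f p3 = \<beta> * (p0 + p1 + p2 + p3) + \<kappa> * (xlnx p0 + xlnx p1 + xlnx p2 + xlnx p3)"
        by (simp add: f_def algebra_simps)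
      also have "\<dots> = \<beta> * (z + (1 - z)) + \<kappa> * (xlnx z + xlnx (1 - z))"
        using sum ent by (simp add: neg_entropy2_def)
      also have "\<dots> = sqrt_sum2 z" unfolding sqrt_sum2_def h by (simp add: algebra_simps)
      finally show ?thesis .
    qed
    have fs: "f p0 \<le> sqrt p0" "f p1 \<le> sqrt p1" "f p2 \<le> sqrt p2" "f p3 \<le> sqrt p3"
      unfolding f_def using nn \<open>z \<le> p0\<close> sum' by (intro ge; linarith)+
    have "p2 = 0" if "sqrt p0 + sqrt p1 + sqrt p2 + sqrt p3 = sqrt_sum2 z"
    proof (rule ccontr)
      assume "p2 \<noteq> 0"
      then have "0 < p2" "p2 < 1 - z" using ord nn \<open>z \<le> p0\<close> sum' by linarith+
      then have "f p2 < sqrt p2" unfolding f_def by (rule ge)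
      then show False using fs total that by linarith
    qed
    then show "sqrt_sum2 z \<le> sqrt p0 + sqrt p1 + sqrt p2 + sqrt p3 \<and>
      (sqrt p0 + sqrt p1 + sqrt p2 + sqrt p3 = sqrt_sum2 z \<longrightarrow> p2 = 0 \<and> p3 = 0)"
      using fs total ord by auto
  qed
qed


section \<open>Concavity of \<open>ln sqrt_sum2\<close> in the binary entropy\<close>

lemma ln_gt_pade: "1 < w \<Longrightarrow> 2 * (w - 1) / (w + 1) < ln w" for w :: real
proof -
  assume w: "1 < w"
  have "ln 1 - 2 * (1 - 1) / (1 + 1) < ln w - 2 * (w - 1) / (w + 1)"
  proof (rule DERIV_pos_imp_increasing_open[OF w])
    fix x :: real assume x: "1 < x" "x < w"
    have "((\<lambda>w. ln w - 2 * (w - 1) / (w + 1)) has_real_derivative 1 / x - 4 / (x + 1)\<^sup>2) (at x)"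
      using x by (auto intro!: derivative_eq_intros simp: field_simps power2_eq_square)
    moreover have "1 / x - 4 / (x + 1)\<^sup>2 = (x - 1)\<^sup>2 / (x * (x + 1)\<^sup>2)"
      using x by (simp add: divide_simps) (simp add: power2_eq_square algebra_simps)
    moreover have "0 < (x - 1)\<^sup>2 / (x * (x + 1)\<^sup>2)" using x by simp
    ultimately show "\<exists>y. ((\<lambda>w. ln w - 2 * (w - 1) / (w + 1)) has_real_derivative y) (at x) \<and> 0 < y"
      by auto
  qed (auto intro!: continuous_intros)
  then show ?thesis by simp
qed

text \<open>In the variable \<open>w = sqrt (t / (1 - t))\<close>, the derivative of
  \<open>ln sqrt_sum2\<close> divided by that of \<open>neg_entropy2\<close> is
  \<open>- slope_ratio w / 4\<close>.\<close>

definition slope_ratio :: "real \<Rightarrow> real" where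
  "slope_ratio w = (w - 1) * (1 + w\<^sup>2) / (w * (1 + w) * ln w)"

text \<open>In the derivative of the logarithm, \<open>ln_gt_pade\<close> bounds the one term that
  contains \<open>ln\<close>, and the remaining rational function is positive beyond 1.\<close>

lemma slope_ratio_strict_mono:
  assumes "1 < v" "v < w"
  shows "slope_ratio v < slope_ratio w"
proof -
  define L where "L w = ln (w - 1) + ln (1 + w\<^sup>2) - ln w - ln (1 + w) - ln (ln w)" for w :: real
  have L: "slope_ratio w = exp (L w)" if "1 < w" for w
  proof -
    have "0 < 1 + w\<^sup>2" by (simp add: add_pos_nonneg)
    then show ?thesis using that by (simp add: L_def slope_ratio_def exp_add exp_diff)
  qed
  have pos: "0 < 1 + w\<^sup>2" for w :: real by (simp add: add_pos_nonneg)
  have DL: "(L has_real_derivative 1 / (w - 1) + 2 * w / (1 + w\<^sup>2) - 1 / w - 1 / (1 + w) - 1 / (w * ln w)) (at w)"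
    if "1 < w" for w
    unfolding L_def using that pos[of w] ln_gt_zero[OF that]
    by (auto intro!: derivative_eq_intros simp: divide_inverse mult.commute)
  have "L v < L w"
  proof (rule DERIV_pos_imp_increasing_open[OF assms(2)])
    fix x assume "v < x" "x < w"
    then have x: "1 < x" using assms by simp
    \<comment> \<open>With this bound the poles at \<open>x = 1\<close> cancel: its difference from
      \<open>1 / (x - 1)\<close> is just \<open>1 / (2 x)\<close>.\<close>
    have "1 / (x * ln x) < (x + 1) / (2 * x * (x - 1))"
    proof -
      have "2 * (x - 1) < (x + 1) * ln x" using ln_gt_pade[OF x] x by (simp add: field_simps)
      then have "x * (2 * (x - 1)) < x * ((x + 1) * ln x)" using x by (intro mult_strict_left_mono) auto
      then show ?thesis using x by (simp add: divide_simps mult_ac)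
    qed
    moreover have "1 / (x - 1) - (x + 1) / (2 * x * (x - 1)) = 1 / (2 * x)"
      using x by (simp add: divide_simps)
    moreover have "2 * x / (1 + x\<^sup>2) - 1 / (2 * x) - 1 / (1 + x)
       = (x - 1) * (x\<^sup>2 + 4 * x + 1) / (2 * x * (1 + x\<^sup>2) * (1 + x))"
      using x pos[of x] by (simp add: divide_simps) (simp add: power2_eq_square algebra_simps)
    moreover have "0 < (x - 1) * (x\<^sup>2 + 4 * x + 1) / (2 * x * (1 + x\<^sup>2) * (1 + x))"
      using x pos[of x] by (intro divide_pos_pos mult_pos_pos add_pos_pos) auto
    moreover have "1 / x - 1 / (2 * x) = 1 / (2 * x)" using x by (simp add: divide_simps)
    ultimately have "0 < 1 / (x - 1) + 2 * x / (1 + x\<^sup>2) - 1 / x - 1 / (1 + x) - 1 / (x * ln x)"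
      by linarith
    with DL[OF x] show "\<exists>y. (L has_real_derivative y) (at x) \<and> 0 < y" by blast
  next
    show "continuous_on {v..w} L"
      using assms DL by (intro DERIV_atLeastAtMost_imp_continuous_on) (meson less_le_trans)
  qed
  then show ?thesis using L assms by simp
qed

definition odds_sqrt :: "real \<Rightarrow> real" where
  "odds_sqrt t = sqrt (t / (1 - t))"

lemma odds_sqrt_strict_mono: "s < t \<Longrightarrow> t < 1 \<Longrightarrow> odds_sqrt s < odds_sqrt t"
  by (simp add: odds_sqrt_def divide_simps algebra_simps)

lemma odds_sqrt_gt_1: "1 / 2 < t \<Longrightarrow> t < 1 \<Longrightarrow> 1 < odds_sqrt t"
  using odds_sqrt_strict_mono[of "1/2" t] by (simp add: odds_sqrt_def)

text \<open>The ratio of the derivatives of \<open>ln sqrt_sum2\<close> and \<open>neg_entropy2\<close> is monotone, which says that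
  \<open>ln sqrt_sum2\<close> is a concave function of the binary entropy.\<close>

lemma DERIV_ln_sqrt_sum2:
  assumes "1 / 2 < t" "t < 1"
  shows "((\<lambda>t. ln (sqrt_sum2 t)) has_real_derivative
     - (slope_ratio (odds_sqrt t) / 4) * (ln t - ln (1 - t))) (at t)"
proof -
  define a b where ab: "a = sqrt t" "b = sqrt (1 - t)"
  have ab0: "0 < a" "0 < b" "b < a" "a\<^sup>2 + b\<^sup>2 = 1" "t = a\<^sup>2" "1 - t = b\<^sup>2" using assms by (auto simp: ab)
  have w: "odds_sqrt t = a / b" by (simp add: odds_sqrt_def ab real_sqrt_divide)
  have lnw: "ln t - ln (1 - t) = 2 * ln (a / b)" using ab0 by (simp add: ln_div ln_realpow)
  have "((\<lambda>t. ln (sqrt_sum2 t)) has_real_derivative (1 / (2 * a) - 1 / (2 * b)) / (a + b)) (at t)"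
    unfolding sqrt_sum2_def using assms ab0(1,2)
    by (auto intro!: derivative_eq_intros simp: ab add_pos_pos field_simps)
  moreover have "(1 / (2 * a) - 1 / (2 * b)) / (a + b) = - (slope_ratio (odds_sqrt t) / 4) * (ln t - ln (1 - t))"
  proof -
    have "ln (a / b) \<noteq> 0" using ab0 by simp
    then have "- (slope_ratio (a / b) / 4) * (2 * ln (a / b)) = - ((a / b - 1) * (1 + (a / b)\<^sup>2) / ((a / b) * (1 + a / b))) / 2"
    proof -
      have "- (X / (Y * l) / 4) * (2 * l) = - (X / Y) / 2" if "l \<noteq> 0" for X Y l :: real
        using that by (simp add: divide_simps)
      from this[OF \<open>ln (a / b) \<noteq> 0\<close>] show ?thesis unfolding slope_ratio_def .
    qed
    also have "\<dots> = - ((a - b) * (a\<^sup>2 + b\<^sup>2)) / (2 * a * b * (a + b))"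
      using ab0(1,2) by (simp add: divide_simps) (simp add: power2_eq_square algebra_simps)
    also have "\<dots> = (1 / (2 * a) - 1 / (2 * b)) / (a + b)"
      unfolding ab0(4) using ab0(1,2) by (simp add: divide_simps)
    finally show ?thesis unfolding w lnw by simp
  qed
  ultimately show ?thesis by simp
qed

text \<open>Cauchy's mean value theorem for the two functions, with \<open>h\<close> as the usual
  auxiliary function; at \<open>t = 1\<close>, where the derivatives blow up, only continuity is
  used.\<close>

lemma ln_sqrt_sum2_chord:
  assumes "1 / 2 \<le> s" "s < t" "t \<le> 1"
  obtains c where "s < c" "c < t"
    "ln (sqrt_sum2 s) - ln (sqrt_sum2 t) = slope_ratio (odds_sqrt c) / 4 * (neg_entropy2 t - neg_entropy2 s)"
proof -
  have cont: "continuous_on {s..t} (\<lambda>t. ln (sqrt_sum2 t))"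
  proof -
    have "sqrt_sum2 x \<noteq> 0" if "x \<in> {s..t}" for x
      using sqrt_sum2_pos[of x] that assms by auto
    then show ?thesis unfolding sqrt_sum2_def by (intro continuous_intros) auto
  qed
  have "continuous_on {s..t} neg_entropy2" using assms by (intro continuous_on_neg_entropy2) auto
  have D: "(neg_entropy2 has_real_derivative ln x - ln (1 - x)) (at x)"
    "((\<lambda>t. ln (sqrt_sum2 t)) has_real_derivative - (slope_ratio (odds_sqrt x) / 4) * (ln x - ln (1 - x))) (at x)"
    if "s < x" "x < t" for x
    using that assms by (intro DERIV_neg_entropy2 DERIV_ln_sqrt_sum2; simp)+
  define G where "G x = ln (sqrt_sum2 x)" for x
  define h where "h x = (G t - G s) * neg_entropy2 x - (neg_entropy2 t - neg_entropy2 s) * G x" for x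
  have Dh: "(h has_real_derivative ((G t - G s) + (neg_entropy2 t - neg_entropy2 s) * (slope_ratio (odds_sqrt x) / 4))
      * (ln x - ln (1 - x))) (at x)" if "s < x" "x < t" for x
    unfolding h_def G_def
    by (rule DERIV_cong[OF DERIV_diff[OF DERIV_cmult[OF D(1)[OF that]] DERIV_cmult[OF D(2)[OF that]]]])
       (simp add: algebra_simps)
  have "\<exists>l z. s < z \<and> z < t \<and> DERIV h z :> l \<and> h t - h s = (t - s) * l"
  proof (rule MVT[OF assms(2)])
    show "continuous_on {s..t} h" unfolding h_def G_def
      by (intro continuous_intros cont \<open>continuous_on {s..t} neg_entropy2\<close>)
    show "h differentiable at x" if "s < x" "x < t" for x
      using Dh[OF that] real_differentiable_def by blast
  qed
  then obtain l c where c: "s < c" "c < t" "DERIV h c :> l" "h t - h s = (t - s) * l" by blast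
  have "h t - h s = 0" by (simp add: h_def algebra_simps)
  then have "l = 0" using c(4) assms by simp
  then have "((G t - G s) + (neg_entropy2 t - neg_entropy2 s) * (slope_ratio (odds_sqrt c) / 4)) * (ln c - ln (1 - c)) = 0"
    using DERIV_unique[OF Dh[OF c(1,2)] c(3)] by simp
  moreover have "ln c - ln (1 - c) > 0" using c assms by simp
  ultimately have "(G t - G s) + (neg_entropy2 t - neg_entropy2 s) * (slope_ratio (odds_sqrt c) / 4) = 0" by simp
  then show ?thesis by (intro that[OF c(1,2)]) (simp add: G_def field_simps)
qed

lemma sqrt_sum2_half: "sqrt_sum2 (1 / 2) = sqrt 2"
  by (simp add: sqrt_sum2_def real_sqrt_divide field_simps)

text \<open>Replacing \<open>(m, r)\<close> by \<open>(z, 1/2)\<close> keeps the total entropy while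
  the two factors move apart. Per unit of entropy, \<open>ln sqrt_sum2\<close> changes more over
  [m, z] than over [1/2, r], since \<open>r <= m\<close>.\<close>

lemma product_sqrt_sum2_less:
  assumes "1 / 2 < r" "r \<le> m" "m \<le> 1" "z \<in> {1/2..1}"
    and ent: "neg_entropy2 m + neg_entropy2 r = neg_entropy2 z - ln 2"
  shows "sqrt 2 * sqrt_sum2 z < sqrt_sum2 m * sqrt_sum2 r"
proof -
  have "neg_entropy2 (1 / 2) < neg_entropy2 r" using assms by (intro neg_entropy2_strict_mono) auto
  then have "neg_entropy2 m < neg_entropy2 z" using ent by (simp add: neg_entropy2_half)
  then have "m < z" using neg_entropy2_less_iff[of m z] assms by auto
  obtain c where c: "m < c" "c < z"
    "ln (sqrt_sum2 m) - ln (sqrt_sum2 z) = slope_ratio (odds_sqrt c) / 4 * (neg_entropy2 z - neg_entropy2 m)"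
    by (rule ln_sqrt_sum2_chord[OF _ \<open>m < z\<close>]) (use assms in auto)
  obtain c' where c': "1 / 2 < c'" "c' < r"
    "ln (sqrt_sum2 (1/2)) - ln (sqrt_sum2 r) = slope_ratio (odds_sqrt c') / 4 * (neg_entropy2 r - neg_entropy2 (1/2))"
    by (rule ln_sqrt_sum2_chord[OF _ assms(1)]) (use assms in auto)
  have "odds_sqrt c' < odds_sqrt c" "1 < odds_sqrt c'"
    using c c' assms by (auto intro!: odds_sqrt_strict_mono odds_sqrt_gt_1)
  then have "slope_ratio (odds_sqrt c') < slope_ratio (odds_sqrt c)" by (intro slope_ratio_strict_mono)
  then have "slope_ratio (odds_sqrt c') / 4 * (neg_entropy2 z - neg_entropy2 m) < slope_ratio (odds_sqrt c) / 4 * (neg_entropy2 z - neg_entropy2 m)"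
    using \<open>neg_entropy2 m < neg_entropy2 z\<close> by (intro mult_strict_right_mono) auto
  moreover have "neg_entropy2 z - neg_entropy2 m = neg_entropy2 r - neg_entropy2 (1 / 2)"
    using ent by (simp add: neg_entropy2_half)
  ultimately have "ln (sqrt 2) + ln (sqrt_sum2 z) < ln (sqrt_sum2 m) + ln (sqrt_sum2 r)"
    using c(3) c'(3) by (simp add: sqrt_sum2_half)
  moreover have pos: "0 < sqrt_sum2 z" "0 < sqrt_sum2 m" "0 < sqrt_sum2 r"
    using assms by (auto intro!: sqrt_sum2_pos)
  ultimately have "ln (sqrt 2 * sqrt_sum2 z) < ln (sqrt_sum2 m * sqrt_sum2 r)"
    by (simp add: ln_mult)
  then show ?thesis using pos by simp
qed


text \<open>The last three inequalities carry the unitarity constraint: for a sorted spectrum only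
  \<open>p\<^sub>1 p\<^sub>2 \<le> p\<^sub>0 p\<^sub>3\<close> is restrictive. Requiring it in all three arrangements makes the domain
  symmetric in \<open>p\<^sub>1, p\<^sub>2, p\<^sub>3\<close>, so that where all three are strict it is open in the simplex.\<close>

definition dominant :: "real \<Rightarrow> real \<Rightarrow> real \<Rightarrow> real \<Rightarrow> bool" where
  "dominant p0 p1 p2 p3 \<longleftrightarrow> 0 \<le> p1 \<and> 0 \<le> p2 \<and> 0 \<le> p3 \<and> p1 \<le> p0 \<and> p2 \<le> p0 \<and> p3 \<le> p0 \<and>
     p0 + p1 + p2 + p3 = 1 \<and> p2 * p3 \<le> p0 * p1 \<and> p1 * p3 \<le> p0 * p2 \<and> p1 * p2 \<le> p0 * p3"

definition xlnx_sum4 :: "real \<Rightarrow> real \<Rightarrow> real \<Rightarrow> real \<Rightarrow> real" where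
  "xlnx_sum4 p0 p1 p2 p3 = xlnx p0 + xlnx p1 + xlnx p2 + xlnx p3"

definition sqrt_sum4 :: "real \<Rightarrow> real \<Rightarrow> real \<Rightarrow> real \<Rightarrow> real" where
  "sqrt_sum4 p0 p1 p2 p3 = sqrt p0 + sqrt p1 + sqrt p2 + sqrt p3"

text \<open>Competitors may have more entropy, so a move that lowers both functionals already
  refutes minimality, and no level set has to be followed.\<close>

definition minimal4 :: "real \<Rightarrow> real \<Rightarrow> real \<Rightarrow> real \<Rightarrow> bool" where
  "minimal4 p0 p1 p2 p3 \<longleftrightarrow> (\<forall>q0 q1 q2 q3. dominant q0 q1 q2 q3 \<longrightarrow>
     xlnx_sum4 q0 q1 q2 q3 \<le> xlnx_sum4 p0 p1 p2 p3 \<longrightarrow> sqrt_sum4 p0 p1 p2 p3 \<le> sqrt_sum4 q0 q1 q2 q3)"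

text \<open>With \<open>a = 1 / sqrt x\<close> one has \<open>ln x = - 2 ln a\<close>, so this says
  that three distinct points on the graph of the logarithm are not collinear. Strict concavity
  enters through the tangent at the middle point \<open>b\<close>.\<close>

lemma ln_chord_slopes:
  fixes x y w :: real
  assumes "0 < x" "x < y" "y < w"
  shows "(ln y - ln x) * (1 / sqrt w - 1 / sqrt x) \<noteq> (ln w - ln x) * (1 / sqrt y - 1 / sqrt x)"
proof -
  define a b c where abc: "a = 1 / sqrt x" "b = 1 / sqrt y" "c = 1 / sqrt w"
  have abc0: "0 < c" "c < b" "b < a" using assms by (auto simp: abc divide_simps)
  have ln: "ln x = - 2 * ln a" "ln y = - 2 * ln b" "ln w = - 2 * ln c"
    using assms by (simp_all add: abc ln_div ln_sqrt)
  have 1: "ln a - ln b < (a - b) / b"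
  proof -
    have "ln (a / b) < a / b - 1"
      using ln_le_minus_one[of "a / b"] ln_eq_minus_one[of "a / b"] abc0 by force
    then show ?thesis using abc0 by (simp add: ln_div diff_divide_distrib)
  qed
  have 2: "(b - c) / b < ln b - ln c"
  proof -
    have "ln (c / b) < c / b - 1"
      using ln_le_minus_one[of "c / b"] ln_eq_minus_one[of "c / b"] abc0 by force
    then show ?thesis using abc0 by (simp add: ln_div diff_divide_distrib)
  qed
  have "(ln a - ln b) * (b - c) < (a - b) / b * (b - c)"
    using 1 abc0 by (intro mult_strict_right_mono) auto
  also have "\<dots> = (b - c) / b * (a - b)" by simp
  also have "\<dots> < (ln b - ln c) * (a - b)"
    using 2 abc0 by (intro mult_strict_right_mono) auto
  finally have "0 < 2 * ((ln b - ln c) * (a - b) - (ln a - ln b) * (b - c))" by simp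
  also have "\<dots> = 2 * ((ln a - ln b) * (c - a) - (ln a - ln c) * (b - a))"
    by (simp add: algebra_simps)
  also have "\<dots> = (ln y - ln x) * (1 / sqrt w - 1 / sqrt x) - (ln w - ln x) * (1 / sqrt y - 1 / sqrt x)"
    unfolding ln abc[symmetric] by (simp add: algebra_simps)
  finally show ?thesis by (metis less_irrefl diff_self)
qed

text \<open>Changing three probabilities with fixed sum leaves the increments \<open>d\<close> and
  \<open>e\<close> free. The two equations prescribe a decrease of both functionals, and
  noncollinearity makes the linear system regular.\<close>

lemma perturbation_direction:
  fixes u v w :: real
  assumes pos: "0 < u" "0 < v" "0 < w" and distinct: "u \<noteq> v" "u \<noteq> w" "v \<noteq> w"
  obtains d e where "(ln v - ln u) * d + (ln w - ln u) * e = -1"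
    "(1 / sqrt v - 1 / sqrt u) * d + (1 / sqrt w - 1 / sqrt u) * e = -1"
proof -
  let ?a = "ln v - ln u" and ?b = "ln w - ln u" and ?c = "1 / sqrt v - 1 / sqrt u" and ?d = "1 / sqrt w - 1 / sqrt u"
  consider "u < v" "v < w" | "u < w" "w < v" | "v < u" "u < w" | "v < w" "w < u" | "w < u" "u < v" | "w < v" "v < u"
    using distinct by linarith
  then have "?a * ?d - ?b * ?c \<noteq> 0"
  proof cases
    case 1 then show ?thesis using ln_chord_slopes[of u v w] pos by (simp add: algebra_simps)
  next
    case 2 then show ?thesis using ln_chord_slopes[of u w v] pos by (simp add: algebra_simps)
  next
    case 3 then show ?thesis using ln_chord_slopes[of v u w] pos by (simp add: algebra_simps)
  next
    case 4 then show ?thesis using ln_chord_slopes[of v w u] pos by (simp add: algebra_simps)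
  next
    case 5 then show ?thesis using ln_chord_slopes[of w u v] pos by (simp add: algebra_simps)
  next
    case 6 then show ?thesis using ln_chord_slopes[of w v u] pos by (simp add: algebra_simps)
  qed
  then have D: "?a * ?d - ?b * ?c \<noteq> 0" .
  define e1 where "e1 = (?b - ?d) / (?a * ?d - ?b * ?c)"
  define e2 where "e2 = (?c - ?a) / (?a * ?d - ?b * ?c)"
  have cramer: "a * ((b - d) / (a * d - b * c)) + b * ((c - a) / (a * d - b * c)) = -1"
    "c * ((b - d) / (a * d - b * c)) + d * ((c - a) / (a * d - b * c)) = -1"
    if "a * d - b * c \<noteq> 0" for a b c d :: real
    using that by (simp_all add: divide_simps) (simp_all add: algebra_simps)
  show ?thesis using that[of e1 e2] cramer[OF D] unfolding e1_def e2_def by blast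
qed

text \<open>Strict constraints survive a small move, and they force \<open>p0\<close> above the
  other three. So \<open>p1 \<noteq> p2\<close> gives three distinct positive values to move, with
  \<open>p3\<close> held fixed.\<close>

lemma not_minimal_if_distinct:
  assumes dom: "dominant p0 p1 p2 p3"
    and strict: "p2 * p3 < p0 * p1" "p1 * p3 < p0 * p2" "p1 * p2 < p0 * p3" and "p1 \<noteq> p2"
  shows "\<not> minimal4 p0 p1 p2 p3"
proof
  assume min: "minimal4 p0 p1 p2 p3"
  have nn: "0 \<le> p0" "0 \<le> p1" "0 \<le> p2" "0 \<le> p3" using dom by (auto simp: dominant_def)
  have pos: "0 < p0" "0 < p1" "0 < p2" "0 < p3"
  proof -
    have "0 < p0 * p1" "0 < p0 * p2" "0 < p0 * p3"
      using strict nn by (meson le_less_trans mult_nonneg_nonneg)+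
    then show "0 < p0" "0 < p1" "0 < p2" "0 < p3" using nn by (auto simp: zero_less_mult_iff)
  qed
  have less: "p1 < p0" "p2 < p0" "p3 < p0"
  proof -
    \<comment> \<open>Equality of \<open>p0\<close> with one of the others turns two of the strict
      inequalities into opposite ones.\<close>
    have "p0 \<noteq> p1" using strict(2,3) pos by auto
    moreover have "p0 \<noteq> p2" using strict(1,3) pos by (auto simp: mult.commute)
    moreover have "p0 \<noteq> p3" using strict(1,2) pos by (auto simp: mult.commute)
    ultimately show "p1 < p0" "p2 < p0" "p3 < p0" using dom by (auto simp: dominant_def)
  qed
  obtain d e where de: "(ln p1 - ln p0) * d + (ln p2 - ln p0) * e = -1"
    "(1 / sqrt p1 - 1 / sqrt p0) * d + (1 / sqrt p2 - 1 / sqrt p0) * e = -1"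
    by (rule perturbation_direction[OF pos(1-3) _ _ \<open>p1 \<noteq> p2\<close>]) (use less in auto)
  let ?q0 = "\<lambda>t. p0 - t * (d + e)" and ?q1 = "\<lambda>t. p1 + t * d" and ?q2 = "\<lambda>t. p2 + t * e"
  have "((\<lambda>t. xlnx_sum4 (?q0 t) (?q1 t) (?q2 t) p3) has_real_derivative
      (ln p1 - ln p0) * d + (ln p2 - ln p0) * e) (at 0)"
    unfolding xlnx_sum4_def using pos by (auto intro!: derivative_eq_intros simp: algebra_simps)
  then have "\<exists>d>0. \<forall>h>0. h < d \<longrightarrow> xlnx_sum4 (?q0 (0 + h)) (?q1 (0 + h)) (?q2 (0 + h)) p3 < xlnx_sum4 (?q0 0) (?q1 0) (?q2 0) p3"
    unfolding de by (rule DERIV_neg_dec_right) simp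
  then have 1: "eventually (\<lambda>t. xlnx_sum4 (?q0 t) (?q1 t) (?q2 t) p3 < xlnx_sum4 p0 p1 p2 p3) (at_right 0)"
    unfolding eventually_at_right_field by auto
  have "((\<lambda>t. sqrt_sum4 (?q0 t) (?q1 t) (?q2 t) p3) has_real_derivative
      ((1 / sqrt p1 - 1 / sqrt p0) * d + (1 / sqrt p2 - 1 / sqrt p0) * e) / 2) (at 0)"
    unfolding sqrt_sum4_def using pos by (auto intro!: derivative_eq_intros simp: field_simps)
  then have "\<exists>d>0. \<forall>h>0. h < d \<longrightarrow> sqrt_sum4 (?q0 (0 + h)) (?q1 (0 + h)) (?q2 (0 + h)) p3 < sqrt_sum4 (?q0 0) (?q1 0) (?q2 0) p3"
    unfolding de by (rule DERIV_neg_dec_right) simp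
  then have 2: "eventually (\<lambda>t. sqrt_sum4 (?q0 t) (?q1 t) (?q2 t) p3 < sqrt_sum4 p0 p1 p2 p3) (at_right 0)"
    unfolding eventually_at_right_field by auto
  have lim: "(?q0 \<longlongrightarrow> p0) (at_right 0)" "(?q1 \<longlongrightarrow> p1) (at_right 0)" "(?q2 \<longlongrightarrow> p2) (at_right 0)"
    by (auto intro!: tendsto_eq_intros)
  have ev: "eventually (\<lambda>t. f t < g t) (at_right 0)" if fg: "(f \<longlongrightarrow> a) (at_right 0)" "(g \<longlongrightarrow> b) (at_right 0)" "a < b"
    for f g :: "real \<Rightarrow> real" and a b
  proof -
    obtain m where "a < m" "m < b" using dense[OF fg(3)] by blast
    with order_tendstoD(2)[OF fg(1), of m] order_tendstoD(1)[OF fg(2), of m]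
    show ?thesis by (auto elim: eventually_elim2)
  qed
  have 3: "eventually (\<lambda>t. dominant (?q0 t) (?q1 t) (?q2 t) p3) (at_right 0)"
  proof -
    have "eventually (\<lambda>t. 0 < ?q1 t \<and> 0 < ?q2 t \<and> ?q1 t < ?q0 t \<and> ?q2 t < ?q0 t \<and> p3 < ?q0 t \<and>
        ?q2 t * p3 < ?q0 t * ?q1 t \<and> ?q1 t * p3 < ?q0 t * ?q2 t \<and> ?q1 t * ?q2 t < ?q0 t * p3) (at_right 0)"
      by (intro eventually_conj ev[OF tendsto_const lim(2) pos(2)] ev[OF tendsto_const lim(3) pos(3)]
          ev[OF lim(2) lim(1) less(1)] ev[OF lim(3) lim(1) less(2)] ev[OF tendsto_const lim(1) less(3)]
          ev[OF tendsto_mult[OF lim(3) tendsto_const] tendsto_mult[OF lim(1,2)] strict(1)]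
          ev[OF tendsto_mult[OF lim(2) tendsto_const] tendsto_mult[OF lim(1,3)] strict(2)]
          ev[OF tendsto_mult[OF lim(2,3)] tendsto_mult[OF lim(1) tendsto_const] strict(3)])
    then show ?thesis
    proof eventually_elim
      case (elim t)
      then show ?case using dom nn(4) by (auto simp: dominant_def algebra_simps)
    qed
  qed
  have "eventually (\<lambda>t. False) (at_right (0::real))"
    using 1 2 3
  proof eventually_elim
    case (elim t)
    then show ?case using min unfolding minimal4_def by (meson less_le_not_le)
  qed
  then show False by (simp add: trivial_limit_at_right_real)
qed

lemma dominant_swap12: "dominant p0 p1 p2 p3 \<longleftrightarrow> dominant p0 p2 p1 p3"
  by (auto simp: dominant_def mult.commute)

lemma dominant_swap23: "dominant p0 p1 p2 p3 \<longleftrightarrow> dominant p0 p1 p3 p2"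
  by (auto simp: dominant_def mult.commute)

lemma sum4_swap:
  "xlnx_sum4 p0 p2 p1 p3 = xlnx_sum4 p0 p1 p2 p3" "sqrt_sum4 p0 p2 p1 p3 = sqrt_sum4 p0 p1 p2 p3"
  "xlnx_sum4 p0 p1 p3 p2 = xlnx_sum4 p0 p1 p2 p3" "sqrt_sum4 p0 p1 p3 p2 = sqrt_sum4 p0 p1 p2 p3"
  by (simp_all add: xlnx_sum4_def sqrt_sum4_def)

lemma minimal4_swap:
  "minimal4 p0 p2 p1 p3 \<longleftrightarrow> minimal4 p0 p1 p2 p3" "minimal4 p0 p1 p3 p2 \<longleftrightarrow> minimal4 p0 p1 p2 p3"
  by (simp_all add: minimal4_def sum4_swap)

lemma product_entropy_bound:
  assumes dom: "dominant p0 p1 p2 p3" and prod: "p0 * p3 = p1 * p2"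
    and z: "z \<in> {1/2..1}" and ent: "xlnx_sum4 p0 p1 p2 p3 = neg_entropy2 z - ln 2"
  shows "sqrt 2 * sqrt_sum2 z \<le> sqrt_sum4 p0 p1 p2 p3"
    "sqrt_sum4 p0 p1 p2 p3 = sqrt 2 * sqrt_sum2 z \<Longrightarrow> p0 = p1 \<and> p2 = p3 \<or> p0 = p2 \<and> p1 = p3"
proof -
  \<comment> \<open>Marginals of the table with rows \<open>(p0, p1)\<close> and
    \<open>(p2, p3)\<close>; its zero determinant makes it the product of its marginals.\<close>
  define m r where mr: "m = p0 + p1" "r = p0 + p2"
  have nn: "0 \<le> p0" "0 \<le> p1" "0 \<le> p2" "0 \<le> p3" and le: "p1 \<le> p0" "p2 \<le> p0" "p3 \<le> p0"
    and sum: "p0 + p1 + p2 + p3 = 1"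
    using dom by (auto simp: dominant_def)
  have p0: "0 < p0" using nn le sum by linarith
  have p: "p0 = m * r" "p1 = m * (1 - r)" "p2 = (1 - m) * r" "p3 = (1 - m) * (1 - r)"
  proof -
    have "m * r = p0 * (p0 + p1 + p2) + p1 * p2" by (simp add: mr algebra_simps)
    also have "\<dots> = p0 * (p0 + p1 + p2 + p3)" using prod by (simp add: algebra_simps)
    finally show 0: "p0 = m * r" by (simp add: sum)
    have e: "m * (1 - r) = m - m * r" "(1 - m) * r = r - m * r" "(1 - m) * (1 - r) = 1 - m - r + m * r"
      by (simp_all add: algebra_simps)
    show "p1 = m * (1 - r)" "p2 = (1 - m) * r" "p3 = (1 - m) * (1 - r)"
      unfolding e 0[symmetric] using sum by (simp_all add: mr)
  qed
  \<comment> \<open>\<open>p3\<close> is the smallest entry, so both marginals are at least 1/2 and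
    lie where \<open>neg_entropy2\<close> is injective.\<close>
  have "p0 * p3 \<le> p0 * p1" "p0 * p3 \<le> p0 * p2"
    unfolding prod using mult_left_mono[OF le(2) nn(2)] mult_right_mono[OF le(1) nn(3)]
    by (simp_all add: mult.commute)
  then have "p3 \<le> p1" "p3 \<le> p2" using p0 by (simp_all add: mult_le_cancel_left)
  then have bounds: "1 / 2 \<le> m" "m \<le> 1" "1 / 2 \<le> r" "r \<le> 1"
    using nn le sum by (auto simp: mr)
  have Q: "sqrt_sum4 p0 p1 p2 p3 = sqrt_sum2 m * sqrt_sum2 r"
    unfolding sqrt_sum4_def sqrt_sum2_def p real_sqrt_mult by (simp add: algebra_simps)
  have "xlnx_sum4 p0 p1 p2 p3 = neg_entropy2 m + neg_entropy2 r"
  proof -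
    have "xlnx (a * b) = b * xlnx a + a * xlnx b" if "a \<in> {m, 1 - m}" "b \<in> {r, 1 - r}" for a b
      using that bounds by (intro xlnx_mult) auto
    from this[of m r] this[of m "1 - r"] this[of "1 - m" r] this[of "1 - m" "1 - r"]
    have "xlnx_sum4 p0 p1 p2 p3 = (r * xlnx m + m * xlnx r) + ((1 - r) * xlnx m + m * xlnx (1 - r))
      + (r * xlnx (1 - m) + (1 - m) * xlnx r) + ((1 - r) * xlnx (1 - m) + (1 - m) * xlnx (1 - r))"
      unfolding xlnx_sum4_def p by simp
    then show ?thesis unfolding neg_entropy2_def by (simp add: algebra_simps)
  qed
  then have ent': "neg_entropy2 m + neg_entropy2 r = neg_entropy2 z - ln 2" using ent by simp
  \<comment> \<open>With one uniform marginal the other one has the entropy of \<open>z\<close>,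
    hence equals \<open>z\<close>; these are the pair-pair spectra. Otherwise
    \<open>product_sqrt_sum2_less\<close> is strict.\<close>
  have half: "sqrt_sum4 p0 p1 p2 p3 = sqrt 2 * sqrt_sum2 z" if "m = 1 / 2 \<or> r = 1 / 2"
  proof -
    have "m = z \<or> r = z"
    proof (cases "m = 1 / 2")
      case True
      then have "neg_entropy2 m = - ln 2" by (simp only: neg_entropy2_half)
      then have "neg_entropy2 r = neg_entropy2 z" using ent' by simp
      then show ?thesis using neg_entropy2_less_iff[of r z] neg_entropy2_less_iff[of z r] bounds z by auto
    next
      case False
      then have "r = 1 / 2" using that by simp
      then have "neg_entropy2 r = - ln 2" by (simp only: neg_entropy2_half)
      then have "neg_entropy2 m = neg_entropy2 z" using ent' by simp
      then show ?thesis using neg_entropy2_less_iff[of m z] neg_entropy2_less_iff[of z m] bounds z by auto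
    qed
    moreover have "m = z \<Longrightarrow> r = 1 / 2" "r = z \<Longrightarrow> m = 1 / 2"
    proof -
      have "t = 1 / 2" if "neg_entropy2 t = - ln 2" "1 / 2 \<le> t" "t \<le> 1" for t
      proof (rule ccontr)
        assume "t \<noteq> 1 / 2"
        then have "1 / 2 < t" using that by simp
        from neg_entropy2_strict_mono[OF order_refl this that(3)] show False
          using that by (simp add: neg_entropy2_half)
      qed
      then show "m = z \<Longrightarrow> r = 1 / 2" "r = z \<Longrightarrow> m = 1 / 2" using ent' bounds by simp_all
    qed
    ultimately consider "m = z" "r = 1 / 2" | "r = z" "m = 1 / 2" by blast
    then show ?thesis unfolding Q by cases (simp_all only: sqrt_sum2_half mult.commute)
  qed
  have strict: "sqrt 2 * sqrt_sum2 z < sqrt_sum4 p0 p1 p2 p3" if "m \<noteq> 1 / 2" "r \<noteq> 1 / 2"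
  proof (cases "r \<le> m")
    case True
    then show ?thesis unfolding Q using product_sqrt_sum2_less[of r m z] that bounds z ent' by simp
  next
    case False
    then show ?thesis unfolding Q using product_sqrt_sum2_less[of m r z] that bounds z ent' by (simp add: mult.commute)
  qed
  show "sqrt 2 * sqrt_sum2 z \<le> sqrt_sum4 p0 p1 p2 p3"
    using half strict by fastforce
  assume "sqrt_sum4 p0 p1 p2 p3 = sqrt 2 * sqrt_sum2 z"
  then have "m = 1 / 2 \<or> r = 1 / 2" using strict by fastforce
  then show "p0 = p1 \<and> p2 = p3 \<or> p0 = p2 \<and> p1 = p3" unfolding p by auto
qed

definition paired :: "real \<Rightarrow> real \<Rightarrow> real \<Rightarrow> real \<Rightarrow> bool" where
  "paired p0 p1 p2 p3 \<longleftrightarrow> p0 = p1 \<and> p2 = p3 \<or> p0 = p2 \<and> p1 = p3 \<or> p0 = p3 \<and> p1 = p2"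

lemma minimal_entropy_bound:
  assumes dom: "dominant p0 p1 p2 p3" and min: "minimal4 p0 p1 p2 p3"
    and z: "z \<in> {1/2..1}" and ent: "xlnx_sum4 p0 p1 p2 p3 = neg_entropy2 z - ln 2"
  shows "sqrt 2 * sqrt_sum2 z \<le> sqrt_sum4 p0 p1 p2 p3 \<and>
    (sqrt_sum4 p0 p1 p2 p3 = sqrt 2 * sqrt_sum2 z \<longrightarrow> paired p0 p1 p2 p3)"
proof -
  have nn: "0 \<le> p0" "0 \<le> p1" "0 \<le> p2" "0 \<le> p3" and le: "p1 \<le> p0" "p2 \<le> p0" "p3 \<le> p0"
    and sum: "p0 + p1 + p2 + p3 = 1"
    and "p2 * p3 \<le> p0 * p1" "p1 * p3 \<le> p0 * p2" "p1 * p2 \<le> p0 * p3"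
    using dom by (auto simp: dominant_def)
  then consider "p0 * p1 = p2 * p3" | "p0 * p2 = p1 * p3" | "p0 * p3 = p1 * p2"
    | (strict) "p2 * p3 < p0 * p1" "p1 * p3 < p0 * p2" "p1 * p2 < p0 * p3" by linarith
  then show ?thesis
  proof cases
    case 3
    from product_entropy_bound[OF dom this z ent] show ?thesis by (auto simp: paired_def)
  next
    case 2
    have "dominant p0 p1 p3 p2" using dom dominant_swap23 by simp
    from product_entropy_bound[OF this 2 z] ent show ?thesis by (auto simp: paired_def sum4_swap)
  next
    case 1
    have "dominant p0 p3 p2 p1" using dom dominant_swap23 dominant_swap12 by metis
    moreover have "xlnx_sum4 p0 p3 p2 p1 = xlnx_sum4 p0 p1 p2 p3" "sqrt_sum4 p0 p3 p2 p1 = sqrt_sum4 p0 p1 p2 p3"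
      by (simp_all add: xlnx_sum4_def sqrt_sum4_def)
    moreover have "p0 * p1 = p3 * p2" using 1 by simp
    ultimately show ?thesis using product_entropy_bound[of p0 p3 p2 p1 z] z ent by (auto simp: paired_def)
  next
    case strict
    \<comment> \<open>Only a fractional-SWAP spectrum survives the perturbation argument, and it maximises the
      sum of square roots at its entropy.\<close>
    have "p1 = p2" using not_minimal_if_distinct[OF dom strict] min by blast
    moreover have "p1 = p3"
      using not_minimal_if_distinct[of p0 p1 p3 p2] dom dominant_swap23 min minimal4_swap(2) strict
      by (metis mult.commute)
    ultimately have eq: "p2 = p1" "p3 = p1" by simp_all
    have "0 < p1" "p1 < p0" using strict nn le eq by (auto simp: less_le)
    \<comment> \<open>The pair-pair spectrum \<open>(z / 2, z / 2, y, y)\<close> has the entropy of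
      \<open>p\<close>; the upper bound is applied to it, with the fractional-SWAP spectrum
      \<open>p\<close> as the extremal one.\<close>
    define y where "y = (1 - z) / 2"
    have q: "xlnx_sum4 (z / 2) (z / 2) y y = xlnx_sum4 p0 p1 p2 p3"
    proof -
      have half: "2 * xlnx (t / 2) = xlnx t - t * ln 2" if "0 \<le> t" for t
        using xlnx_mult[of t "1/2"] that by (simp add: xlnx_def ln_div)
      have "xlnx_sum4 (z / 2) (z / 2) y y = neg_entropy2 z - ln 2"
        unfolding y_def xlnx_sum4_def neg_entropy2_def
        using half[of z] half[of "1 - z"] z by (simp add: algebra_simps)
      then show ?thesis using ent by simp
    qed
    have Q: "sqrt_sum4 (z / 2) (z / 2) y y = sqrt 2 * sqrt_sum2 z"
    proof -
      have "2 * sqrt (t / 2) = sqrt 2 * sqrt t" for t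
        by (simp add: real_sqrt_divide field_simps)
      from this[of z] this[of "1 - z"] show ?thesis by (simp add: sqrt_sum4_def sqrt_sum2_def y_def distrib_left)
    qed
    have sum': "p0 + 3 * p1 = 1" using sum eq by simp
    note up = sum_sqrt_upper_entropy[of "z / 2" y y "z / 2" p1 p0]
    have "sqrt_sum4 (z / 2) (z / 2) y y \<le> sqrt_sum4 p0 p1 p2 p3"
      using up(1) q z \<open>0 < p1\<close> \<open>p1 < p0\<close> sum' by (simp add: sqrt_sum4_def xlnx_sum4_def eq y_def)
    moreover have "sqrt_sum4 (z / 2) (z / 2) y y \<noteq> sqrt_sum4 p0 p1 p2 p3"
    proof
      assume "sqrt_sum4 (z / 2) (z / 2) y y = sqrt_sum4 p0 p1 p2 p3"
      then have "{z / 2, z / 2, y, y} \<subseteq> {p1, p0}"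
        using up(2) q z \<open>0 < p1\<close> \<open>p1 < p0\<close> sum' by (simp add: sqrt_sum4_def xlnx_sum4_def eq y_def)
      \<comment> \<open>Two copies each of \<open>z / 2\<close> and \<open>y\<close>, both taken
        from \<open>p0\<close> and \<open>p1\<close>, cannot have the sum \<open>p0 + 3 p1\<close>
        when \<open>p0\<close> and \<open>p1\<close> differ.\<close>
      moreover have "z / 2 + z / 2 + y + y = 1" by (simp add: y_def)
      ultimately show False using sum' \<open>0 < p1\<close> \<open>p1 < p0\<close> by auto
    qed
    ultimately show ?thesis unfolding Q by simp
  qed
qed

text \<open>Compactness: \<open>xlnx\<close> is continuous up to 0, so the sublevel set of the
  entropy functional is closed in the compact domain.\<close>

lemma minimal4_exists:
  assumes dom: "dominant p0 p1 p2 p3"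
  obtains q0 q1 q2 q3 where "dominant q0 q1 q2 q3" "xlnx_sum4 q0 q1 q2 q3 \<le> xlnx_sum4 p0 p1 p2 p3"
    "minimal4 q0 q1 q2 q3" "sqrt_sum4 q0 q1 q2 q3 \<le> sqrt_sum4 p0 p1 p2 p3"
proof -
  define D :: "(real \<times> real \<times> real \<times> real) set" where "D = {(q0, q1, q2, q3). dominant q0 q1 q2 q3}"
  define X where "X = (\<lambda>(q0, q1, q2, q3). xlnx_sum4 q0 q1 q2 q3)"
  define Q where "Q = (\<lambda>(q0, q1, q2, q3). sqrt_sum4 q0 q1 q2 q3)"
  have "closed D" unfolding D_def dominant_def case_prod_unfold
    by (intro closed_Collect_conj closed_Collect_le closed_Collect_eq continuous_intros)
  moreover have "D \<subseteq> cbox (0, 0, 0, 0) (1, 1, 1, 1)"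
    by (auto simp: D_def dominant_def cbox_Pair_eq)
  ultimately have cD: "compact D"
    by (meson bounded_cbox bounded_subset compact_eq_bounded_closed)
  have "continuous_on D X" unfolding X_def case_prod_unfold xlnx_sum4_def
    by (intro continuous_intros) (auto simp: D_def dominant_def)
  then have "closed (D \<inter> X -` {..xlnx_sum4 p0 p1 p2 p3})"
    using \<open>closed D\<close> by (intro continuous_closed_preimage) auto
  then have "compact (D \<inter> (D \<inter> X -` {..xlnx_sum4 p0 p1 p2 p3}))" (is "compact ?C")
    using cD by (rule compact_Int_closed[rotated])
  moreover have "(p0, p1, p2, p3) \<in> ?C" using dom by (auto simp: D_def X_def)
  moreover have "continuous_on ?C Q" unfolding Q_def case_prod_unfold sqrt_sum4_def
    by (intro continuous_intros)
  ultimately obtain q where q: "q \<in> ?C" "\<And>q'. q' \<in> ?C \<Longrightarrow> Q q \<le> Q q'"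
    by (metis (no_types, lifting) continuous_attains_inf empty_iff)
  obtain q0 q1 q2 q3 where qq: "q = (q0, q1, q2, q3)" by (metis surj_pair)
  have 1: "dominant q0 q1 q2 q3" "xlnx_sum4 q0 q1 q2 q3 \<le> xlnx_sum4 p0 p1 p2 p3"
    using q(1) by (auto simp: qq D_def X_def)
  moreover have "minimal4 q0 q1 q2 q3"
    unfolding minimal4_def
  proof (intro allI impI)
    fix r0 r1 r2 r3 assume "dominant r0 r1 r2 r3" "xlnx_sum4 r0 r1 r2 r3 \<le> xlnx_sum4 q0 q1 q2 q3"
    with 1 have "(r0, r1, r2, r3) \<in> ?C" by (auto simp: D_def X_def)
    from q(2)[OF this] show "sqrt_sum4 q0 q1 q2 q3 \<le> sqrt_sum4 r0 r1 r2 r3" by (simp add: qq Q_def)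
  qed
  moreover have "sqrt_sum4 q0 q1 q2 q3 \<le> sqrt_sum4 p0 p1 p2 p3"
    using q(2)[OF \<open>(p0, p1, p2, p3) \<in> ?C\<close>] by (simp add: qq Q_def)
  ultimately show ?thesis using that by blast
qed

text \<open>The minimiser may have more entropy than \<open>p\<close>. It then belongs to some
  \<open>z' <= z\<close>, and the bound for \<open>z'\<close> is at least the one for
  \<open>z\<close>.\<close>

lemma sqrt_sum4_ge_pair_pair:
  assumes dom: "dominant p0 p1 p2 p3"
    and z: "z \<in> {1/2..1}" and ent: "xlnx_sum4 p0 p1 p2 p3 \<le> neg_entropy2 z - ln 2"
  shows "sqrt 2 * sqrt_sum2 z \<le> sqrt_sum4 p0 p1 p2 p3"
proof -
  obtain q0 q1 q2 q3 where q: "dominant q0 q1 q2 q3" "xlnx_sum4 q0 q1 q2 q3 \<le> xlnx_sum4 p0 p1 p2 p3"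
    "minimal4 q0 q1 q2 q3" "sqrt_sum4 q0 q1 q2 q3 \<le> sqrt_sum4 p0 p1 p2 p3"
    by (rule minimal4_exists[OF dom])
  \<comment> \<open>The entropy of four outcomes is at most two bits, which guarantees that
    \<open>z'\<close> exists.\<close>
  have "- ln 4 \<le> xlnx_sum4 q0 q1 q2 q3"
  proof -
    have "0 \<le> q0" "0 \<le> q1" "0 \<le> q2" "0 \<le> q3" "q0 + q1 + q2 + q3 = 1" using q(1) by (auto simp: dominant_def)
    moreover have "(q0 + q1 + q2 + q3) * ln (1 / 4) + (q0 + q1 + q2 + q3) - 1 \<le> xlnx_sum4 q0 q1 q2 q3"
      using xlnx_tangent[of q0 "1/4"] xlnx_tangent[of q1 "1/4"] xlnx_tangent[of q2 "1/4"] xlnx_tangent[of q3 "1/4"] calculation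
      unfolding xlnx_sum4_def distrib_right by linarith
    ultimately show ?thesis by (simp add: ln_div)
  qed
  moreover have "ln 4 = 2 * ln (2::real)" using ln_realpow[of 2 2] by simp
  ultimately have "- ln 2 \<le> xlnx_sum4 q0 q1 q2 q3 + ln 2" by simp
  moreover have le: "xlnx_sum4 q0 q1 q2 q3 + ln 2 \<le> neg_entropy2 z" using q(2) ent by simp
  moreover have "neg_entropy2 z \<le> 0"
    using neg_entropy2_less_iff[of 1 z] z by force
  ultimately obtain z' where z': "z' \<in> {1/2..1}" "neg_entropy2 z' = xlnx_sum4 q0 q1 q2 q3 + ln 2"
    using neg_entropy2_surj[of "xlnx_sum4 q0 q1 q2 q3 + ln 2"] by auto
  then have "z' \<le> z" using le neg_entropy2_less_iff[OF z z'(1)] by simp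
  then have "sqrt_sum2 z \<le> sqrt_sum2 z'" using z z' by (intro sqrt_sum2_antimono) auto
  then have "sqrt 2 * sqrt_sum2 z \<le> sqrt 2 * sqrt_sum2 z'" by simp
  also have "\<dots> \<le> sqrt_sum4 q0 q1 q2 q3"
    using minimal_entropy_bound[OF q(1,3) z'(1)] z'(2) by simp
  finally have bound: "sqrt 2 * sqrt_sum2 z \<le> sqrt_sum4 q0 q1 q2 q3" .
  then show ?thesis using q(4) by simp
qed

text \<open>A spectrum that attains the bound is itself a minimiser, because the bound covers all
  competitors of at least the same entropy.\<close>

lemma sum_sqrt_lower_entropy_pair_pair:
  assumes dom: "dominant p0 p1 p2 p3"
    and z: "z \<in> {1/2..1}" and ent: "xlnx_sum4 p0 p1 p2 p3 = neg_entropy2 z - ln 2"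
    and eq: "sqrt_sum4 p0 p1 p2 p3 = sqrt 2 * sqrt_sum2 z"
  shows "paired p0 p1 p2 p3"
proof -
  have "minimal4 p0 p1 p2 p3"
    unfolding minimal4_def ent eq using sqrt_sum4_ge_pair_pair z by blast
  from minimal_entropy_bound[OF dom this z ent] eq show ?thesis by blast
qed


section \<open>Envelopes\<close>

text \<open>With \<open>a <= b <= c\<close> the cosines of the doubled angles,
  \<open>A = b c\<close>, \<open>B = a c\<close> and \<open>C = a b\<close>. Then
  \<open>A B = c^2 C\<close>, whence the constraint.\<close>

lemma two_qubit_spectrum:
  assumes "unitary U"
  obtains A B C where "0 \<le> C" "C \<le> B" "B \<le> A" "A \<le> 1" "A * B \<le> C" "0 \<le> 1 - A - B + C"
    "schmidt_spectrum U = {# (1 + A + B + C) / 4, (1 + A - B - C) / 4, (1 - A + B - C) / 4, (1 - A - B + C) / 4 #}"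
proof -
  obtain x y z where cf: "cartan_form U x y z" using cartan_form_exists[OF assms] by blast
  then have xyz: "\<bar>z\<bar> \<le> y" "y \<le> x" "x \<le> pi / 4" by (auto simp: cartan_form_def)
  define a b c where "a = cos (2 * x)" "b = cos (2 * y)" "c = cos (2 * z)"
  note abc = this
  \<comment> \<open>The cosine forgets the sign of \<open>z\<close>, so the spectrum does not see
    it.\<close>
  have "cos (2 * \<bar>z\<bar>) = c" by (simp add: abc abs_if)
  moreover have "cos (2 * y) \<le> cos (2 * \<bar>z\<bar>)" "cos (2 * x) \<le> cos (2 * y)"
    using xyz by (intro cos_monotone_0_pi_le; linarith)+
  moreover have "0 \<le> cos (2 * x)" using xyz by (intro cos_ge_zero) auto
  ultimately have ord: "0 \<le> a" "a \<le> b" "b \<le> c" "c \<le> 1" by (simp_all add: abc)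
  have 1: "0 \<le> a * b" "a * b \<le> a * c" "a * c \<le> b * c" "b * c \<le> 1"
    using ord by (auto intro!: mult_left_mono mult_right_mono mult_le_one)
  have "a * b * (c * c) \<le> a * b * 1" using ord by (intro mult_left_mono mult_le_one) auto
  then have 2: "b * c * (a * c) \<le> a * b" by (simp add: mult_ac)
  \<comment> \<open>Nonnegativity of the least probability: \<open>1 - A - B + C\<close> is at least
    \<open>(1 - A) (1 - B)\<close>, by \<open>A B <= C\<close>.\<close>
  have "0 \<le> (1 - b * c) * (1 - a * c)" using 1 by (intro mult_nonneg_nonneg) auto
  then have 3: "0 \<le> 1 - b * c - a * c + a * b" using 2 by (simp add: algebra_simps)
  have "schmidt_spectrum U = {# (1 + b * c + a * c + a * b) / 4, (1 + b * c - a * c - a * b) / 4,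
      (1 - b * c + a * c - a * b) / 4, (1 - b * c - a * c + a * b) / 4 #}"
    unfolding schmidt_spectrum_eq[OF cf] weyl_spectrum_def abc[symmetric] by (simp add: algebra_simps)
  with that 1 2 3 show ?thesis by blast
qed

lemma spectrum_functionals:
  assumes "schmidt_spectrum U = {# p0, p1, p2, p3 #}"
  shows "qp_extent U = 2 * (sqrt_sum4 p0 p1 p2 p3)\<^sup>2 - 1"
    "op_entanglement U = 1 - (p0\<^sup>2 + p1\<^sup>2 + p2\<^sup>2 + p3\<^sup>2)"
    "schmidt_strength U = - xlnx_sum4 p0 p1 p2 p3 / ln 2"
  unfolding qp_extent_def op_entanglement_def schmidt_strength_def assms
  by (simp_all add: sqrt_sum4_def xlnx_sum4_def xlnx_def log_def add_divide_distrib diff_divide_distrib add.assoc)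

lemma two_qubit_probabilities:
  assumes "unitary U"
  obtains p0 p1 p2 p3 where "schmidt_spectrum U = {# p0, p1, p2, p3 #}"
    "p3 \<le> p2" "p2 \<le> p1" "p1 \<le> p0" "0 \<le> p3" "p0 + p1 + p2 + p3 = 1" "dominant p0 p1 p2 p3"
proof -
  obtain A B C where ABC: "0 \<le> C" "C \<le> B" "B \<le> A" "A \<le> 1" "A * B \<le> C" "0 \<le> 1 - A - B + C"
    and spec: "schmidt_spectrum U = {# (1 + A + B + C) / 4, (1 + A - B - C) / 4, (1 - A + B - C) / 4, (1 - A - B + C) / 4 #}"
    using two_qubit_spectrum[OF assms] .
  \<comment> \<open>In terms of \<open>A\<close>, \<open>B\<close>, \<open>C\<close> the product
    conditions of \<open>dominant\<close> read \<open>B C <= A\<close>, \<open>A C <= B\<close> and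
    \<open>A B <= C\<close>.\<close>
  have "B * C \<le> A * 1" "A * C \<le> 1 * B" using ABC by (intro mult_mono; linarith)+
  then have "dominant ((1 + A + B + C) / 4) ((1 + A - B - C) / 4) ((1 - A + B - C) / 4) ((1 - A - B + C) / 4)"
    using ABC unfolding dominant_def by (simp add: field_simps)
  moreover have "(1 + A + B + C) / 4 + (1 + A - B - C) / 4 + (1 - A + B - C) / 4 + (1 - A - B + C) / 4 = 1"
    by (simp add: field_simps)
  ultimately show ?thesis using ABC by (intro that[OF spec]) simp_all
qed

lemma cos_double_surj: "0 \<le> a \<Longrightarrow> a \<le> 1 \<Longrightarrow> \<exists>\<theta>\<in>{0..pi/4}. cos (2 * \<theta>) = a"
proof
  assume a: "0 \<le> a" "a \<le> 1"
  then have "arccos a \<le> arccos 0" by (subst arccos_le_mono) auto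
  then have "arccos a \<le> pi / 2" by simp
  with a show "arccos a / 2 \<in> {0..pi/4}" using arccos_lbound[of a] by simp
  from a show "cos (2 * (arccos a / 2)) = a" by simp
qed

lemma cos_double_bounds: "\<theta> \<in> {0..pi/4} \<Longrightarrow> 0 \<le> cos (2 * \<theta>) \<and> cos (2 * \<theta>) \<le> 1"
  by (auto intro!: cos_ge_zero)

section \<open>Spectra and descriptors of the three families\<close>

lemma schmidt_spectrum_controlled:
  assumes "\<theta> \<in> {0..pi/4}"
  shows "schmidt_spectrum (controlled \<theta>) = {# (1 + cos (2 * \<theta>)) / 2, 1 - (1 + cos (2 * \<theta>)) / 2, 0, 0 #}"
proof -
  have "cartan_form (controlled \<theta>) \<theta> 0 0"
    unfolding controlled_def using assms by (intro cartan_form_Ud) auto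
  from schmidt_spectrum_eq[OF this] show ?thesis
    unfolding weyl_spectrum_def by (elim ssubst) (intro arg_cong2[where f = add_mset] refl; simp add: field_simps)
qed

lemma schmidt_spectrum_cnot_swap:
  assumes "\<theta> \<in> {0..pi/4}"
  defines "t \<equiv> (1 + (cos (2 * \<theta>))\<^sup>2) / 2"
  shows "schmidt_spectrum (cnot_swap \<theta>) = {# t / 2, t / 2, (1 - t) / 2, (1 - t) / 2 #}"
proof -
  have "cartan_form (cnot_swap \<theta>) (pi / 4) \<theta> \<theta>"
    unfolding cnot_swap_def using assms by (intro cartan_form_Ud) auto
  from schmidt_spectrum_eq[OF this] show ?thesis
    unfolding weyl_spectrum_def t_def
    by (elim ssubst) (intro arg_cong2[where f = add_mset] refl; simp add: field_simps power2_eq_square)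
qed

lemma schmidt_spectrum_fractional_swap:
  assumes "\<theta> \<in> {0..pi/4}"
  defines "x \<equiv> (1 - (cos (2 * \<theta>))\<^sup>2) / 4"
  shows "schmidt_spectrum (fractional_swap \<theta>) = {# 1 - 3 * x, x, x, x #}"
proof -
  have "cartan_form (fractional_swap \<theta>) \<theta> \<theta> \<theta>"
    unfolding fractional_swap_def using assms by (intro cartan_form_Ud) auto
  from schmidt_spectrum_eq[OF this] show ?thesis
    unfolding weyl_spectrum_def x_def
    by (elim ssubst) (intro arg_cong2[where f = add_mset] refl; simp add: field_simps power2_eq_square)
qed

lemma controlled_surj:
  assumes "t \<in> {1/2..1}"
  obtains \<theta> where "\<theta> \<in> {0..pi/4}" "schmidt_spectrum (controlled \<theta>) = {# t, 1 - t, 0, 0 #}"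
proof -
  obtain \<theta> where "\<theta> \<in> {0..pi/4}" "cos (2 * \<theta>) = 2 * t - 1" using cos_double_surj[of "2 * t - 1"] assms by auto
  then show ?thesis using that[of \<theta>] schmidt_spectrum_controlled[of \<theta>] by simp
qed

lemma cnot_swap_surj:
  assumes "t \<in> {1/2..1}"
  obtains \<theta> where "\<theta> \<in> {0..pi/4}" "schmidt_spectrum (cnot_swap \<theta>) = {# t / 2, t / 2, (1 - t) / 2, (1 - t) / 2 #}"
proof -
  obtain \<theta> where \<theta>: "\<theta> \<in> {0..pi/4}" "cos (2 * \<theta>) = sqrt (2 * t - 1)"
    using cos_double_surj[of "sqrt (2 * t - 1)"] assms by auto
  then have "(1 + (cos (2 * \<theta>))\<^sup>2) / 2 = t" using assms by simp
  then show ?thesis using that[OF \<theta>(1)] schmidt_spectrum_cnot_swap[OF \<theta>(1)] by simp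
qed

lemma fractional_swap_surj:
  assumes "0 \<le> x" "x \<le> 1 / 4"
  obtains \<theta> where "\<theta> \<in> {0..pi/4}" "schmidt_spectrum (fractional_swap \<theta>) = {# 1 - 3 * x, x, x, x #}"
proof -
  obtain \<theta> where \<theta>: "\<theta> \<in> {0..pi/4}" "cos (2 * \<theta>) = sqrt (1 - 4 * x)"
    using cos_double_surj[of "sqrt (1 - 4 * x)"] assms by auto
  then have "(1 - (cos (2 * \<theta>))\<^sup>2) / 4 = x" using assms by simp
  then show ?thesis using that[OF \<theta>(1)] schmidt_spectrum_fractional_swap[OF \<theta>(1)] by simp
qed

lemma controlled_image: "(\<lambda>\<theta>. schmidt_spectrum (controlled \<theta>)) ` {0..pi/4} = {P. rank_two_controlled P}"
proof (intro set_eqI iffI)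
  fix P assume "P \<in> (\<lambda>\<theta>. schmidt_spectrum (controlled \<theta>)) ` {0..pi/4}"
  then obtain \<theta> where \<theta>: "\<theta> \<in> {0..pi/4}" "P = schmidt_spectrum (controlled \<theta>)" by blast
  then show "P \<in> {P. rank_two_controlled P}"
    using schmidt_spectrum_controlled[OF \<theta>(1)] cos_double_bounds[OF \<theta>(1)]
    by (auto simp: rank_two_controlled_def intro!: bexI[of _ "(1 + cos (2 * \<theta>)) / 2"])
next
  fix P assume "P \<in> {P. rank_two_controlled P}"
  then obtain t where "t \<in> {1/2..1}" "P = {# t, 1 - t, 0, 0 #}" by (auto simp: rank_two_controlled_def)
  then show "P \<in> (\<lambda>\<theta>. schmidt_spectrum (controlled \<theta>)) ` {0..pi/4}"
    using controlled_surj by (metis imageI)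
qed

lemma cnot_swap_image: "(\<lambda>\<theta>. schmidt_spectrum (cnot_swap \<theta>)) ` {0..pi/4} = {P. pair_pair P}"
proof (intro set_eqI iffI)
  fix P assume "P \<in> (\<lambda>\<theta>. schmidt_spectrum (cnot_swap \<theta>)) ` {0..pi/4}"
  then obtain \<theta> where \<theta>: "\<theta> \<in> {0..pi/4}" "P = schmidt_spectrum (cnot_swap \<theta>)" by blast
  moreover have "(cos (2 * \<theta>))\<^sup>2 \<le> 1" by (simp add: abs_square_le_1)
  ultimately show "P \<in> {P. pair_pair P}"
    using schmidt_spectrum_cnot_swap[OF \<theta>(1)]
    by (auto simp: pair_pair_def intro!: bexI[of _ "(1 + (cos (2 * \<theta>))\<^sup>2) / 2"])
next
  fix P assume "P \<in> {P. pair_pair P}"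
  then obtain t where "t \<in> {1/2..1}" "P = {# t / 2, t / 2, (1 - t) / 2, (1 - t) / 2 #}" by (auto simp: pair_pair_def)
  then show "P \<in> (\<lambda>\<theta>. schmidt_spectrum (cnot_swap \<theta>)) ` {0..pi/4}"
    using cnot_swap_surj by (metis imageI)
qed

lemma rank_two_functionals:
  assumes "schmidt_spectrum U = {# t, 1 - t, 0, 0 #}" "t \<in> {1/2..1}"
  shows "qp_extent U = 1 + 4 * sqrt (t * (1 - t))" "op_entanglement U = 2 * (t * (1 - t))"
    "schmidt_strength U = - neg_entropy2 t / ln 2"
proof -
  have "sqrt_sum4 t (1 - t) 0 0 = sqrt_sum2 t" by (simp add: sqrt_sum4_def sqrt_sum2_def)
  then show "qp_extent U = 1 + 4 * sqrt (t * (1 - t))"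
    using assms spectrum_functionals(1)[OF assms(1)] sqrt_sum2_sq[of t] by simp
  show "op_entanglement U = 2 * (t * (1 - t))"
    unfolding spectrum_functionals(2)[OF assms(1)] by (simp add: power2_eq_square algebra_simps)
  show "schmidt_strength U = - neg_entropy2 t / ln 2"
    unfolding spectrum_functionals(3)[OF assms(1)] by (simp add: xlnx_sum4_def neg_entropy2_def)
qed

lemma pair_pair_functionals:
  assumes "schmidt_spectrum U = {# t / 2, t / 2, (1 - t) / 2, (1 - t) / 2 #}" "t \<in> {1/2..1}"
  shows "qp_extent U = 3 + 8 * sqrt (t * (1 - t))" "op_entanglement U = 1 / 2 + t * (1 - t)"
    "schmidt_strength U = 1 - neg_entropy2 t / ln 2"
proof -
  have "2 * sqrt (s / 2) = sqrt 2 * sqrt s" for s by (simp add: real_sqrt_divide field_simps)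
  from this[of t] this[of "1 - t"] have "sqrt_sum4 (t / 2) (t / 2) ((1 - t) / 2) ((1 - t) / 2) = sqrt 2 * sqrt_sum2 t"
    by (simp add: sqrt_sum4_def sqrt_sum2_def distrib_left)
  then show "qp_extent U = 3 + 8 * sqrt (t * (1 - t))"
    using assms spectrum_functionals(1)[OF assms(1)] sqrt_sum2_sq[of t] by (simp add: power_mult_distrib)
  show "op_entanglement U = 1 / 2 + t * (1 - t)"
    unfolding spectrum_functionals(2)[OF assms(1)] by (simp add: power2_eq_square field_simps)
  have half: "2 * xlnx (s / 2) = xlnx s - s * ln 2" if "0 \<le> s" for s
    using xlnx_mult[of s "1/2"] that by (simp add: xlnx_def ln_div)
  have "xlnx_sum4 (t / 2) (t / 2) ((1 - t) / 2) ((1 - t) / 2) = neg_entropy2 t - ln 2"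
    unfolding xlnx_sum4_def neg_entropy2_def
    using half[of t] half[of "1 - t"] assms(2) by (simp add: algebra_simps)
  then show "schmidt_strength U = 1 - neg_entropy2 t / ln 2"
    unfolding spectrum_functionals(3)[OF assms(1)] by (simp add: diff_divide_distrib)
qed

lemma one_three_functionals:
  assumes "schmidt_spectrum U = {# 1 - 3 * x, x, x, x #}"
  shows "qp_extent U = 2 * (sqrt (1 - 3 * x) + 3 * sqrt x)\<^sup>2 - 1"
    "op_entanglement U = 1 - ((1 - 3 * x)\<^sup>2 + 3 * x\<^sup>2)"
    "schmidt_strength U = - (xlnx (1 - 3 * x) + 3 * xlnx x) / ln 2"
  by (simp_all add: spectrum_functionals[OF assms] sqrt_sum4_def xlnx_sum4_def add.commute)

lemma paired_imp_pair_pair: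
  assumes "paired p0 p1 p2 p3" "p0 + p1 + p2 + p3 = 1" "p1 \<le> p0" "p2 \<le> p0" "p3 \<le> p0"
    "0 \<le> p1" "0 \<le> p2" "0 \<le> p3"
  shows "pair_pair {# p0, p1, p2, p3 #}"
proof -
  obtain q where q: "{# p0, p1, p2, p3 #} = {# p0, p0, q, q #}" "2 * p0 + 2 * q = 1" "q \<le> p0" "0 \<le> q"
  proof -
    from assms(1) consider "p0 = p1" "p2 = p3" | "p0 = p2" "p1 = p3" | "p0 = p3" "p1 = p2"
      by (auto simp: paired_def)
    then show thesis
    proof cases
      case 1 then show thesis using that[of p2] assms by simp
    next
      case 2 then show thesis using that[of p1] assms by (simp add: add_mset_commute)
    next
      case 3 then show thesis using that[of p1] assms by (simp add: add_mset_commute)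
    qed
  qed
  then have t: "2 * p0 \<in> {1/2..1}" and q': "q = (1 - 2 * p0) / 2" by auto
  have "{# p0, p0, q, q #} = {# 2 * p0 / 2, 2 * p0 / 2, (1 - 2 * p0) / 2, (1 - 2 * p0) / 2 #}"
    unfolding q' by simp
  then show ?thesis unfolding pair_pair_def q(1) using t by blast
qed

section \<open>The inverse binary entropy\<close>

lemma h2_eq: "h2 z = - neg_entropy2 z / ln 2"
  by (simp add: h2_def neg_entropy2_def xlnx_def log_def diff_divide_distrib add_divide_distrib)

lemma h2_ex1:
  assumes "u \<in> {0..1}"
  shows "\<exists>!z. z \<in> {1/2..1} \<and> h2 z = u"
proof -
  have "- ln 2 \<le> - u * ln 2" "- u * ln 2 \<le> 0" using assms by (simp_all add: mult_nonneg_nonneg)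
  then obtain z where z: "z \<in> {1/2..1}" "neg_entropy2 z = - u * ln 2" by (rule neg_entropy2_surj)
  show ?thesis
  proof (rule ex1I[of _ z])
    show "z \<in> {1/2..1} \<and> h2 z = u" using z by (simp add: h2_eq)
    fix y assume y: "y \<in> {1/2..1} \<and> h2 y = u"
    then have "neg_entropy2 y = neg_entropy2 z" using z by (simp add: h2_eq field_simps)
    then show "y = z" using neg_entropy2_less_iff[of y z] neg_entropy2_less_iff[of z y] y z by auto
  qed
qed

lemma h2_inv:
  assumes "u \<in> {0..1}"
  shows "h2_inv u \<in> {1/2..1}" "neg_entropy2 (h2_inv u) = - u * ln 2"
proof -
  have *: "h2_inv u \<in> {1/2..1} \<and> h2 (h2_inv u) = u"
    unfolding h2_inv_def by (rule theI'[OF h2_ex1[OF assms]])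
  then show "h2_inv u \<in> {1/2..1}" by simp
  from * have "- neg_entropy2 (h2_inv u) / ln 2 = u" by (simp add: h2_eq)
  then show "neg_entropy2 (h2_inv u) = - u * ln 2" by (simp add: field_simps)
qed

lemma h2_inv_eq: "u \<in> {0..1} \<Longrightarrow> t \<in> {1/2..1} \<Longrightarrow> - neg_entropy2 t / ln 2 = u \<Longrightarrow> h2_inv u = t"
  unfolding h2_inv_def by (rule the1_equality[OF h2_ex1]) (simp_all add: h2_eq)

text \<open>\<open>attaining_spectrum\<close> is an equivalence, hence premises in both directions.
  The extent of the family member follows from its spectrum, so one witness serves both attainment
  claims.\<close>

lemma lower_envelopeI:
  assumes "\<And>U. unitary U \<Longrightarrow> D U = d \<Longrightarrow> g \<le> qp_extent U"
    and "\<And>U. unitary U \<Longrightarrow> D U = d \<Longrightarrow> qp_extent U = g \<Longrightarrow> S (schmidt_spectrum U)"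
    and "\<And>U. D U = d \<Longrightarrow> S (schmidt_spectrum U) \<Longrightarrow> qp_extent U = g"
    and "\<And>\<theta>. unitary (G \<theta>)"
    and "\<theta> \<in> {0..pi/4}" "D (G \<theta>) = d" "S (schmidt_spectrum (G \<theta>))"
  shows "is_gamma_min D d g \<and> attaining_spectrum S D d g \<and> attained_by G D d g"
  unfolding is_gamma_min_def attaining_spectrum_def attained_by_def two_qubit_unitaries_def
  using assms by blast

lemma upper_envelopeI:
  assumes "\<And>U. unitary U \<Longrightarrow> D U = d \<Longrightarrow> qp_extent U \<le> g"
    and "\<And>\<theta>. unitary (G \<theta>)"
    and "\<theta> \<in> {0..pi/4}" "D (G \<theta>) = d" "qp_extent (G \<theta>) = g"
  shows "is_gamma_max D d g \<and> attained_by G D d g"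
  unfolding is_gamma_max_def attained_by_def two_qubit_unitaries_def
  using assms by blast

lemma unitary_families: "unitary (controlled \<theta>)" "unitary (cnot_swap \<theta>)" "unitary (fractional_swap \<theta>)"
  by (simp_all add: controlled_def cnot_swap_def fractional_swap_def unitary_Ud)

section \<open>Envelopes of the operator entanglement\<close>

lemma op_entanglement_lower_rank_two:
  assumes e: "e \<in> {0..1/2}"
  defines "g \<equiv> 1 + 2 * sqrt (2 * e)"
  shows "is_gamma_min op_entanglement e g \<and> attaining_spectrum rank_two_controlled op_entanglement e g \<and>
    attained_by controlled op_entanglement e g"
proof -
  \<comment> \<open>The root of \<open>2 t (1 - t) = e\<close> in [1/2, 1].\<close>
  define t where "t = (1 + sqrt (1 - 2 * e)) / 2"
  have t: "t \<in> {1/2..1}" "2 * (t * (1 - t)) = e"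
    using e by (auto simp: t_def field_simps)
  obtain \<theta> where \<theta>: "\<theta> \<in> {0..pi/4}" "schmidt_spectrum (controlled \<theta>) = {# t, 1 - t, 0, 0 #}"
    using controlled_surj[OF t(1)] .
  show ?thesis
  proof (rule lower_envelopeI[OF _ _ _ unitary_families(1) \<theta>(1)])
    show "op_entanglement (controlled \<theta>) = e" using rank_two_functionals(2)[OF \<theta>(2) t(1)] t by simp
    show "rank_two_controlled (schmidt_spectrum (controlled \<theta>))"
      unfolding rank_two_controlled_def \<theta>(2) using t(1) by blast
  next
    fix U assume "op_entanglement U = e" "rank_two_controlled (schmidt_spectrum U)"
    then obtain s where s: "s \<in> {1/2..1}" "schmidt_spectrum U = {# s, 1 - s, 0, 0 #}"
      by (auto simp: rank_two_controlled_def)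
    have "2 * e = 4 * (s * (1 - s))"
      using rank_two_functionals(2)[OF s(2,1)] \<open>op_entanglement U = e\<close> by simp
    then have "sqrt (2 * e) = 2 * sqrt (s * (1 - s))" by (simp only: real_sqrt_mult) simp
    then show "qp_extent U = g" using rank_two_functionals(1)[OF s(2,1)] by (simp add: g_def)
  next
    fix U assume U: "unitary U" "op_entanglement U = e"
    obtain p0 p1 p2 p3 where p: "schmidt_spectrum U = {# p0, p1, p2, p3 #}"
      and ord: "p3 \<le> p2" "p2 \<le> p1" "p1 \<le> p0" "0 \<le> p3" and sum: "p0 + p1 + p2 + p3 = 1"
      and "dominant p0 p1 p2 p3"
      by (rule two_qubit_probabilities[OF U(1)])
    have E: "e = 1 - (p0\<^sup>2 + p1\<^sup>2 + p2\<^sup>2 + p3\<^sup>2)" using spectrum_functionals(2)[OF p] U(2) by simp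
    have G: "qp_extent U = 2 * (sqrt p0 + sqrt p1 + sqrt p2 + sqrt p3)\<^sup>2 - 1"
      using spectrum_functionals(1)[OF p] by (simp add: sqrt_sum4_def)
    show "g \<le> qp_extent U" unfolding g_def E G by (rule sum_sqrt_lower_rank_two(1)[OF ord sum])
    assume "qp_extent U = g"
    then have "p2 = 0 \<and> p3 = 0" unfolding g_def E G by (rule sum_sqrt_lower_rank_two(2)[OF ord sum])
    then have "p0 \<in> {1/2..1}" "schmidt_spectrum U = {# p0, 1 - p0, 0, 0 #}" using p ord sum by auto
    then show "rank_two_controlled (schmidt_spectrum U)" by (auto simp: rank_two_controlled_def)
  qed
qed

lemma op_entanglement_lower_pair_pair:
  assumes e: "e \<in> {1/2..3/4}"
  defines "g \<equiv> 3 + 4 * sqrt (4 * e - 2)"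
  shows "is_gamma_min op_entanglement e g \<and> attaining_spectrum pair_pair op_entanglement e g \<and>
    attained_by cnot_swap op_entanglement e g"
proof -
  \<comment> \<open>The root of \<open>1/2 + t (1 - t) = e\<close> in [1/2, 1].\<close>
  define t where "t = (1 + sqrt (3 - 4 * e)) / 2"
  have t: "t \<in> {1/2..1}" "1 / 2 + t * (1 - t) = e"
    using e by (auto simp: t_def field_simps)
  obtain \<theta> where \<theta>: "\<theta> \<in> {0..pi/4}" "schmidt_spectrum (cnot_swap \<theta>) = {# t / 2, t / 2, (1 - t) / 2, (1 - t) / 2 #}"
    using cnot_swap_surj[OF t(1)] .
  show ?thesis
  proof (rule lower_envelopeI[OF _ _ _ unitary_families(2) \<theta>(1)])
    show "op_entanglement (cnot_swap \<theta>) = e" using pair_pair_functionals(2)[OF \<theta>(2) t(1)] t by simp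
    show "pair_pair (schmidt_spectrum (cnot_swap \<theta>))"
      unfolding pair_pair_def \<theta>(2) using t(1) by blast
  next
    fix U assume "op_entanglement U = e" "pair_pair (schmidt_spectrum U)"
    then obtain s where s: "s \<in> {1/2..1}" "schmidt_spectrum U = {# s / 2, s / 2, (1 - s) / 2, (1 - s) / 2 #}"
      by (auto simp: pair_pair_def)
    have "4 * e - 2 = 4 * (s * (1 - s))"
      using pair_pair_functionals(2)[OF s(2,1)] \<open>op_entanglement U = e\<close> by simp
    then have "sqrt (4 * e - 2) = 2 * sqrt (s * (1 - s))" by (simp only: real_sqrt_mult) simp
    then show "qp_extent U = g" using pair_pair_functionals(1)[OF s(2,1)] by (simp add: g_def)
  next
    fix U assume U: "unitary U" "op_entanglement U = e"
    obtain A B C where ABC: "0 \<le> C" "C \<le> B" "B \<le> A" "A \<le> 1" "A * B \<le> C" "0 \<le> 1 - A - B + C"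
      and spec: "schmidt_spectrum U = {# (1 + A + B + C) / 4, (1 + A - B - C) / 4, (1 - A + B - C) / 4, (1 - A - B + C) / 4 #}"
      using two_qubit_spectrum[OF U(1)] .
    \<comment> \<open>Parseval for the sign transform: the sum of squares of the spectrum is
      \<open>(1 + A^2 + B^2 + C^2) / 4\<close>.\<close>
    have E: "4 * e - 2 = 1 - (A\<^sup>2 + B\<^sup>2 + C\<^sup>2)"
      using spectrum_functionals(2)[OF spec] U(2) by (simp add: power2_eq_square field_simps)
    have S: "A\<^sup>2 + B\<^sup>2 + C\<^sup>2 \<le> 1" using E e by simp
    have nn: "0 \<le> 1 - A + B - C" "0 \<le> 1 - A - B + C" using ABC by simp_all
    note bound = sum_sqrt_lower_pair_pair[OF ABC(1,2,3,5) S nn]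
    have G: "qp_extent U = 2 * (sqrt ((1 + A + B + C) / 4) + sqrt ((1 + A - B - C) / 4)
      + sqrt ((1 - A + B - C) / 4) + sqrt ((1 - A - B + C) / 4))\<^sup>2 - 1"
      using spectrum_functionals(1)[OF spec] by (simp only: sqrt_sum4_def)
    show "g \<le> qp_extent U" unfolding g_def E G by (rule bound(1))
    assume "qp_extent U = g"
    then have "B = 0 \<and> C = 0" unfolding g_def E G by (rule bound(2))
    then have "schmidt_spectrum U = {# (1 + A) / 2 / 2, (1 + A) / 2 / 2, (1 - (1 + A) / 2) / 2, (1 - (1 + A) / 2) / 2 #}"
      unfolding spec by (simp add: field_simps)
    moreover have "(1 + A) / 2 \<in> {1/2..1}" using ABC by simp
    ultimately show "pair_pair (schmidt_spectrum U)" unfolding pair_pair_def by blast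
  qed
qed

lemma op_entanglement_upper:
  assumes e: "e \<in> {0..3/4}"
  defines "q \<equiv> sqrt (1 - 4 / 3 * e)"
  defines "g \<equiv> 4 - 3 * q + 3 * sqrt ((1 - q) * (1 + 3 * q))"
  shows "is_gamma_max op_entanglement e g \<and> attained_by fractional_swap op_entanglement e g"
proof -
  have q: "0 \<le> q" "q \<le> 1" "q\<^sup>2 = 1 - 4 / 3 * e" using e by (auto simp: q_def)
  \<comment> \<open>With this \<open>x\<close> the squares of \<open>1 - 3 x, x, x, x\<close> add up
    to \<open>(1 + 3 q^2) / 4\<close>, which has to be \<open>1 - e\<close>; this is the origin of
    \<open>q\<close>.\<close>
  define x where "x = (1 - q) / 4"
  have x: "0 \<le> x" "x \<le> 1 / 4" "1 - 3 * x = (1 + 3 * q) / 4" using q by (auto simp: x_def field_simps)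
  have sq: "(1 - 3 * x)\<^sup>2 + 3 * x\<^sup>2 = 1 - e"
  proof -
    have "(1 - 3 * x)\<^sup>2 + 3 * x\<^sup>2 = (1 + 3 * q\<^sup>2) / 4" by (simp add: x_def power2_eq_square field_simps)
    then show ?thesis by (simp add: q(3))
  qed
  have g: "2 * (sqrt (1 - 3 * x) + 3 * sqrt x)\<^sup>2 - 1 = g"
  proof -
    have "sqrt (1 - 3 * x) * sqrt x = sqrt ((1 - q) * (1 + 3 * q)) / 4"
      unfolding x(3) unfolding x_def by (simp add: real_sqrt_mult real_sqrt_divide)
    moreover have "(sqrt (1 - 3 * x) + 3 * sqrt x)\<^sup>2 = (1 - 3 * x) + 9 * x + 6 * (sqrt (1 - 3 * x) * sqrt x)"
      using x(1,2) by (simp add: power2_sum power_mult_distrib)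
    ultimately show ?thesis by (simp add: g_def x_def field_simps)
  qed
  obtain \<theta> where \<theta>: "\<theta> \<in> {0..pi/4}" "schmidt_spectrum (fractional_swap \<theta>) = {# 1 - 3 * x, x, x, x #}"
    using fractional_swap_surj[OF x(1,2)] .
  show ?thesis
  proof (rule upper_envelopeI[OF _ unitary_families(3) \<theta>(1)])
    show "op_entanglement (fractional_swap \<theta>) = e" "qp_extent (fractional_swap \<theta>) = g"
      using one_three_functionals[OF \<theta>(2)] sq g by simp_all
    fix U assume U: "unitary U" "op_entanglement U = e"
    obtain p0 p1 p2 p3 where p: "schmidt_spectrum U = {# p0, p1, p2, p3 #}"
      and ord: "p3 \<le> p2" "p2 \<le> p1" "p1 \<le> p0" "0 \<le> p3" and sum: "p0 + p1 + p2 + p3 = 1"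
      and "dominant p0 p1 p2 p3"
      by (rule two_qubit_probabilities[OF U(1)])
    have sq': "p0\<^sup>2 + p1\<^sup>2 + p2\<^sup>2 + p3\<^sup>2 = (1 - 3 * x)\<^sup>2 + 3 * x\<^sup>2"
      using spectrum_functionals(2)[OF p] U(2) sq by linarith
    have "sqrt p0 + sqrt p1 + sqrt p2 + sqrt p3 \<le> sqrt (1 - 3 * x) + 3 * sqrt x"
      by (rule sum_sqrt_upper_one_three[OF _ _ _ _ _ _ sum _ _ _ sq']) (use ord x(1,2) in linarith)+
    then have "(sqrt p0 + sqrt p1 + sqrt p2 + sqrt p3)\<^sup>2 \<le> (sqrt (1 - 3 * x) + 3 * sqrt x)\<^sup>2"
      using ord by (intro power_mono) auto
    then show "qp_extent U \<le> g" unfolding g[symmetric] spectrum_functionals(1)[OF p] sqrt_sum4_def by simp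
  qed
qed

section \<open>Envelopes of the Schmidt strength\<close>

lemma schmidt_strength_lower_rank_two:
  assumes k: "k \<in> {0..1}"
  defines "g \<equiv> 1 + 4 * sqrt (h2_inv k * (1 - h2_inv k))"
  shows "is_gamma_min schmidt_strength k g \<and> attaining_spectrum rank_two_controlled schmidt_strength k g \<and>
    attained_by controlled schmidt_strength k g"
proof -
  define z where "z = h2_inv k"
  have z: "z \<in> {1/2..1}" "neg_entropy2 z = - k * ln 2" unfolding z_def by (rule h2_inv[OF k])+
  have g: "g = 2 * (sqrt_sum2 z)\<^sup>2 - 1" using z(1) by (simp add: g_def z_def[symmetric] sqrt_sum2_sq)
  obtain \<theta> where \<theta>: "\<theta> \<in> {0..pi/4}" "schmidt_spectrum (controlled \<theta>) = {# z, 1 - z, 0, 0 #}"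
    using controlled_surj[OF z(1)] .
  show ?thesis
  proof (rule lower_envelopeI[OF _ _ _ unitary_families(1) \<theta>(1)])
    show "schmidt_strength (controlled \<theta>) = k" using rank_two_functionals(3)[OF \<theta>(2) z(1)] z(2) by simp
    show "rank_two_controlled (schmidt_spectrum (controlled \<theta>))"
      unfolding rank_two_controlled_def \<theta>(2) using z(1) by blast
  next
    fix U assume "schmidt_strength U = k" "rank_two_controlled (schmidt_spectrum U)"
    then obtain s where s: "s \<in> {1/2..1}" "schmidt_spectrum U = {# s, 1 - s, 0, 0 #}"
      by (auto simp: rank_two_controlled_def)
    have "h2_inv k = s"
      using h2_inv_eq[OF k s(1)] rank_two_functionals(3)[OF s(2,1)] \<open>schmidt_strength U = k\<close> by simp
    then show "qp_extent U = g" using rank_two_functionals(1)[OF s(2,1)] by (simp add: g_def)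
  next
    fix U assume U: "unitary U" "schmidt_strength U = k"
    obtain p0 p1 p2 p3 where p: "schmidt_spectrum U = {# p0, p1, p2, p3 #}"
      and ord: "p3 \<le> p2" "p2 \<le> p1" "p1 \<le> p0" "0 \<le> p3" and sum: "p0 + p1 + p2 + p3 = 1"
      and "dominant p0 p1 p2 p3"
      by (rule two_qubit_probabilities[OF U(1)])
    have ent: "xlnx p0 + xlnx p1 + xlnx p2 + xlnx p3 = neg_entropy2 z"
      using spectrum_functionals(3)[OF p] U(2) z(2) by (simp add: xlnx_sum4_def field_simps)
    note bound = sum_sqrt_lower_entropy_rank_two[OF ord sum z(1) ent]
    have Q: "qp_extent U = 2 * (sqrt p0 + sqrt p1 + sqrt p2 + sqrt p3)\<^sup>2 - 1"
      using spectrum_functionals(1)[OF p] by (simp add: sqrt_sum4_def)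
    have pos: "0 < sqrt_sum2 z" using z(1) by (intro sqrt_sum2_pos) auto
    show "g \<le> qp_extent U" unfolding g Q using bound(1) pos by (simp add: power_mono)
    assume "qp_extent U = g"
    then have "(sqrt p0 + sqrt p1 + sqrt p2 + sqrt p3)\<^sup>2 = (sqrt_sum2 z)\<^sup>2" by (simp add: g Q)
    then have "sqrt p0 + sqrt p1 + sqrt p2 + sqrt p3 = sqrt_sum2 z"
      by (rule power2_eq_imp_eq) (use ord pos in simp_all)
    then have "p2 = 0 \<and> p3 = 0" by (rule bound(2))
    then have "p0 \<in> {1/2..1}" "schmidt_spectrum U = {# p0, 1 - p0, 0, 0 #}" using p ord sum by auto
    then show "rank_two_controlled (schmidt_spectrum U)" by (auto simp: rank_two_controlled_def)
  qed
qed

lemma schmidt_strength_lower_pair_pair: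
  assumes k: "k \<in> {1..2}"
  defines "g \<equiv> 3 + 8 * sqrt (h2_inv (k - 1) * (1 - h2_inv (k - 1)))"
  shows "is_gamma_min schmidt_strength k g \<and> attaining_spectrum pair_pair schmidt_strength k g \<and>
    attained_by cnot_swap schmidt_strength k g"
proof -
  have k': "k - 1 \<in> {0..1}" using k by auto
  define z where "z = h2_inv (k - 1)"
  have z: "z \<in> {1/2..1}" "neg_entropy2 z = - (k - 1) * ln 2" unfolding z_def by (rule h2_inv[OF k'])+
  have g: "g = 2 * (sqrt 2 * sqrt_sum2 z)\<^sup>2 - 1"
    using z(1) by (simp add: g_def z_def[symmetric] sqrt_sum2_sq power_mult_distrib)
  obtain \<theta> where \<theta>: "\<theta> \<in> {0..pi/4}" "schmidt_spectrum (cnot_swap \<theta>) = {# z / 2, z / 2, (1 - z) / 2, (1 - z) / 2 #}"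
    using cnot_swap_surj[OF z(1)] .
  show ?thesis
  proof (rule lower_envelopeI[OF _ _ _ unitary_families(2) \<theta>(1)])
    show "schmidt_strength (cnot_swap \<theta>) = k" using pair_pair_functionals(3)[OF \<theta>(2) z(1)] z(2) by simp
    show "pair_pair (schmidt_spectrum (cnot_swap \<theta>))"
      unfolding pair_pair_def \<theta>(2) using z(1) by blast
  next
    fix U assume "schmidt_strength U = k" "pair_pair (schmidt_spectrum U)"
    then obtain s where s: "s \<in> {1/2..1}" "schmidt_spectrum U = {# s / 2, s / 2, (1 - s) / 2, (1 - s) / 2 #}"
      by (auto simp: pair_pair_def)
    have "h2_inv (k - 1) = s"
      using h2_inv_eq[OF k' s(1)] pair_pair_functionals(3)[OF s(2,1)] \<open>schmidt_strength U = k\<close> by simp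
    then show "qp_extent U = g" using pair_pair_functionals(1)[OF s(2,1)] by (simp add: g_def)
  next
    fix U assume U: "unitary U" "schmidt_strength U = k"
    obtain p0 p1 p2 p3 where p: "schmidt_spectrum U = {# p0, p1, p2, p3 #}"
      and "p3 \<le> p2" "p2 \<le> p1" "p1 \<le> p0" "0 \<le> p3" "p0 + p1 + p2 + p3 = 1"
      and dom: "dominant p0 p1 p2 p3"
      by (rule two_qubit_probabilities[OF U(1)])
    have ent: "xlnx_sum4 p0 p1 p2 p3 = neg_entropy2 z - ln 2"
      using spectrum_functionals(3)[OF p] U(2) z(2) by (simp add: field_simps)
    have ge: "sqrt 2 * sqrt_sum2 z \<le> sqrt_sum4 p0 p1 p2 p3"
      using ent by (intro sqrt_sum4_ge_pair_pair[OF dom z(1)]) simp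
    have pos: "0 < sqrt 2 * sqrt_sum2 z" using sqrt_sum2_pos[of z] z(1) by simp
    show "g \<le> qp_extent U" unfolding g spectrum_functionals(1)[OF p]
      using power_mono[OF ge, of 2] pos by simp
    assume "qp_extent U = g"
    then have "(sqrt_sum4 p0 p1 p2 p3)\<^sup>2 = (sqrt 2 * sqrt_sum2 z)\<^sup>2" by (simp add: g spectrum_functionals(1)[OF p])
    then have "sqrt_sum4 p0 p1 p2 p3 = sqrt 2 * sqrt_sum2 z"
      by (rule power2_eq_imp_eq) (use ge pos in linarith)+
    from sum_sqrt_lower_entropy_pair_pair[OF dom z(1) ent this]
    show "pair_pair (schmidt_spectrum U)"
      unfolding p by (rule paired_imp_pair_pair) (use dom in \<open>auto simp: dominant_def\<close>)
  qed
qed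

text \<open>Chain rule for the entropy of \<open>1 - 3x/4, x/4, x/4, x/4\<close>: the binary choice
  between the single outcome and the group of three, plus \<open>log 2 3\<close> bits inside the
  group.\<close>

lemma K_FS_eq: "0 \<le> x \<Longrightarrow> K_FS x = - (xlnx (1 - 3 * (x / 4)) + 3 * xlnx (x / 4)) / ln 2"
  using xlnx_mult[of 3 "x / 4"]
  by (simp add: K_FS_def h2_eq neg_entropy2_def log_def xlnx_def[of 3] add_divide_distrib diff_divide_distrib)

lemma gamma_FS_eq:
  assumes "x \<in> {0..1}"
  shows "gamma_FS x = 2 * (sqrt (1 - 3 * (x / 4)) + 3 * sqrt (x / 4))\<^sup>2 - 1"
proof -
  have m: "sqrt (1 - 3 * (x / 4)) * sqrt (x / 4) = sqrt (x * (4 - 3 * x)) / 4"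
  proof -
    have "(1 - 3 * (x / 4)) * (x / 4) = x * (4 - 3 * x) / 16" by (simp add: field_simps)
    then show ?thesis by (simp only: real_sqrt_mult[symmetric]) (simp add: real_sqrt_divide)
  qed
  have "(sqrt (1 - 3 * (x / 4)) + 3 * sqrt (x / 4))\<^sup>2
      = (1 - 3 * (x / 4)) + 9 * (x / 4) + 6 * (sqrt (1 - 3 * (x / 4)) * sqrt (x / 4))"
    using assms by (simp add: power2_sum power_mult_distrib)
  then show ?thesis unfolding gamma_FS_def m by (simp add: field_simps)
qed

lemma K_FS_strict_mono: "strict_mono_on {0..1} K_FS"
proof (rule strict_mono_onI)
  fix x y :: real assume xy: "x \<in> {0..1}" "y \<in> {0..1}" "x < y"
  have "xlnx (1 - 3 * (y / 4)) + 3 * xlnx ((1 - (1 - 3 * (y / 4))) / 3)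
      < xlnx (1 - 3 * (x / 4)) + 3 * xlnx ((1 - (1 - 3 * (x / 4))) / 3)"
    using xy by (intro xlnx_one_three_strict_mono) auto
  then show "K_FS x < K_FS y" using xy by (simp add: K_FS_eq divide_strict_right_mono)
qed

lemma K_FS_0: "K_FS 0 = 0" and K_FS_1: "K_FS 1 = 2"
proof -
  show "K_FS 0 = 0" by (simp add: K_FS_eq)
  have "ln 4 = 2 * ln (2::real)" using ln_realpow[of 2 2] by simp
  then show "K_FS 1 = 2" by (simp add: K_FS_eq xlnx_def ln_div)
qed

lemma K_FS_image: "K_FS ` {0..1} = {0..2}"
proof (intro set_eqI iffI)
  fix k assume "k \<in> K_FS ` {0..1}"
  then obtain x where x: "x \<in> {0..1}" "k = K_FS x" by blast
  then have "K_FS 0 \<le> K_FS x" "K_FS x \<le> K_FS 1"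
    using strict_mono_on_leD[OF K_FS_strict_mono] by auto
  then show "k \<in> {0..2}" using x by (simp add: K_FS_0 K_FS_1)
next
  fix k :: real assume k: "k \<in> {0..2}"
  have "continuous_on {0..1} (\<lambda>x. - (xlnx (1 - 3 * (x / 4)) + 3 * xlnx (x / 4)) / ln 2)"
    by (intro continuous_intros) auto
  then have "continuous_on {0..1} K_FS"
    by (rule continuous_on_eq) (simp add: K_FS_eq)
  then show "k \<in> K_FS ` {0..1}"
    using IVT'[of K_FS 0 k 1] k by (force simp: K_FS_0 K_FS_1)
qed

text \<open>The interpolation needs distinct positive nodes \<open>x/4\<close> and
  \<open>1 - 3x/4\<close>; the endpoints are the point spectrum and the uniform one, where direct
  arguments apply.\<close>

lemma sum_sqrt_upper_entropy_full:
  assumes ord: "p3 \<le> p2" "p2 \<le> p1" "p1 \<le> p0" "0 \<le> p3" and sum: "p0 + p1 + p2 + p3 = 1"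
    and x: "x \<in> {0..1}" and ent: "xlnx p0 + xlnx p1 + xlnx p2 + xlnx p3 = xlnx (1 - 3 * (x / 4)) + 3 * xlnx (x / 4)"
  shows "sqrt p0 + sqrt p1 + sqrt p2 + sqrt p3 \<le> sqrt (1 - 3 * (x / 4)) + 3 * sqrt (x / 4)"
proof -
  have nn: "0 \<le> p0" "0 \<le> p1" "0 \<le> p2" "0 \<le> p3" using ord by linarith+
  consider "x = 0" | "x = 1" | "0 < x" "x < 1" using x by force
  then show ?thesis
  proof cases
    case 1
    \<comment> \<open>On [0, 1] \<open>xlnx\<close> vanishes only at 0 and 1, the fixed points of
      \<open>sqrt\<close>.\<close>
    have neg: "xlnx p \<le> 0" "xlnx p = 0 \<Longrightarrow> sqrt p = p" if "0 \<le> p" "p \<le> 1" for p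
      using that by (cases "p = 0"; simp add: xlnx_def mult_le_0_iff)+
    have le: "p0 \<le> 1" "p1 \<le> 1" "p2 \<le> 1" "p3 \<le> 1" using nn sum by linarith+
    have "xlnx p0 + xlnx p1 + xlnx p2 + xlnx p3 = 0" using ent 1 by simp
    then have "xlnx p0 = 0" "xlnx p1 = 0" "xlnx p2 = 0" "xlnx p3 = 0"
      using neg(1)[OF nn(1) le(1)] neg(1)[OF nn(2) le(2)] neg(1)[OF nn(3) le(3)] neg(1)[OF nn(4) le(4)]
      by linarith+
    then have "sqrt p0 = p0" "sqrt p1 = p1" "sqrt p2 = p2" "sqrt p3 = p3"
      using neg(2)[OF nn(1) le(1)] neg(2)[OF nn(2) le(2)] neg(2)[OF nn(3) le(3)] neg(2)[OF nn(4) le(4)]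
      by auto
    then show ?thesis using sum 1 by simp
  next
    case 2
    \<comment> \<open>Tangent to the square root at the uniform value 1/4.\<close>
    have "sqrt p \<le> p + 1 / 4" if "0 \<le> p" for p
    proof -
      have "0 \<le> (sqrt p - 1 / 2)\<^sup>2" by simp
      also have "\<dots> = p - sqrt p + 1 / 4" using that by (simp add: power2_diff power_divide)
      finally show ?thesis by simp
    qed
    from this[OF nn(1)] this[OF nn(2)] this[OF nn(3)] this[OF nn(4)]
    have "sqrt p0 + sqrt p1 + sqrt p2 + sqrt p3 \<le> 2" using sum by linarith
    also have "2 = sqrt (1 - 3 * (x / 4)) + 3 * sqrt (x / 4)" using 2 by (simp add: real_sqrt_divide)
    finally show ?thesis .
  next
    case 3
    then show ?thesis using ord nn sum ent by (intro sum_sqrt_upper_entropy(1)) auto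
  qed
qed

lemma schmidt_strength_upper:
  assumes x: "x \<in> {0..1}"
  shows "is_gamma_max schmidt_strength (K_FS x) (gamma_FS x) \<and>
    attained_by fractional_swap schmidt_strength (K_FS x) (gamma_FS x)"
proof -
  have x': "0 \<le> x / 4" "x / 4 \<le> 1 / 4" using x by auto
  obtain \<theta> where \<theta>: "\<theta> \<in> {0..pi/4}" "schmidt_spectrum (fractional_swap \<theta>) = {# 1 - 3 * (x / 4), x / 4, x / 4, x / 4 #}"
    using fractional_swap_surj[OF x'] .
  show ?thesis
  proof (rule upper_envelopeI[OF _ unitary_families(3) \<theta>(1)])
    show "schmidt_strength (fractional_swap \<theta>) = K_FS x"
      using one_three_functionals(3)[OF \<theta>(2)] x by (simp only: K_FS_eq atLeastAtMost_iff)
    show "qp_extent (fractional_swap \<theta>) = gamma_FS x"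
      unfolding one_three_functionals(1)[OF \<theta>(2)] gamma_FS_eq[OF x] ..
    fix U assume U: "unitary U" "schmidt_strength U = K_FS x"
    obtain p0 p1 p2 p3 where p: "schmidt_spectrum U = {# p0, p1, p2, p3 #}"
      and ord: "p3 \<le> p2" "p2 \<le> p1" "p1 \<le> p0" "0 \<le> p3" and sum: "p0 + p1 + p2 + p3 = 1"
      and "dominant p0 p1 p2 p3"
      by (rule two_qubit_probabilities[OF U(1)])
    have "xlnx_sum4 p0 p1 p2 p3 = xlnx (1 - 3 * (x / 4)) + 3 * xlnx (x / 4)"
    proof -
      have "- xlnx_sum4 p0 p1 p2 p3 / ln 2 = - (xlnx (1 - 3 * (x / 4)) + 3 * xlnx (x / 4)) / ln 2"
        using spectrum_functionals(3)[OF p] U(2) K_FS_eq[of x] x by simp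
      then show ?thesis by (simp del: mult_minus_right minus_add_distrib)
    qed
    then have "sqrt_sum4 p0 p1 p2 p3 \<le> sqrt (1 - 3 * (x / 4)) + 3 * sqrt (x / 4)"
      unfolding sqrt_sum4_def xlnx_sum4_def by (intro sum_sqrt_upper_entropy_full[OF ord sum x])
    moreover have "0 \<le> sqrt_sum4 p0 p1 p2 p3" unfolding sqrt_sum4_def using ord by simp
    ultimately have "(sqrt_sum4 p0 p1 p2 p3)\<^sup>2 \<le> (sqrt (1 - 3 * (x / 4)) + 3 * sqrt (x / 4))\<^sup>2"
      by (rule power_mono)
    then show "qp_extent U \<le> gamma_FS x"
      unfolding spectrum_functionals(1)[OF p] gamma_FS_eq[OF x] by simp
  qed
qed

theorem theorem2:
  shows
    "((\<lambda>\<theta>. schmidt_spectrum (controlled \<theta>)) ` {0..pi/4} = {P. rank_two_controlled P} \<and>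
      (\<lambda>\<theta>. schmidt_spectrum (cnot_swap \<theta>)) ` {0..pi/4} = {P. pair_pair P}) \<and>

     ((\<forall>e\<in>{0..1/2}. let g = 1 + 2 * sqrt (2 * e) in
         is_gamma_min op_entanglement e g \<and>
         attaining_spectrum rank_two_controlled op_entanglement e g \<and>
         attained_by controlled op_entanglement e g) \<and>
      (\<forall>e\<in>{1/2..3/4}. let g = 3 + 4 * sqrt (4 * e - 2) in
         is_gamma_min op_entanglement e g \<and>
         attaining_spectrum pair_pair op_entanglement e g \<and>
         attained_by cnot_swap op_entanglement e g) \<and>
      (\<forall>e\<in>{0..3/4}. let q = sqrt (1 - 4 / 3 * e);
           g = 4 - 3 * q + 3 * sqrt ((1 - q) * (1 + 3 * q)) in
         is_gamma_max op_entanglement e g \<and>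
         attained_by fractional_swap op_entanglement e g)) \<and>

     ((\<forall>u\<in>{0..1}. \<exists>!z. z \<in> {1/2..1} \<and> h2 z = u) \<and>
      (\<forall>k\<in>{0..1}. let g = 1 + 4 * sqrt (h2_inv k * (1 - h2_inv k)) in
         is_gamma_min schmidt_strength k g \<and>
         attaining_spectrum rank_two_controlled schmidt_strength k g \<and>
         attained_by controlled schmidt_strength k g) \<and>
      (\<forall>k\<in>{1..2}. let g = 3 + 8 * sqrt (h2_inv (k - 1) * (1 - h2_inv (k - 1))) in
         is_gamma_min schmidt_strength k g \<and>
         attaining_spectrum pair_pair schmidt_strength k g \<and>
         attained_by cnot_swap schmidt_strength k g) \<and>
      (\<forall>x\<in>{0..1}.
         is_gamma_max schmidt_strength (K_FS x) (gamma_FS x) \<and>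
         attained_by fractional_swap schmidt_strength (K_FS x) (gamma_FS x)) \<and>
      strict_mono_on {0..1} K_FS \<and>
      K_FS ` {0..1} = {0..2})"
  unfolding Let_def
  by (intro conjI ballI controlled_image cnot_swap_image h2_ex1 K_FS_strict_mono K_FS_image
      op_entanglement_lower_rank_two[THEN conjunct1] op_entanglement_lower_rank_two[THEN conjunct2, THEN conjunct1]
      op_entanglement_lower_rank_two[THEN conjunct2, THEN conjunct2]
      op_entanglement_lower_pair_pair[THEN conjunct1] op_entanglement_lower_pair_pair[THEN conjunct2, THEN conjunct1]
      op_entanglement_lower_pair_pair[THEN conjunct2, THEN conjunct2]
      op_entanglement_upper[THEN conjunct1] op_entanglement_upper[THEN conjunct2]
      schmidt_strength_lower_rank_two[THEN conjunct1] schmidt_strength_lower_rank_two[THEN conjunct2, THEN conjunct1]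
      schmidt_strength_lower_rank_two[THEN conjunct2, THEN conjunct2]
      schmidt_strength_lower_pair_pair[THEN conjunct1] schmidt_strength_lower_pair_pair[THEN conjunct2, THEN conjunct1]
      schmidt_strength_lower_pair_pair[THEN conjunct2, THEN conjunct2]
      schmidt_strength_upper[THEN conjunct1] schmidt_strength_upper[THEN conjunct2])

end
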